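(* Let $N\subset M$ be an inclusion of II$_1$ factors of finite Jones index, with Jones projection $\mathsf p$, and let ${\cal O}(\mathsf p)=\{u\mathsf p u^*: u\in U_M\}$. Then ${\cal O}(\mathsf p)$ is a complete metric space with the Riemannian (geodesic) distance $d_M$ induced by the trace inner product.
   Context: Let $N\subset M$ be II$_1$ factors with finite index $[M:N]=\lambda^{-1}$, $\tau$ the normalized trace of $M$ (and of $N$), $\mathsf p:L^2(M,\tau)\to L^2(N,\tau)$ the Jones (orthogonal) projection, and $M_1$ the von Neumann algebra of operators on $L^2(M,\tau)$ generated by $M$ and $\mathsf p$. $M_1$ is a II$_1$ factor whose normalized trace, also denoted $\tau$, restricts to the traces of $M$ and $N$. $U_A$ denotes the unitary group of a von Neumann algebra $A$; $\|\cdot\|$ is the operator norm and $\|x\|_2=\tau(x^*x)^{1/2}$. The orbit ${\cal O}(\mathsf p)\subset M_1$ is a smooth submanifold (in the operator norm structure) of the set ${\cal P}(M_1)$ of selfadjoint projections of $M_1$, with tangent spaces $(T{\cal O}(\mathsf p))_q=\{xq-qx: x\in M,\ x^*=-x\}$, and it carries the weak Riemannian metric $\langle x,y\rangle=\tau(y^*x)$ on each tangent space. "Smooth" always refers to the norm structure. For a piecewise smooth curve $\gamma:[0,1]\to{\cal O}(\mathsf p)$, $L_2(\gamma)=\int_0^1\|\dot\gamma(t)\|_2\,dt$, and $d_M(p_1,p_2)$ is the infimum of $L_2(\gamma)$ over piecewise smooth curves $\gamma$ in ${\cal O}(\mathsf p)$ joining $p_1$ to $p_2$. *)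

theory Defs
  imports "HOL-Analysis.Analysis"
begin

(* The inner product is linear in the first variable, so that <x,y> = tau(y* x). *)
class complex_hilbert = real_inner + banach +
  fixes scaleC :: "complex \<Rightarrow> 'a \<Rightarrow> 'a" (infixr "*\<^sub>C" 75)
    and cinner :: "'a \<Rightarrow> 'a \<Rightarrow> complex"
  assumes scaleC_add_right: "c *\<^sub>C (x + y) = c *\<^sub>C x + c *\<^sub>C y"
    and scaleC_add_left: "(c + d) *\<^sub>C x = c *\<^sub>C x + d *\<^sub>C x"
    and scaleC_scaleC: "c *\<^sub>C (d *\<^sub>C x) = (c * d) *\<^sub>C x"
    and scaleC_of_real: "complex_of_real r *\<^sub>C x = r *\<^sub>R x"
    and cinner_add_left: "cinner (x + y) z = cinner x z + cinner y z"
    and cinner_scaleC_left: "cinner (c *\<^sub>C x) y = c * cinner x y"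
    and cinner_commute: "cinner y x = cnj (cinner x y)"
    and inner_eq_Re_cinner: "inner x y = Re (cinner x y)"


text \<open>The library type of bounded real-linear maps is the ambient Banach space (its norm is
  the operator norm); B(H) is the subset of complex-linear maps.\<close>

definition cbounded_ops :: "('h::complex_hilbert \<Rightarrow>\<^sub>L 'h) set" where
  "cbounded_ops = {T. \<forall>c x. blinfun_apply T (c *\<^sub>C x) = c *\<^sub>C blinfun_apply T x}"

definition scalar_op :: "complex \<Rightarrow> 'h::complex_hilbert \<Rightarrow>\<^sub>L 'h" where
  "scalar_op c = Blinfun (\<lambda>x. c *\<^sub>C x)"

definition adj :: "('h::complex_hilbert \<Rightarrow>\<^sub>L 'h) \<Rightarrow> 'h \<Rightarrow>\<^sub>L 'h" where
  "adj T = (THE S. \<forall>x y. cinner (blinfun_apply T x) y = cinner x (blinfun_apply S y))"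

definition commutant :: "('h::complex_hilbert \<Rightarrow>\<^sub>L 'h) set \<Rightarrow> ('h \<Rightarrow>\<^sub>L 'h) set" where
  "commutant S = {T \<in> cbounded_ops. \<forall>A\<in>S. T o\<^sub>L A = A o\<^sub>L T}"

definition von_neumann_algebra :: "('h::complex_hilbert \<Rightarrow>\<^sub>L 'h) set \<Rightarrow> bool" where
  "von_neumann_algebra A \<longleftrightarrow>
     A \<subseteq> cbounded_ops \<and> (\<forall>x\<in>A. adj x \<in> A) \<and> commutant (commutant A) = A"

definition generated_vN :: "('h::complex_hilbert \<Rightarrow>\<^sub>L 'h) set \<Rightarrow> ('h \<Rightarrow>\<^sub>L 'h) set" where
  "generated_vN S = commutant (commutant (S \<union> adj ` S))"

definition vN_factor :: "('h::complex_hilbert \<Rightarrow>\<^sub>L 'h) set \<Rightarrow> bool" where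
  "vN_factor A \<longleftrightarrow> von_neumann_algebra A \<and> A \<inter> commutant A = range scalar_op"

definition unitaries :: "('h::complex_hilbert \<Rightarrow>\<^sub>L 'h) set \<Rightarrow> ('h \<Rightarrow>\<^sub>L 'h) set" where
  "unitaries A = {u \<in> A. adj u o\<^sub>L u = id_blinfun \<and> u o\<^sub>L adj u = id_blinfun}"

definition projection_onto :: "'h::complex_hilbert set \<Rightarrow> 'h \<Rightarrow>\<^sub>L 'h" where
  "projection_onto V = (THE P. P \<in> cbounded_ops \<and> P o\<^sub>L P = P \<and> adj P = P
      \<and> range (blinfun_apply P) = closure V)"


definition ultraweakly_continuous ::
    "('h::complex_hilbert \<Rightarrow>\<^sub>L 'h) set \<Rightarrow> (('h \<Rightarrow>\<^sub>L 'h) \<Rightarrow> complex) \<Rightarrow> bool" where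
  "ultraweakly_continuous A \<phi> \<longleftrightarrow>
     (\<exists>\<xi> \<eta> :: nat \<Rightarrow> 'h. summable (\<lambda>n. (norm (\<xi> n))\<^sup>2) \<and> summable (\<lambda>n. (norm (\<eta> n))\<^sup>2)
        \<and> (\<forall>x\<in>A. (\<lambda>n. cinner (blinfun_apply x (\<xi> n)) (\<eta> n)) sums \<phi> x))"

definition normalized_trace ::
    "('h::complex_hilbert \<Rightarrow>\<^sub>L 'h) set \<Rightarrow> (('h \<Rightarrow>\<^sub>L 'h) \<Rightarrow> complex) \<Rightarrow> bool" where
  "normalized_trace A \<tau> \<longleftrightarrow>
     (\<forall>x\<in>A. \<forall>y\<in>A. \<tau> (x + y) = \<tau> x + \<tau> y) \<and>
     (\<forall>c. \<forall>x\<in>A. \<tau> (scalar_op c o\<^sub>L x) = c * \<tau> x) \<and>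
     \<tau> id_blinfun = 1 \<and>
     (\<forall>x\<in>A. \<tau> (adj x o\<^sub>L x) \<in> \<real>\<^sub>\<ge>\<^sub>0) \<and>
     (\<forall>x\<in>A. \<tau> (adj x o\<^sub>L x) = 0 \<longrightarrow> x = 0) \<and>
     (\<forall>x\<in>A. \<forall>y\<in>A. \<tau> (x o\<^sub>L y) = \<tau> (y o\<^sub>L x)) \<and>
     ultraweakly_continuous A \<tau>"

definition II1_factor :: "('h::complex_hilbert \<Rightarrow>\<^sub>L 'h) set \<Rightarrow> bool" where
  "II1_factor A \<longleftrightarrow> vN_factor A \<and> \<not> (\<exists>B. finite B \<and> A \<subseteq> span B) \<and> (\<exists>\<tau>. normalized_trace A \<tau>)"

(* On a II_1 factor A the normalized trace is unique on A; values outside A are irrelevant. *)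
definition trace_of :: "('h::complex_hilbert \<Rightarrow>\<^sub>L 'h) set \<Rightarrow> ('h \<Rightarrow>\<^sub>L 'h) \<Rightarrow> complex" where
  "trace_of A = (SOME \<tau>. normalized_trace A \<tau>)"

definition norm2 :: "('h::complex_hilbert \<Rightarrow>\<^sub>L 'h) set \<Rightarrow> ('h \<Rightarrow>\<^sub>L 'h) \<Rightarrow> real" where
  "norm2 A x = sqrt (Re (trace_of A (adj x o\<^sub>L x)))"

text \<open>The Hilbert space of the type, on which M acts, is L2(M,tau): it is the completion of M
  for the inner product tau(y* x), an element x of M being identified with the vector x \<Omega>
  (so \<Omega> is the class of 1). The action of M is then left multiplication,
  since x (y \<Omega>) = (x y) \<Omega>.\<close>

definition acts_on_L2 :: "('h::complex_hilbert \<Rightarrow>\<^sub>L 'h) set \<Rightarrow> 'h \<Rightarrow> bool" where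
  "acts_on_L2 M \<Omega> \<longleftrightarrow>
     (\<forall>x\<in>M. \<forall>y\<in>M. cinner (blinfun_apply x \<Omega>) (blinfun_apply y \<Omega>) = trace_of M (adj y o\<^sub>L x)) \<and>
     closure ((\<lambda>x. blinfun_apply x \<Omega>) ` M) = UNIV"

text \<open>Murray--von Neumann coupling constant of a II_1 factor A acting on H: the ratio of
  tr_A([A' \<xi>]) and tr_A'([A \<xi>]), which does not depend on the nonzero vector \<xi>; it is infinite
  when A' is not finite. As A is of type II, A' is finite iff it is a II_1 factor.\<close>

definition vN_dim :: "('h::complex_hilbert \<Rightarrow>\<^sub>L 'h) set \<Rightarrow> ennreal" where
  "vN_dim A =
     (if II1_factor (commutant A)
      then ennreal (THE c. \<forall>\<xi>. \<xi> \<noteq> 0 \<longrightarrow>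
        c = Re (trace_of A (projection_onto ((\<lambda>x. blinfun_apply x \<xi>) ` commutant A)))
          / Re (trace_of (commutant A) (projection_onto ((\<lambda>x. blinfun_apply x \<xi>) ` A))))
      else \<infinity>)"

text \<open>Jones' index [M:N] is the dimension of L2(M,tau) over N. The algebra M enters only through
  that Hilbert space, so this is to be used together with \<open>acts_on_L2 M \<Omega>\<close>.\<close>

definition jones_index ::
    "('h::complex_hilbert \<Rightarrow>\<^sub>L 'h) set \<Rightarrow> ('h \<Rightarrow>\<^sub>L 'h) set \<Rightarrow> ennreal" where
  "jones_index M N = vN_dim N"

(* L2(N,tau) is the closure of N \<Omega>. *)
definition jones_projection :: "('h::complex_hilbert \<Rightarrow>\<^sub>L 'h) set \<Rightarrow> 'h \<Rightarrow> 'h \<Rightarrow>\<^sub>L 'h" where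
  "jones_projection N \<Omega> = projection_onto ((\<lambda>x. blinfun_apply x \<Omega>) ` N)"

definition basic_construction ::
    "('h::complex_hilbert \<Rightarrow>\<^sub>L 'h) set \<Rightarrow> ('h \<Rightarrow>\<^sub>L 'h) set \<Rightarrow> 'h \<Rightarrow> ('h \<Rightarrow>\<^sub>L 'h) set" where
  "basic_construction M N \<Omega> = generated_vN (insert (jones_projection N \<Omega>) M)"

definition unitary_orbit ::
    "('h::complex_hilbert \<Rightarrow>\<^sub>L 'h) set \<Rightarrow> ('h \<Rightarrow>\<^sub>L 'h) \<Rightarrow> ('h \<Rightarrow>\<^sub>L 'h) set" where
  "unitary_orbit M p = {u o\<^sub>L p o\<^sub>L adj u | u. u \<in> unitaries M}"


(* C-infinity on the closed interval, with one-sided derivatives at the end points. *)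
definition smooth_arc :: "(real \<Rightarrow> 'a::real_normed_vector) \<Rightarrow> real \<Rightarrow> real \<Rightarrow> bool" where
  "smooth_arc \<gamma> a b \<longleftrightarrow>
     (\<exists>D :: nat \<Rightarrow> real \<Rightarrow> 'a. (\<forall>t\<in>{a..b}. D 0 t = \<gamma> t) \<and>
        (\<forall>k. \<forall>t\<in>{a..b}. (D k has_vector_derivative D (Suc k) t) (at t within {a..b})))"

definition piecewise_smooth :: "(real \<Rightarrow> 'a::real_normed_vector) \<Rightarrow> bool" where
  "piecewise_smooth \<gamma> \<longleftrightarrow> continuous_on {0..1} \<gamma> \<and>
     (\<exists>S. finite S \<and> {0, 1} \<subseteq> S \<and> S \<subseteq> {0..1} \<and>
        (\<forall>a\<in>S. \<forall>b\<in>S. a < b \<and> S \<inter> {a<..<b} = {} \<longrightarrow> smooth_arc \<gamma> a b))"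

text \<open>In the next two definitions A is the algebra whose trace defines the metric. The orbit
  being a submanifold in the norm structure, its smooth curves are the norm-smooth
  operator-valued curves with values in it.\<close>

definition length2 ::
    "('h::complex_hilbert \<Rightarrow>\<^sub>L 'h) set \<Rightarrow> (real \<Rightarrow> 'h \<Rightarrow>\<^sub>L 'h) \<Rightarrow> real" where
  "length2 A \<gamma> = integral {0..1} (\<lambda>t. norm2 A (vector_derivative \<gamma> (at t within {0..1})))"

(* The infimum is infinite if no admissible curve joins the two points. *)
definition geodesic_dist ::
    "('h::complex_hilbert \<Rightarrow>\<^sub>L 'h) set \<Rightarrow> ('h \<Rightarrow>\<^sub>L 'h) set \<Rightarrow> ('h \<Rightarrow>\<^sub>L 'h) \<Rightarrow> ('h \<Rightarrow>\<^sub>L 'h) \<Rightarrow> ennreal" where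
  "geodesic_dist A Q q1 q2 =
     (INF \<gamma>\<in>{\<gamma>. piecewise_smooth \<gamma> \<and> \<gamma> ` {0..1} \<subseteq> Q \<and> \<gamma> 0 = q1 \<and> \<gamma> 1 = q2}.
        ennreal (length2 A \<gamma>))"

definition orbit_dist ::
    "('h::complex_hilbert \<Rightarrow>\<^sub>L 'h) set \<Rightarrow> ('h \<Rightarrow>\<^sub>L 'h) set \<Rightarrow> 'h \<Rightarrow> ('h \<Rightarrow>\<^sub>L 'h) \<Rightarrow> ('h \<Rightarrow>\<^sub>L 'h) \<Rightarrow> ennreal" where
  "orbit_dist M N \<Omega> =
     geodesic_dist (basic_construction M N \<Omega>) (unitary_orbit M (jones_projection N \<Omega>))"

end

theory Submission imports Defs begin

text \<open>Let \<open>\<lambda>\<close> be the trace of the Jones projection p. The trace of \<open>p S p\<close> is \<open>\<lambda> \<langle>S \<Omega>, \<Omega>\<rangle>\<close> for every S in the basic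
  construction, so the 2-norm distance of \<open>u p u*\<close> and \<open>v p v*\<close> is \<open>(2 \<lambda>)\<^sup>1\<^sup>/\<^sup>2\<close> times the distance of \<open>v* u \<Omega>\<close> from L2(N).
  The conditional expectation of \<open>v* u\<close> is a contraction of N, and a linear functional does not take larger real values on
  contractions than on unitaries; hence v can be multiplied by a unitary of N, which does not change \<open>v p v*\<close>, so that
  \<open>u \<Omega> - v \<Omega>\<close> becomes small. Conversely, every unitary v of M is joined to 1 by smooth curves of unitaries of
  2-norm length at most a constant times \<open>\<parallel>v \<Omega> - \<Omega>\<parallel>\<close>. So the geodesic distance is equivalent to the 2-norm distance, and a Cauchy
  sequence of the orbit, thinned out, lifts to a sequence of unitaries that converges strongly to a unitary.\<close>

section \<open>Complex Hilbert spaces\<close>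

text \<open>Two obstacles shape the proof. First, no trace on M_1 is given. Finite index says that
  the commutant of N is a II_1 factor, and its trace is carried over by the modular conjugation J.
  The inclusions of J M J in M' and of J M_1 J in N' are checked on generators; that p M_1 p lies in
  N p then rests on a commutation argument inside L2(N): a vector of L2(N) that is bounded with
  respect to N' comes from an operator of N. Second, curves are smooth for the operator norm but
  measured in the 2-norm. A unitary close to 1 in the 2-norm may have spectrum all around the
  circle, so a Cayley parameter of it can be small at \<open>\<Omega>\<close> only. A spectral
  projection, itself small at \<open>\<Omega>\<close>, moves the spectrum into the right half plane,
  where the Cayley parameter is bounded; right multiplication by unitaries is isometric for the
  2-norm, so smallness at \<open>\<Omega>\<close> persists along the whole curve. Functional
  calculus is reduced to square roots that commute with whatever commutes with the given operator;
  this places them in the algebra. Finiteness of the trace is used again at the end: a strong limit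
  of unitaries is an isometry, and the trace makes it surjective.\<close>

lemma cinner_scaleC_right: "cinner x (c *\<^sub>C y) = cnj c * cinner x y"
  by (subst (1 2) cinner_commute) (simp add: cinner_scaleC_left)

lemma cinner_add_right: "cinner x (y + z) = cinner x y + cinner x z"
  by (subst (1 2 3) cinner_commute) (simp add: cinner_add_left)

lemma Im_cinner: "Im (cinner x y) = - inner (\<i> *\<^sub>C x) y"
  by (simp add: inner_eq_Re_cinner cinner_scaleC_left)

lemma cinner_self: "cinner x x = complex_of_real ((norm x)\<^sup>2)"
proof -
  have "Im (cinner x x) = 0"
    using arg_cong[OF cinner_commute[of x x], of Im] by simp
  then show ?thesis
    by (simp add: complex_eq_iff power2_norm_eq_inner inner_eq_Re_cinner)
qed

lemma norm_scaleC: "norm (c *\<^sub>C x) = cmod c * norm (x::'h::complex_hilbert)"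
proof -
  have "complex_of_real ((norm (c *\<^sub>C x))\<^sup>2) = complex_of_real ((cmod c * norm x)\<^sup>2)"
    unfolding cinner_self[symmetric] power_mult_distrib of_real_mult cinner_scaleC_left cinner_scaleC_right
    by (simp add: mult.assoc) (metis complex_norm_square mult.commute of_real_power)
  then show ?thesis
    by (metis abs_norm_cancel mult_nonneg_nonneg norm_ge_zero of_real_eq_iff power2_eq_iff_nonneg)
qed

lemma cmod_cinner_le: "cmod (cinner x y) \<le> norm x * norm y"
proof (cases "cinner x y = 0")
  case False
  \<comment> \<open>A phase that turns the inner product into a nonnegative real, so that the real
    Cauchy-Schwarz inequality applies.\<close>
  define u where "u = cnj (cinner x y) / cmod (cinner x y)"
  have u: "cmod u = 1" using False by (simp add: u_def norm_divide)
  have "cnj (cinner x y) * cinner x y = (complex_of_real (cmod (cinner x y)))\<^sup>2"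
    by (metis complex_norm_square mult.commute of_real_power)
  then have "u * cinner x y = cmod (cinner x y)"
    using False by (simp add: u_def power2_eq_square)
  then have "cmod (cinner x y) = inner (u *\<^sub>C x) y"
    by (simp add: inner_eq_Re_cinner cinner_scaleC_left)
  also have "\<dots> \<le> norm x * norm y"
    using norm_cauchy_schwarz[of "u *\<^sub>C x" y] u by (simp add: norm_scaleC)
  finally show ?thesis .
qed simp

interpretation cinner: bounded_bilinear "cinner :: 'h::complex_hilbert \<Rightarrow> 'h \<Rightarrow> complex"
proof
  fix a b :: 'h and r :: real
  show "cinner (r *\<^sub>R a) b = r *\<^sub>R cinner a b" "cinner a (r *\<^sub>R b) = r *\<^sub>R cinner a b"
    unfolding scaleC_of_real[symmetric] by (simp_all add: cinner_scaleC_left cinner_scaleC_right scaleR_conv_of_real)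
  show "\<exists>K. \<forall>(a::'h) b. cmod (cinner a b) \<le> norm a * norm b * K"
    by (rule exI[of _ 1]) (simp add: cmod_cinner_le)
qed (simp_all add: cinner_add_left cinner_add_right)

interpretation scaleC: bounded_bilinear "scaleC :: complex \<Rightarrow> 'h::complex_hilbert \<Rightarrow> 'h"
proof
  fix a :: complex and b :: 'h and r :: real
  show "(r *\<^sub>R a) *\<^sub>C b = r *\<^sub>R (a *\<^sub>C b)" "a *\<^sub>C (r *\<^sub>R b) = r *\<^sub>R (a *\<^sub>C b)"
    unfolding scaleC_of_real[symmetric] scaleC_scaleC by (simp_all add: scaleR_conv_of_real mult.commute)
  show "\<exists>K. \<forall>a (b::'h). norm (a *\<^sub>C b) \<le> norm a * norm b * K"
    by (rule exI[of _ 1]) (simp add: norm_scaleC)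
qed (simp_all add: scaleC_add_right scaleC_add_left)

lemma scaleC_one [simp]: "(1 :: complex) *\<^sub>C x = x"
  using scaleC_of_real[of 1 x] by simp

lemma cinner_eqI: "(\<And>y. cinner x y = cinner x' y) \<Longrightarrow> x = x'"
proof -
  assume "\<And>y. cinner x y = cinner x' y"
  then have "cinner (x - x') (x - x') = 0" by (simp add: cinner.diff_left)
  then show "x = x'" by (simp add: cinner_self)
qed

lemma inner_eqI:
  fixes x :: "'a::real_inner"
  shows "(\<And>y. inner y x = inner y x') \<Longrightarrow> x = x'"
  by (metis inner_commute vector_eq_ldot)

lemma parallelogram_law:
  fixes x y :: "'a::real_inner"
  shows "(norm (x - y))\<^sup>2 = 2 * (norm x)\<^sup>2 + 2 * (norm y)\<^sup>2 - 4 * (norm ((1/2) *\<^sub>R x + (1/2) *\<^sub>R y))\<^sup>2"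
  unfolding power2_norm_eq_inner by (simp add: inner_simps inner_commute[of y x] field_simps)

text \<open>The midpoint lies in K, so the parallelogram law forces the distance to be 0. In
  \<open>trace_N_p\<close> it turns an isometry that preserves K into one that fixes the minimal
  vector.\<close>

lemma min_norm_unique:
  fixes K :: "'a::real_inner set"
  assumes "convex K" "x \<in> K" "y \<in> K" "\<And>z. z \<in> K \<Longrightarrow> norm x \<le> norm z" "\<And>z. z \<in> K \<Longrightarrow> norm y \<le> norm z"
  shows "x = y"
proof -
  have e: "norm x = norm y" using assms by (simp add: order.antisym)
  have "(1/2) *\<^sub>R x + (1/2) *\<^sub>R y \<in> K" using assms(1-3) by (rule convexD) auto
  then have "(norm x)\<^sup>2 \<le> (norm ((1/2) *\<^sub>R x + (1/2) *\<^sub>R y))\<^sup>2" by (simp add: assms(4) power_mono)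
  then have "(norm (x - y))\<^sup>2 \<le> 0" by (simp add: parallelogram_law e)
  then show ?thesis by simp
qed

text \<open>A minimizing sequence is Cauchy: midpoints stay in K, so their squared norms are at
  least D, and the parallelogram law bounds the differences.\<close>

lemma closed_convex_min_norm:
  fixes K :: "'a::{real_inner,banach} set"
  assumes "closed K" "convex K" "K \<noteq> {}"
  obtains x where "x \<in> K" "\<And>y. y \<in> K \<Longrightarrow> norm x \<le> norm y"
proof -
  define D where "D = (INF y\<in>K. (norm y)\<^sup>2)"
  have bdd: "bdd_below ((\<lambda>y. (norm y)\<^sup>2) ` K)" by (rule bdd_belowI[of _ 0]) auto
  have D: "D \<le> (norm y)\<^sup>2" if "y \<in> K" for y
    unfolding D_def by (rule cINF_lower[OF bdd that])
  have "\<exists>y\<in>K. (norm y)\<^sup>2 < D + 1 / Suc n" for n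
    using cINF_less_iff[OF assms(3) bdd, of "D + 1 / Suc n"] unfolding D_def by simp
  then obtain x where x: "\<And>n. x n \<in> K" "\<And>n. (norm (x n))\<^sup>2 < D + 1 / Suc n" by metis
  have c: "(norm (x m - x n))\<^sup>2 < 2 / Suc m + 2 / Suc n" for m n
  proof -
    have "(1/2) *\<^sub>R x m + (1/2) *\<^sub>R x n \<in> K" by (rule convexD[OF assms(2) x(1) x(1)]) auto
    from D[OF this] show ?thesis
      unfolding parallelogram_law[of "x m" "x n"] using x(2)[of m] x(2)[of n] by simp
  qed
  have "Cauchy x"
  proof (rule CauchyI)
    fix e :: real assume e: "0 < e"
    obtain k where k: "4 / e\<^sup>2 < real k" using reals_Archimedean2 by blast
    then have k4: "4 / Suc k < e\<^sup>2" using e by (simp add: field_simps) (smt (verit) zero_less_power)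
    have "norm (x m - x n) < e" if "m \<ge> k" "n \<ge> k" for m n
    proof -
      have "2 / Suc m \<le> 2 / Suc k" "2 / Suc n \<le> 2 / Suc k" using that by (auto intro!: divide_left_mono)
      with c[of m n] k4 have "(norm (x m - x n))\<^sup>2 < e\<^sup>2" by linarith
      then show ?thesis using e by (simp add: power_less_imp_less_base)
    qed
    then show "\<exists>M. \<forall>m\<ge>M. \<forall>n\<ge>M. norm (x m - x n) < e" by blast
  qed
  then obtain l where l: "x \<longlonglongrightarrow> l" by (meson Cauchy_convergent_iff convergent_def)
  have lK: "l \<in> K" using closed_sequentially[OF assms(1) x(1) l] .
  have "(norm l)\<^sup>2 \<le> D"
  proof (rule LIMSEQ_le)
    show "(\<lambda>n. (norm (x n))\<^sup>2) \<longlonglongrightarrow> (norm l)\<^sup>2" by (intro tendsto_intros l)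
    show "(\<lambda>n. D + 1 / Suc n) \<longlonglongrightarrow> D" using LIMSEQ_inverse_real_of_nat_add[of D] by (simp add: inverse_eq_divide)
    show "\<exists>N. \<forall>n\<ge>N. (norm (x n))\<^sup>2 \<le> D + 1 / real (Suc n)" using x(2) less_imp_le by blast
  qed
  then have "norm l \<le> norm y" if "y \<in> K" for y
    using D[OF that] by (meson norm_ge_zero order_trans power2_le_imp_le)
  with lK that show thesis by blast
qed

lemma closed_subspace_decompose:
  fixes V :: "'a::{real_inner,banach} set"
  assumes "closed V" "subspace V"
  obtains y where "y \<in> V" "\<And>v. v \<in> V \<Longrightarrow> inner (x - y) v = 0"
proof -
  have "closed ((\<lambda>v. x + (-1) *\<^sub>R v) ` V)"
    using closed_translation[OF closed_scaling[OF assms(1), of "-1"], of x] by (simp add: image_image)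
  moreover have "convex ((\<lambda>v. x + (-1) *\<^sub>R v) ` V)"
    using convex_affinity[OF subspace_imp_convex[OF assms(2)], of x "-1"] .
  moreover have "(\<lambda>v. x + (-1) *\<^sub>R v) ` V \<noteq> {}" using assms(2) subspace_0 by blast
  ultimately obtain z where z: "z \<in> (\<lambda>v. x + (-1) *\<^sub>R v) ` V"
    "\<And>w. w \<in> (\<lambda>v. x + (-1) *\<^sub>R v) ` V \<Longrightarrow> norm z \<le> norm w" by (rule closed_convex_min_norm) blast
  then obtain y where y: "y \<in> V" "z = x - y" by auto
  have "inner (x - y) v = 0" if v: "v \<in> V" for v
  proof (cases "v = 0")
    case False
    \<comment> \<open>The minimizer of the quadratic polynomial giving the squared norm of
      \<open>x - y - t *\<^sub>R v\<close>; minimality at 0 then forces its linear coefficient to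
      vanish.\<close>
    define t where "t = inner (x - y) v / (inner v v)"
    have "y + t *\<^sub>R v \<in> V" using y v assms(2) by (simp add: subspace_add subspace_scale)
    then have "norm (x - y) \<le> norm (x - y - t *\<^sub>R v)" using z(2)[of "x - (y + t *\<^sub>R v)"] y by (force simp: algebra_simps)
    then have "inner (x - y) (x - y) \<le> inner (x - y - t *\<^sub>R v) (x - y - t *\<^sub>R v)" by (simp add: norm_le)
    also have "\<dots> = inner (x - y) (x - y) - 2 * t * inner (x - y) v + t * (t * inner v v)"
      by (simp add: inner_simps inner_commute algebra_simps)
    also have "t * inner v v = inner (x - y) v" using False by (simp add: t_def)
    finally have "t * inner (x - y) v \<le> 0" by simp
    then show ?thesis using False unfolding t_def by (simp add: divide_le_0_iff zero_le_square mult_le_0_iff) (smt (verit) inner_gt_zero_iff)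
  qed simp
  with y that show thesis by blast
qed

lemma riesz_representation:
  fixes f :: "'a::{real_inner,banach} \<Rightarrow> real"
  assumes "bounded_linear f"
  obtains y where "\<And>x. f x = inner x y"
proof (cases "\<forall>x. f x = 0")
  case True
  then show thesis using that[of 0] by simp
next
  case False
  interpret f: bounded_linear f by fact
  from False obtain a where a: "f a \<noteq> 0" by blast
  have "closed (f -` {0})" by (intro closed_vimage closed_singleton f.continuous_on continuous_on_id)
  moreover have "subspace (f -` {0})" by (auto simp: subspace_def f.add f.scaleR f.zero)
  ultimately obtain b where b: "f b = 0" "\<And>v. f v = 0 \<Longrightarrow> inner (a - b) v = 0"
    using closed_subspace_decompose[of "f -` {0}" a] by auto
  define c where "c = a - b"
  have c: "f c \<noteq> 0" "inner c c \<noteq> 0" using a b(1) f.zero by (auto simp: c_def f.diff)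
  have "f x = inner x ((f c / inner c c) *\<^sub>R c)" for x
  proof -
    have "inner c (x - (f x / f c) *\<^sub>R c) = 0" using b(2)[of "x - (f x / f c) *\<^sub>R c"] c by (simp add: c_def f.diff f.scaleR)
    then have "inner c x = f x / f c * inner c c" by (simp add: inner_simps)
    then show ?thesis using c by (simp add: inner_simps inner_commute[of x c])
  qed
  with that show thesis by blast
qed

lemma adjoint_exists:
  fixes T :: "'a::{real_inner,banach} \<Rightarrow>\<^sub>L 'a"
  obtains S :: "'a \<Rightarrow>\<^sub>L 'a" where "\<And>x y. inner (T x) y = inner x (S y)"
proof -
  have "\<exists>z. \<forall>x. inner (T x) y = inner x z" for y
    using riesz_representation[of "\<lambda>x. inner (T x) y"]
    by (metis bounded_linear_inner_left_comp blinfun.bounded_linear_right)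
  then obtain S where S: "\<And>x y. inner (T x) y = inner x (S y)" by metis
  have "bounded_linear S"
  proof (rule bounded_linear_intro[where K = "norm T"])
    show "S (x + y) = S x + S y" for x y
      by (rule inner_eqI) (metis S inner_add_right)
    show "S (r *\<^sub>R x) = r *\<^sub>R S x" for r x
      by (rule inner_eqI) (metis S inner_scaleR_right)
    show "norm (S x) \<le> norm x * norm T" for x
    proof (cases "S x = 0")
      case False
      have "norm (S x) * norm (S x) = inner (T (S x)) x" by (simp add: S dot_square_norm power2_eq_square)
      also have "\<dots> \<le> norm T * norm (S x) * norm x"
        by (meson norm_blinfun norm_cauchy_schwarz mult_right_mono norm_ge_zero order_trans)
      finally show ?thesis using False by (simp add: mult.commute)
    qed simp
  qed
  then show thesis using that[of "Blinfun S"] S by (simp add: bounded_linear_Blinfun_apply)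
qed

section \<open>Adjoints and commutants\<close>

lemma cboundedI: "(\<And>c x. blinfun_apply T (c *\<^sub>C x) = c *\<^sub>C blinfun_apply T x) \<Longrightarrow> T \<in> cbounded_ops"
  by (simp add: cbounded_ops_def)

lemma cboundedD: "T \<in> cbounded_ops \<Longrightarrow> blinfun_apply T (c *\<^sub>C x) = c *\<^sub>C blinfun_apply T x"
  by (simp add: cbounded_ops_def)

lemma adj_equality:
  assumes "\<And>x y. cinner (blinfun_apply T x) y = cinner x (blinfun_apply S y)"
  shows "adj T = S"
  unfolding adj_def
proof (rule the_equality)
  show "\<forall>x y. cinner (T x) y = cinner x (S y)" using assms by blast
  fix S' assume S': "\<forall>x y. cinner (T x) y = cinner x (blinfun_apply S' y)"
  show "S' = S"
  proof (rule blinfun_eqI, rule cinner_eqI)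
    show "cinner (S' i) y = cinner (S i) y" for i y
      using S' assms by (metis cinner_commute)
  qed
qed

text \<open>The adjoint for the real inner product serves also for the complex one: the imaginary
  part of \<open>cinner x y\<close> is minus the real inner product of i x and y, and i passes
  through T by complex linearity.\<close>

lemma cinner_adj:
  assumes "T \<in> cbounded_ops"
  shows "cinner (T x) y = cinner x (adj T y)"
proof -
  obtain S where S: "\<And>x y. inner (T x) y = inner x (blinfun_apply S y)" by (rule adjoint_exists[of T]) blast
  have "cinner (T x) y = cinner x (blinfun_apply S y)" for x y
    by (rule complex_eqI)
      (simp_all add: Im_cinner S flip: inner_eq_Re_cinner cboundedD[OF assms])
  with adj_equality show ?thesis by metis
qed

lemma inner_adj: "T \<in> cbounded_ops \<Longrightarrow> inner (T x) y = inner x (adj T y)"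
  by (simp add: inner_eq_Re_cinner cinner_adj)

lemma adj_cbounded [intro]: "T \<in> cbounded_ops \<Longrightarrow> adj T \<in> cbounded_ops"
proof (rule cboundedI)
  fix c x assume "T \<in> cbounded_ops"
  then have "cinner (adj T (c *\<^sub>C x)) y = cinner (c *\<^sub>C adj T x) y" for y
    using cinner_commute by (metis cinner_adj cinner_scaleC_right)
  then show "adj T (c *\<^sub>C x) = c *\<^sub>C adj T x" by (rule cinner_eqI)
qed

lemma cinner_adj': "T \<in> cbounded_ops \<Longrightarrow> cinner (adj T x) y = cinner x (T y)"
  by (metis cinner_adj cinner_commute)

lemma adj_adj [simp]: "T \<in> cbounded_ops \<Longrightarrow> adj (adj T) = T"
  by (rule adj_equality) (simp add: cinner_adj')

lemma adj_id [simp]: "adj id_blinfun = id_blinfun"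
  by (rule adj_equality) simp

lemma cbounded_closed [intro, simp]:
  "id_blinfun \<in> cbounded_ops"
  "S \<in> cbounded_ops \<Longrightarrow> T \<in> cbounded_ops \<Longrightarrow> S o\<^sub>L T \<in> cbounded_ops"
  "S \<in> cbounded_ops \<Longrightarrow> T \<in> cbounded_ops \<Longrightarrow> S + T \<in> cbounded_ops"
  "S \<in> cbounded_ops \<Longrightarrow> T \<in> cbounded_ops \<Longrightarrow> S - T \<in> cbounded_ops"
  "S \<in> cbounded_ops \<Longrightarrow> - S \<in> cbounded_ops"
  "S \<in> cbounded_ops \<Longrightarrow> r *\<^sub>R S \<in> cbounded_ops"
  "scalar_op c \<in> cbounded_ops"
  by (auto simp: cbounded_ops_def blinfun.bilinear_simps scaleC.add_right scaleC.diff_right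
      scaleC.minus_right scaleC.scaleR_right scalar_op_def bounded_linear_Blinfun_apply
      scaleC.bounded_linear_right scaleC_scaleC mult.commute)

lemma scalar_op_apply [simp]: "scalar_op c x = c *\<^sub>C x"
  by (simp add: scalar_op_def bounded_linear_Blinfun_apply scaleC.bounded_linear_right)

lemma adj_simps:
  assumes "S \<in> cbounded_ops" "T \<in> cbounded_ops"
  shows "adj (S o\<^sub>L T) = adj T o\<^sub>L adj S" "adj (S + T) = adj S + adj T" "adj (S - T) = adj S - adj T"
  by (rule adj_equality; simp add: blinfun.bilinear_simps cinner.add_left cinner.add_right cinner.diff_left
    cinner.diff_right cinner_adj assms)+

lemma adj_unary:
  assumes "S \<in> cbounded_ops"
  shows "adj (- S) = - adj S" "adj (r *\<^sub>R S) = r *\<^sub>R adj S"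
  by (rule adj_equality; simp add: blinfun.bilinear_simps cinner.minus_left cinner.minus_right
    cinner.scaleR_left cinner.scaleR_right cinner_adj assms)+

lemma adj_scalar_op: "adj (scalar_op c) = scalar_op (cnj c)"
  by (rule adj_equality) (simp add: cinner_scaleC_left cinner_scaleC_right)

text \<open>Complex linearity expressed as commutation. Roots, inverses and projections built by
  real-linear means inherit it, since they commute with everything that commutes with the original
  operator.\<close>

lemma cbounded_iff_commutes: "T \<in> cbounded_ops \<longleftrightarrow> (\<forall>c. T o\<^sub>L scalar_op c = scalar_op c o\<^sub>L T)"
  by (metis blinfun_apply_blinfun_compose blinfun_eqI cboundedD cboundedI scalar_op_apply)

lemma commutes_apply: "S o\<^sub>L T = T o\<^sub>L S \<Longrightarrow> blinfun_apply S (blinfun_apply T x) = blinfun_apply T (blinfun_apply S x)"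
  by (metis blinfun_apply_blinfun_compose)

lemma commutesI: "(\<And>x. blinfun_apply S (blinfun_apply T x) = blinfun_apply T (blinfun_apply S x)) \<Longrightarrow> S o\<^sub>L T = T o\<^sub>L S"
  by (rule blinfun_eqI) simp

lemma commutant_cbounded: "T \<in> commutant S \<Longrightarrow> T \<in> cbounded_ops"
  by (simp add: commutant_def)

lemma commutant_apply: "T \<in> commutant S \<Longrightarrow> A \<in> S \<Longrightarrow> blinfun_apply T (blinfun_apply A x) = blinfun_apply A (blinfun_apply T x)"
  by (auto simp: commutant_def intro: commutes_apply)

lemma commutantI: "T \<in> cbounded_ops \<Longrightarrow> (\<And>A x. A \<in> S \<Longrightarrow> blinfun_apply T (blinfun_apply A x) = blinfun_apply A (blinfun_apply T x)) \<Longrightarrow> T \<in> commutant S"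
  by (auto simp: commutant_def intro: commutesI)

lemma commutant_anti: "S \<subseteq> T \<Longrightarrow> commutant T \<subseteq> commutant S"
  by (auto simp: commutant_def)

lemma subset_bicommutant: "S \<subseteq> cbounded_ops \<Longrightarrow> S \<subseteq> commutant (commutant S)"
  by (auto intro!: commutantI simp: commutant_apply)

lemma tricommutant: "S \<subseteq> cbounded_ops \<Longrightarrow> commutant (commutant (commutant S)) = commutant S"
  by (meson commutant_anti commutant_cbounded subset_antisym subset_bicommutant subsetI)

lemma commutant_adj:
  assumes "S \<subseteq> cbounded_ops" "adj ` S \<subseteq> S" "T \<in> commutant S"
  shows "adj T \<in> commutant S"
proof (rule commutantI)
  have T: "T \<in> cbounded_ops" using assms(3) by (rule commutant_cbounded)
  then show "adj T \<in> cbounded_ops" by blast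
  fix A x assume A: "A \<in> S"
  then have "adj A \<in> S" "A \<in> cbounded_ops" using assms by auto
  then have "cinner (adj T (A x)) y = cinner (A (adj T x)) y" for y
    by (simp add: cinner_adj cinner_adj' T commutant_apply[OF assms(3)])
  then show "adj T (A x) = A (adj T x)" by (rule cinner_eqI)
qed

lemma commutant_closed_ops [intro]:
  "id_blinfun \<in> commutant S"
  "S \<subseteq> cbounded_ops \<Longrightarrow> scalar_op c \<in> commutant S"
  "A \<in> commutant S \<Longrightarrow> B \<in> commutant S \<Longrightarrow> A o\<^sub>L B \<in> commutant S"
  "A \<in> commutant S \<Longrightarrow> B \<in> commutant S \<Longrightarrow> A + B \<in> commutant S"
  "A \<in> commutant S \<Longrightarrow> B \<in> commutant S \<Longrightarrow> A - B \<in> commutant S"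
  "A \<in> commutant S \<Longrightarrow> - A \<in> commutant S"
  "A \<in> commutant S \<Longrightarrow> r *\<^sub>R A \<in> commutant S"
  by (auto intro!: commutantI simp: blinfun.bilinear_simps commutant_cbounded commutant_apply cboundedD)

lemma blinfun_apply_tendsto: "f \<longlonglongrightarrow> T \<Longrightarrow> (\<lambda>n. blinfun_apply (f n) x) \<longlonglongrightarrow> T x"
  by (intro tendsto_intros)

lemma commutant_strong_limit:
  assumes "\<And>n. f n \<in> commutant S" "\<And>x. (\<lambda>n. blinfun_apply (f n) x) \<longlonglongrightarrow> blinfun_apply T x"
  shows "T \<in> commutant S"
proof (rule commutantI)
  have c: "f n \<in> cbounded_ops" for n using assms(1) by (rule commutant_cbounded)
  show "T \<in> cbounded_ops"
  proof (rule cboundedI)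
    fix c x
    have "(\<lambda>n. blinfun_apply (f n) (c *\<^sub>C x)) \<longlonglongrightarrow> c *\<^sub>C T x"
      unfolding cboundedD[OF c] by (intro scaleC.tendsto tendsto_const assms)
    then show "T (c *\<^sub>C x) = c *\<^sub>C T x" using assms(2) LIMSEQ_unique by blast
  qed
  fix A x assume A: "A \<in> S"
  have "(\<lambda>n. blinfun_apply (f n) (A x)) \<longlonglongrightarrow> A (T x)"
    unfolding commutant_apply[OF assms(1) A] by (intro blinfun.tendsto tendsto_const assms(2))
  then show "T (A x) = A (T x)" using assms(2) LIMSEQ_unique by blast
qed

lemma closed_commutant: "closed (commutant S)"
  unfolding closed_sequential_limits by (blast intro: commutant_strong_limit blinfun_apply_tendsto)

lemma bicommutant_least:
  assumes "S \<subseteq> commutant T" "T \<subseteq> cbounded_ops"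
  shows "commutant (commutant S) \<subseteq> commutant T"
proof -
  have "commutant (commutant S) \<subseteq> commutant (commutant (commutant T))"
    using assms(1) by (intro commutant_anti)
  then show ?thesis using tricommutant assms(2) by blast
qed

section \<open>Tools for bounded operators\<close>

lemma blinfun_eq_on_dense:
  assumes "closure D = UNIV" "\<And>x. x \<in> D \<Longrightarrow> blinfun_apply F x = blinfun_apply G x"
  shows "F = G"
proof (rule blinfun_eqI)
  fix x
  have "closed {x. blinfun_apply F x = blinfun_apply G x}" by (intro closed_Collect_eq continuous_intros)
  then have "closure D \<subseteq> {x. blinfun_apply F x = blinfun_apply G x}" using assms(2) by (intro closure_minimal) auto
  then show "F x = G x" using assms(1) by auto
qed

lemma subspace_closure:
  fixes V :: "'a::real_normed_vector set"
  assumes "subspace V"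
  shows "subspace (closure V)"
proof (rule subspaceI)
  show "0 \<in> closure V" using assms closure_subset subspace_0 by blast
  show "x + y \<in> closure V" if "x \<in> closure V" "y \<in> closure V" for x y
  proof -
    obtain f where "\<forall>n. f n \<in> V" "f \<longlonglongrightarrow> x" using \<open>x \<in> closure V\<close> unfolding closure_sequential by blast
    moreover obtain g where "\<forall>n. g n \<in> V" "g \<longlonglongrightarrow> y" using \<open>y \<in> closure V\<close> unfolding closure_sequential by blast
    ultimately have "\<And>n. f n + g n \<in> V" "(\<lambda>n. f n + g n) \<longlonglongrightarrow> x + y"
      using assms by (auto intro: subspace_add tendsto_add)
    then show ?thesis unfolding closure_sequential by (intro exI[of _ "\<lambda>n. f n + g n"]) simp
  qed
  show "r *\<^sub>R x \<in> closure V" if x: "x \<in> closure V" for r x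
  proof -
    obtain f where "\<forall>n. f n \<in> V" "f \<longlonglongrightarrow> x" using x unfolding closure_sequential by blast
    then have "\<And>n. r *\<^sub>R f n \<in> V" "(\<lambda>n. r *\<^sub>R f n) \<longlonglongrightarrow> r *\<^sub>R x"
      using assms by (auto intro: subspace_scale tendsto_scaleR)
    then show ?thesis unfolding closure_sequential by (intro exI[of _ "\<lambda>n. r *\<^sub>R f n"]) simp
  qed
qed

text \<open>The densely defined map is given as its graph R, so that maps like "x \<Omega> to y"
  need no prior proof of being well defined: the bound makes the closure of R single valued, and
  completeness makes it total. Real linearity is all that is asked, so the conjugate-linear J is
  covered.\<close>

lemma bounded_extension:
  fixes R :: "('a::real_normed_vector \<times> 'b::banach) set"
  assumes R: "subspace R" and bound: "\<And>x y. (x, y) \<in> R \<Longrightarrow> norm y \<le> C * norm x"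
    and dense: "closure (fst ` R) = UNIV" and "0 \<le> C"
  obtains F :: "'a \<Rightarrow>\<^sub>L 'b" where "norm F \<le> C" "\<And>x y. (x, y) \<in> R \<Longrightarrow> F x = y"
proof -
  have sub: "subspace (closure R)" using R by (rule subspace_closure)
  have "closed {z::'a \<times> 'b. norm (snd z) \<le> C * norm (fst z)}" by (intro closed_Collect_le continuous_intros)
  then have "closure R \<subseteq> {z. norm (snd z) \<le> C * norm (fst z)}" using bound by (intro closure_minimal) auto
  then have bnd: "norm y \<le> C * norm x" if "(x, y) \<in> closure R" for x y using that by auto
  have "\<exists>y. (x, y) \<in> closure R" for x
  proof -
    have "x \<in> closure (fst ` R)" using dense by simp
    then obtain g where g: "\<forall>n. g n \<in> fst ` R" "g \<longlonglongrightarrow> x"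
      unfolding closure_sequential by blast
    have "\<forall>n. \<exists>y. (g n, y) \<in> R" using g(1) by force
    then obtain h where h: "\<And>n. (g n, h n) \<in> R" by metis
    have d: "norm (h m - h n) \<le> C * norm (g m - g n)" for m n
      using bound[of "g m - g n" "h m - h n"] subspace_diff[OF R h[of m] h[of n]] by simp
    have "Cauchy h"
    proof (rule CauchyI)
      fix e :: real assume e: "0 < e"
      have "Cauchy g" using g(2) by (rule LIMSEQ_imp_Cauchy)
      then obtain k where k: "\<And>m n. m \<ge> k \<Longrightarrow> n \<ge> k \<Longrightarrow> norm (g m - g n) < e / (C + 1)"
        using CauchyD[of g "e / (C + 1)"] e \<open>0 \<le> C\<close> by (metis add_nonneg_pos divide_pos_pos zero_less_one)
      have "norm (h m - h n) < e" if "m \<ge> k" "n \<ge> k" for m n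
      proof -
        have "norm (h m - h n) \<le> (C + 1) * norm (g m - g n)" using d[of m n] by (simp add: distrib_right add_increasing2)
        also have "\<dots> < e" using k[OF that] \<open>0 \<le> C\<close> by (simp add: pos_less_divide_eq mult.commute)
        finally show ?thesis .
      qed
      then show "\<exists>M. \<forall>m\<ge>M. \<forall>n\<ge>M. norm (h m - h n) < e" by blast
    qed
    then obtain y where "h \<longlonglongrightarrow> y" by (meson Cauchy_convergent_iff convergent_def)
    then have "(\<lambda>n. (g n, h n)) \<longlonglongrightarrow> (x, y)" using g(2) by (intro tendsto_Pair)
    then have "(x, y) \<in> closure R"
      unfolding closure_sequential using h by (intro exI[of _ "\<lambda>n. (g n, h n)"]) simp
    then show ?thesis by blast
  qed
  then obtain F where F: "\<And>x. (x, F x) \<in> closure R" by metis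
  have uniq: "y = F x" if "(x, y) \<in> closure R" for x y
    using bnd[of "x - x" "y - F x"] subspace_diff[OF sub that F[of x]] by simp
  have "bounded_linear F"
  proof (rule bounded_linear_intro[where K = C])
    show "F (x + y) = F x + F y" for x y using uniq[of "x + y" "F x + F y"] subspace_add[OF sub F[of x] F[of y]] by simp
    show "F (r *\<^sub>R x) = r *\<^sub>R F x" for r x using uniq[of "r *\<^sub>R x" "r *\<^sub>R F x"] subspace_scale[OF sub F[of x], of r] by simp
    show "norm (F x) \<le> norm x * C" for x using bnd[OF F, of x] by (simp add: mult.commute)
  qed
  moreover have "F x = y" if "(x, y) \<in> R" for x y using uniq that closure_subset by blast
  moreover have "norm (F x) \<le> C * norm x" for x using bnd[OF F] .
  ultimately show thesis using that[of "Blinfun F"] \<open>0 \<le> C\<close>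
    by (simp add: bounded_linear_Blinfun_apply norm_blinfun_bound)
qed

text \<open>The lower bound on T gives injectivity and closed range; the one on its adjoint kills
  the orthogonal complement of the range.\<close>

lemma bounded_below_invertible:
  assumes T: "T \<in> cbounded_ops" and "0 < \<delta>"
    and b: "\<And>x. \<delta> * norm x \<le> norm (blinfun_apply T x)" and b': "\<And>x. \<delta> * norm x \<le> norm (blinfun_apply (adj T) x)"
  obtains S where "S \<in> cbounded_ops" "S o\<^sub>L T = id_blinfun" "T o\<^sub>L S = id_blinfun" "norm S \<le> 1 / \<delta>"
proof -
  have sub: "subspace (range T)" by (metis blinfun.bounded_linear_right bounded_linear.linear linear_subspace_image subspace_UNIV)
  have "complete (range T)"
    using complete_isometric_image[OF \<open>0 < \<delta>\<close> subspace_UNIV blinfun.bounded_linear_right[of T]] b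
    by (simp add: complete_UNIV)
  then have cl: "closed (range T)" by (rule complete_imp_closed)
  have "\<exists>x. T x = y" for y
  proof -
    obtain z where z: "z \<in> range T" "\<And>v. v \<in> range T \<Longrightarrow> inner (y - z) v = 0"
      using closed_subspace_decompose[OF cl sub] by blast
    have "inner (adj T (y - z)) v = 0" for v
      using z(2)[of "T v"] inner_adj[OF T, of v "y - z"] by (simp add: inner_commute)
    then have "adj T (y - z) = 0" by (metis inner_eq_zero_iff)
    then have "y = z" using b'[of "y - z"] \<open>0 < \<delta>\<close> by (simp add: mult_le_0_iff)
    with z(1) show ?thesis by blast
  qed
  then obtain S where S: "\<And>y. T (S y) = y" by metis
  have inj: "x = y" if "T x = T y" for x y
    using b[of "x - y"] that \<open>0 < \<delta>\<close> by (simp add: blinfun.diff_right mult_le_0_iff)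
  have ST: "S (T x) = x" for x by (rule inj) (simp add: S)
  have n: "norm (S x) \<le> 1 / \<delta> * norm x" for x
    using b[of "S x"] S[of x] \<open>0 < \<delta>\<close> by (simp add: field_simps)
  have bl: "bounded_linear S"
  proof (rule bounded_linear_intro[where K = "1 / \<delta>"])
    show "S (x + y) = S x + S y" for x y by (rule inj) (simp add: blinfun.add_right S)
    show "S (r *\<^sub>R x) = r *\<^sub>R S x" for r x by (rule inj) (simp add: blinfun.scaleR_right S)
    show "norm (S x) \<le> norm x * (1 / \<delta>)" for x using n by (simp add: mult.commute)
  qed
  show thesis
  proof (rule that[of "Blinfun S"])
    show "Blinfun S \<in> cbounded_ops"
      by (rule cboundedI, rule inj) (simp add: bounded_linear_Blinfun_apply[OF bl] cboundedD[OF T] S)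
    show "Blinfun S o\<^sub>L T = id_blinfun" "T o\<^sub>L Blinfun S = id_blinfun"
      by (rule blinfun_eqI, simp add: bounded_linear_Blinfun_apply[OF bl] S ST)+
    show "norm (Blinfun S) \<le> 1 / \<delta>"
      using n \<open>0 < \<delta>\<close> by (intro norm_blinfun_bound) (simp_all add: bounded_linear_Blinfun_apply[OF bl])
  qed
qed

lemma inverse_commutes:
  assumes "S o\<^sub>L T = id_blinfun" "T o\<^sub>L S = id_blinfun" "A o\<^sub>L T = T o\<^sub>L A"
  shows "A o\<^sub>L S = S o\<^sub>L A"
proof (rule commutesI)
  fix x
  have ST: "S (T y) = y" "T (S y) = y" for y
    using arg_cong[OF assms(1), of "\<lambda>Z. blinfun_apply Z y"] arg_cong[OF assms(2), of "\<lambda>Z. blinfun_apply Z y"]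
    by simp_all
  have "A (S x) = S (T (A (S x)))" by (simp add: ST)
  also have "\<dots> = S (A x)" by (simp add: ST flip: commutes_apply[OF assms(3)])
  finally show "A (S x) = S (A x)" .
qed

section \<open>Selfadjoint operators, square roots and spectral projections\<close>

definition selfadjoint :: "('a::real_inner \<Rightarrow>\<^sub>L 'a) \<Rightarrow> bool" where
  "selfadjoint T \<longleftrightarrow> (\<forall>x y. inner (T x) y = inner x (T y))"

definition positive_op :: "('a::real_inner \<Rightarrow>\<^sub>L 'a) \<Rightarrow> bool" where
  "positive_op T \<longleftrightarrow> selfadjoint T \<and> (\<forall>x. 0 \<le> inner (T x) x)"

lemma selfadjointD: "selfadjoint T \<Longrightarrow> inner (blinfun_apply T x) y = inner x (blinfun_apply T y)"
  by (simp add: selfadjoint_def)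

lemma selfadjoint_iff_adj: "T \<in> cbounded_ops \<Longrightarrow> selfadjoint T \<longleftrightarrow> adj T = T"
proof
  assume T: "T \<in> cbounded_ops" "selfadjoint T"
  show "adj T = T"
    by (rule blinfun_eqI, rule inner_eqI) (simp add: selfadjointD[OF T(2)] flip: inner_adj[OF T(1)])
next
  assume "T \<in> cbounded_ops" "adj T = T"
  then show "selfadjoint T" using inner_adj[of T] by (simp add: selfadjoint_def)
qed

text \<open>Polarization: the form at x and y, with y the multiple of T x of the same norm as x, is
  a difference of quadratic values at x + y and x - y, and the parallelogram law collects the
  bounds.\<close>

lemma norm_selfadjoint_le:
  fixes T :: "'a::real_inner \<Rightarrow>\<^sub>L 'a"
  assumes s: "selfadjoint T" and b: "\<And>x. \<bar>inner (T x) x\<bar> \<le> c * (norm x)\<^sup>2" and "0 \<le> c"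
  shows "norm T \<le> c"
proof (rule norm_blinfun_bound[OF \<open>0 \<le> c\<close>])
  fix x
  show "norm (T x) \<le> c * norm x"
  proof (cases "T x = 0")
    case False
    then have "x \<noteq> 0" by auto
    define y where "y = (norm x / norm (T x)) *\<^sub>R T x"
    have ny: "norm y = norm x" using False by (simp add: y_def)
    have "4 * inner (T x) y = inner (T (x + y)) (x + y) - inner (T (x - y)) (x - y)"
      by (simp add: blinfun.bilinear_simps inner_simps selfadjointD[OF s, of y x] inner_commute[of y "T x"])
    also have "\<dots> \<le> c * (norm (x + y))\<^sup>2 + c * (norm (x - y))\<^sup>2"
      using b[of "x + y"] b[of "x - y"] by linarith
    also have "\<dots> = 4 * (c * (norm x)\<^sup>2)"
      using ny unfolding power2_norm_eq_inner norm_eq by (simp add: inner_simps inner_commute algebra_simps)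
    finally have "inner (T x) y \<le> c * (norm x)\<^sup>2" by simp
    moreover have "inner (T x) y = norm x * norm (T x)"
      using False by (simp add: y_def dot_square_norm power2_eq_square)
    ultimately show ?thesis using \<open>x \<noteq> 0\<close> by (simp add: power2_eq_square mult.left_commute)
  qed (use \<open>0 \<le> c\<close> in simp)
qed

text \<open>The solution is the limit of \<open>y (n + 1) = (x + y n\<^sup>2) / 2\<close>, whose increments are dominated by those
  of the same iteration for the real number 1.\<close>

lemma one_minus_sqrt_exists:
  fixes X :: "'a::{real_inner,banach} \<Rightarrow>\<^sub>L 'a"
  assumes "norm X \<le> 1"
  obtains Y where "norm Y \<le> 1" "Y = (1/2) *\<^sub>R (X + (Y o\<^sub>L Y))"
    "\<And>A. A o\<^sub>L X = X o\<^sub>L A \<Longrightarrow> A o\<^sub>L Y = Y o\<^sub>L A" "selfadjoint X \<Longrightarrow> selfadjoint Y"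
proof -
  interpret C: bounded_bilinear "blinfun_compose :: ('a \<Rightarrow>\<^sub>L 'a) \<Rightarrow> ('a \<Rightarrow>\<^sub>L 'a) \<Rightarrow> ('a \<Rightarrow>\<^sub>L 'a)"
    by (rule bounded_bilinear_blinfun_compose)
  define y where "y = rec_nat (0 :: 'a \<Rightarrow>\<^sub>L 'a) (\<lambda>_ z. (1/2) *\<^sub>R (X + (z o\<^sub>L z)))"
  define s where "s = rec_nat (0 :: real) (\<lambda>_ z. (1/2) * (1 + z * z))"
  have y: "y 0 = 0" "y (Suc n) = (1/2) *\<^sub>R (X + (y n o\<^sub>L y n))" for n by (simp_all add: y_def)
  have s: "s 0 = 0" "s (Suc n) = (1/2) * (1 + s n * s n)" for n by (simp_all add: s_def)
  have s01: "0 \<le> s n \<and> s n \<le> 1" for n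
  proof (induction n)
    case (Suc n)
    then have "0 \<le> s n * s n" "s n * s n \<le> 1" by (auto intro: mult_le_one)
    then show ?case unfolding s by simp
  qed (simp add: s)
  have ny: "norm (y n) \<le> s n" for n
  proof (induction n)
    case (Suc n)
    have "norm (y n o\<^sub>L y n) \<le> s n * s n"
      using norm_blinfun_compose[of "y n" "y n"] mult_mono[OF Suc Suc] s01[of n] by (simp add: order_trans)
    then show ?case using norm_triangle_ineq[of X "y n o\<^sub>L y n"] assms by (simp add: y s)
  qed (simp add: y s)
  have inc: "norm (y (Suc n) - y n) \<le> s (Suc n) - s n" for n
  proof (induction n)
    case (Suc n)
    let ?d = "y (Suc n) - y n"
    have "y (Suc (Suc n)) - y (Suc n) = (1/2) *\<^sub>R ((y (Suc n) o\<^sub>L ?d) + (?d o\<^sub>L y n))"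
      by (simp add: y(2)[of "Suc n"] y(2)[of n] C.diff_left C.diff_right flip: scaleR_diff_right)
    then have "norm (y (Suc (Suc n)) - y (Suc n)) \<le> (1/2) * (norm (y (Suc n) o\<^sub>L ?d) + norm (?d o\<^sub>L y n))"
      by (simp add: norm_triangle_ineq)
    also have "\<dots> \<le> (1/2) * (s (Suc n) * (s (Suc n) - s n) + (s (Suc n) - s n) * s n)"
      using s01 order_trans[OF norm_ge_zero Suc] by (intro mult_left_mono add_mono order_trans[OF norm_blinfun_compose] mult_mono ny Suc) auto
    also have "\<dots> = s (Suc (Suc n)) - s (Suc n)"
      unfolding s(2)[of "Suc n"] s(2)[of n] by (simp add: algebra_simps)
    finally show ?case .
  qed (simp add: y s assms)
  have "s n \<le> s (Suc n)" for n using order_trans[OF norm_ge_zero inc[of n]] by simp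
  then have "incseq s" by (rule incseq_SucI)
  moreover have "\<forall>n. s n \<le> 1" using s01 by blast
  ultimately obtain l where "s \<longlonglongrightarrow> l" by (rule incseq_convergent)
  then have "summable (\<lambda>n. s (Suc n) - s n)" by (rule telescope_summable)
  then have "summable (\<lambda>n. norm (y (Suc n) - y n))" by (rule summable_comparison_test') (simp add: inc)
  then have "summable (\<lambda>n. y (Suc n) - y n)" by (rule summable_norm_cancel)
  then have "convergent (\<lambda>n. \<Sum>k<n. y (Suc k) - y k)" by (simp add: summable_iff_convergent)
  then have "convergent y" unfolding sum_lessThan_telescope by (simp add: y(1))
  then obtain Y where Y: "y \<longlonglongrightarrow> Y" by (auto simp: convergent_def)
  show thesis
  proof (rule that)
    show "norm Y \<le> 1" using ny s01 by (intro Lim_norm_ubound[OF _ Y]) (auto intro: order_trans always_eventually)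
    have "(\<lambda>n. y (Suc n)) \<longlonglongrightarrow> (1/2) *\<^sub>R (X + (Y o\<^sub>L Y))" unfolding y by (intro tendsto_intros C.tendsto Y)
    then show "Y = (1/2) *\<^sub>R (X + (Y o\<^sub>L Y))" using LIMSEQ_Suc[OF Y] LIMSEQ_unique by blast
    show "A o\<^sub>L Y = Y o\<^sub>L A" if A: "A o\<^sub>L X = X o\<^sub>L A" for A
    proof -
      have *: "A o\<^sub>L y n = y n o\<^sub>L A" for n
      proof (induction n)
        case (Suc n)
        show ?case
          by (rule commutesI)
            (simp add: y blinfun.bilinear_simps commutes_apply[OF Suc] commutes_apply[OF A])
      qed (simp add: y C.zero_left C.zero_right)
      have "(\<lambda>n. A o\<^sub>L y n) \<longlonglongrightarrow> (A o\<^sub>L Y)" "(\<lambda>n. y n o\<^sub>L A) \<longlonglongrightarrow> (Y o\<^sub>L A)" by (intro C.tendsto tendsto_const Y)+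
      then show ?thesis unfolding * using LIMSEQ_unique by blast
    qed
    assume X: "selfadjoint X"
    have *: "inner (y n a) b = inner a (y n b)" for n a b
      by (induction n arbitrary: a b) (simp_all add: y blinfun.bilinear_simps inner_simps selfadjointD[OF X])
    have "inner (Y a) b = inner a (Y b)" for a b
    proof (rule LIMSEQ_unique)
      show "(\<lambda>n. inner (y n a) b) \<longlonglongrightarrow> inner (Y a) b" by (intro tendsto_intros Y)
      show "(\<lambda>n. inner (y n a) b) \<longlonglongrightarrow> inner a (Y b)" unfolding * by (intro tendsto_intros Y)
    qed
    then show "selfadjoint Y" by (simp add: selfadjoint_def)
  qed
qed

text \<open>For X = 1 - B the equation Y = (X + Y Y) / 2 says exactly that (1 - Y) squared is B, so
  G = 1 - Y. The norm bound on B keeps X in the unit ball where the iteration converges.\<close>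

lemma positive_sqrt:
  fixes B :: "'h::complex_hilbert \<Rightarrow>\<^sub>L 'h"
  assumes B: "B \<in> cbounded_ops" "positive_op B" "norm B \<le> 1"
  obtains G where "G \<in> cbounded_ops" "positive_op G" "G o\<^sub>L G = B" "norm G \<le> 1"
    "\<And>A. A o\<^sub>L B = B o\<^sub>L A \<Longrightarrow> A o\<^sub>L G = G o\<^sub>L A"
proof -
  have sB: "selfadjoint B" and pB: "\<And>x. 0 \<le> inner (B x) x" using B(2) by (auto simp: positive_op_def)
  have Bx: "inner (B x) x \<le> (norm x)\<^sup>2" for x
  proof -
    have "inner (B x) x \<le> norm (B x) * norm x" by (rule norm_cauchy_schwarz)
    also have "\<dots> \<le> 1 * norm x * norm x"
      using norm_blinfun[of B x] B(3) by (meson mult_right_mono norm_ge_zero order_trans)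
    finally show ?thesis by (simp add: power2_eq_square)
  qed
  have sX: "selfadjoint (id_blinfun - B)"
    using sB by (simp add: selfadjoint_def blinfun.diff_left inner_simps)
  have "norm (id_blinfun - B) \<le> 1"
    by (rule norm_selfadjoint_le[OF sX])
      (use pB Bx in \<open>simp_all add: blinfun.diff_left inner_diff_left dot_square_norm\<close>)
  then obtain Y where Y: "norm Y \<le> 1" "Y = (1/2) *\<^sub>R (id_blinfun - B + (Y o\<^sub>L Y))"
    "\<And>A. A o\<^sub>L (id_blinfun - B) = (id_blinfun - B) o\<^sub>L A \<Longrightarrow> A o\<^sub>L Y = Y o\<^sub>L A"
    "selfadjoint Y" using one_minus_sqrt_exists sX by metis
  define G where "G = id_blinfun - Y"
  have comm: "A o\<^sub>L G = G o\<^sub>L A" if "A o\<^sub>L B = B o\<^sub>L A" for A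
  proof -
    have "A o\<^sub>L (id_blinfun - B) = (id_blinfun - B) o\<^sub>L A"
      by (rule commutesI) (simp add: blinfun.diff_left blinfun.diff_right commutes_apply[OF that])
    from Y(3)[OF this] show ?thesis
      by (intro commutesI) (simp add: G_def blinfun.diff_left blinfun.diff_right commutes_apply)
  qed
  have sG: "selfadjoint G" using Y(4) by (simp add: G_def selfadjoint_def blinfun.diff_left inner_simps)
  have GG: "G o\<^sub>L G = B"
  proof (rule blinfun_eqI)
    fix x
    have "Y x = (1/2) *\<^sub>R (x - B x + Y (Y x))"
      using arg_cong[OF Y(2), of "\<lambda>Z. blinfun_apply Z x"] by (simp add: blinfun.bilinear_simps)
    from arg_cong[OF this, of "\<lambda>z. 2 *\<^sub>R z"] have "2 *\<^sub>R Y x = x - B x + Y (Y x)" by simp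
    then show "(G o\<^sub>L G) x = B x" by (simp add: G_def blinfun.bilinear_simps scaleR_2 algebra_simps)
  qed
  show thesis
  proof (rule that[OF _ _ GG _ comm])
    show "G \<in> cbounded_ops"
      unfolding cbounded_iff_commutes using B(1) by (metis comm cbounded_iff_commutes)
    have "inner (Y x) x \<le> (norm x)\<^sup>2" for x
    proof -
      have "inner (Y x) x \<le> norm (Y x) * norm x" by (rule norm_cauchy_schwarz)
      also have "\<dots> \<le> 1 * norm x * norm x"
        using norm_blinfun[of Y x] Y(1) by (meson mult_right_mono norm_ge_zero order_trans)
      finally show ?thesis by (simp add: power2_eq_square)
    qed
    then show "positive_op G"
      using sG by (simp add: positive_op_def G_def blinfun.diff_left inner_diff_left dot_square_norm)
    have "(norm (G x))\<^sup>2 \<le> (norm x)\<^sup>2" for x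
      using Bx[of x] by (simp add: power2_norm_eq_inner selfadjointD[OF sG] GG flip: blinfun_apply_blinfun_compose)
        (metis GG blinfun_apply_blinfun_compose inner_commute)
    then show "norm G \<le> 1" by (intro norm_blinfun_bound) (auto intro: power2_le_imp_le)
  qed
qed

text \<open>The root G of c commutes with T, so the form of c at T x is the squared norm of T (G x),
  up to the factor \<open>norm c\<close> by which c is divided to enter the unit ball. This is the
  bound behind \<open>corner_conditional_expectation\<close>.\<close>

lemma commuting_positive_le:
  fixes c T :: "'h::complex_hilbert \<Rightarrow>\<^sub>L 'h"
  assumes c: "c \<in> cbounded_ops" "positive_op c" and Tc: "T o\<^sub>L c = c o\<^sub>L T"
  shows "inner (c (T x)) (T x) \<le> (norm T)\<^sup>2 * inner (c x) x"
proof (cases "c = 0")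
  case False
  have "selfadjoint c" and pos: "\<And>x. 0 \<le> inner (c x) x" using c(2) by (simp_all add: positive_op_def)
  then have "selfadjoint ((1 / norm c) *\<^sub>R c)" by (simp add: selfadjoint_def blinfun.scaleR_left)
  then have "positive_op ((1 / norm c) *\<^sub>R c)"
    unfolding positive_op_def by (simp add: blinfun.scaleR_left pos)
  moreover have "(1 / norm c) *\<^sub>R c \<in> cbounded_ops" "norm ((1 / norm c) *\<^sub>R c) \<le> 1" using c(1) False by auto
  ultimately obtain G where "G \<in> cbounded_ops" and G: "positive_op G" "G o\<^sub>L G = (1 / norm c) *\<^sub>R c" "norm G \<le> 1"
    "\<And>A. A o\<^sub>L ((1 / norm c) *\<^sub>R c) = ((1 / norm c) *\<^sub>R c) o\<^sub>L A \<Longrightarrow> A o\<^sub>L G = G o\<^sub>L A"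
    using positive_sqrt[of "(1 / norm c) *\<^sub>R c"] by blast
  have cG: "norm c * inner (G z) (G z) = inner (c z) z" for z
  proof -
    have "inner (G z) (G z) = inner ((G o\<^sub>L G) z) z" using G(1) by (simp add: positive_op_def selfadjointD)
    then show ?thesis using False by (simp add: G(2) blinfun.bilinear_simps)
  qed
  have "T o\<^sub>L G = G o\<^sub>L T"
    by (rule G(4), rule commutesI) (simp add: blinfun.bilinear_simps commutes_apply[OF Tc])
  then have "inner (G (T x)) (G (T x)) = (norm (T (G x)))\<^sup>2" by (simp add: power2_norm_eq_inner commutes_apply)
  also have "\<dots> \<le> (norm T * norm (G x))\<^sup>2" by (intro power_mono norm_blinfun) simp
  finally have "inner (G (T x)) (G (T x)) \<le> (norm T)\<^sup>2 * inner (G x) (G x)"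
    by (simp add: power_mult_distrib power2_norm_eq_inner)
  then have "norm c * inner (G (T x)) (G (T x)) \<le> norm c * ((norm T)\<^sup>2 * inner (G x) (G x))"
    by (rule mult_left_mono) simp
  then show ?thesis by (simp add: mult.left_commute flip: cG)
qed simp

definition csubspace :: "'h::complex_hilbert set \<Rightarrow> bool" where
  "csubspace V \<longleftrightarrow> subspace V \<and> (\<forall>c. \<forall>x\<in>V. c *\<^sub>C x \<in> V)"

lemma csubspace_closure: "csubspace V \<Longrightarrow> csubspace (closure V)"
proof -
  assume V: "csubspace V"
  have "c *\<^sub>C x \<in> closure V" if x: "x \<in> closure V" for c x
  proof -
    from x obtain f where f: "\<forall>n. f n \<in> V" "f \<longlonglongrightarrow> x" unfolding closure_sequential by blast
    then have "\<And>n. c *\<^sub>C f n \<in> V" "(\<lambda>n. c *\<^sub>C f n) \<longlonglongrightarrow> c *\<^sub>C x"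
      using V by (auto simp: csubspace_def intro: scaleC.tendsto)
    then show ?thesis unfolding closure_sequential by (intro exI[of _ "\<lambda>n. c *\<^sub>C f n"]) simp
  qed
  then show ?thesis using V by (auto simp: csubspace_def subspace_closure)
qed

lemma projection_onto:
  assumes V: "csubspace V"
  shows "projection_onto V \<in> cbounded_ops" "projection_onto V o\<^sub>L projection_onto V = projection_onto V"
    "adj (projection_onto V) = projection_onto V" "range (projection_onto V) = closure V"
proof -
  let ?W = "closure V"
  have cs: "csubspace ?W" using V by (rule csubspace_closure)
  then have W: "subspace ?W" by (simp add: csubspace_def)
  have "\<exists>y\<in>?W. \<forall>v\<in>?W. inner (x - y) v = 0" for x
    using closed_subspace_decompose[OF closed_closure W, of x] by metis
  then obtain f where f: "\<And>x. f x \<in> ?W" "\<And>x v. v \<in> ?W \<Longrightarrow> inner (x - f x) v = 0" by metis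
  have uniq: "f x = y" if "y \<in> ?W" "\<And>v. v \<in> ?W \<Longrightarrow> inner (x - y) v = 0" for x y
  proof -
    have "f x - y \<in> ?W" using f(1) that(1) W subspace_diff by blast
    then have "inner (x - y) (f x - y) = 0" "inner (x - f x) (f x - y) = 0" using f(2) that(2) by auto
    then have "inner (f x - y) (f x - y) = 0" by (simp add: inner_simps)
    then show ?thesis by simp
  qed
  have fW: "f y = y" if "y \<in> ?W" for y using uniq[OF that] by simp
  have bl: "bounded_linear f"
  proof (rule bounded_linear_intro[where K = 1])
    show "f (x + y) = f x + f y" for x y
    proof (rule uniq)
      show "f x + f y \<in> ?W" using f(1) W by (simp add: subspace_add)
      show "inner (x + y - (f x + f y)) v = 0" if "v \<in> ?W" for v
        using f(2)[OF that, of x] f(2)[OF that, of y] by (simp add: inner_simps)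
    qed
    show "f (r *\<^sub>R x) = r *\<^sub>R f x" for r x
    proof (rule uniq)
      show "r *\<^sub>R f x \<in> ?W" using f(1) W by (simp add: subspace_scale)
      show "inner (r *\<^sub>R x - r *\<^sub>R f x) v = 0" if "v \<in> ?W" for v
        using f(2)[OF that, of x] by (simp flip: scaleR_diff_right)
    qed
    show "norm (f x) \<le> norm x * 1" for x
    proof -
      have "norm (f x) * norm (f x) = inner x (f x)" using f(2)[OF f(1), of x x] by (simp add: inner_diff_left dot_square_norm power2_eq_square)
      also have "\<dots> \<le> norm x * norm (f x)" by (rule norm_cauchy_schwarz)
      finally show ?thesis by (cases "norm (f x) = 0") auto
    qed
  qed
  define P where "P = Blinfun f"
  have P: "P x = f x" for x by (simp add: P_def bounded_linear_Blinfun_apply bl)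
  have icomm: "inner (c *\<^sub>C x) y = inner x (cnj c *\<^sub>C y)" for c and x y :: 'a
    by (simp add: inner_eq_Re_cinner cinner_scaleC_left cinner_scaleC_right)
  have PC: "P \<in> cbounded_ops"
  proof (rule cboundedI)
    fix c x
    have "f (c *\<^sub>C x) = c *\<^sub>C f x"
    proof (rule uniq)
      show "c *\<^sub>C f x \<in> ?W" using f(1) cs by (simp add: csubspace_def)
      fix v assume "v \<in> ?W"
      then have "cnj c *\<^sub>C v \<in> ?W" using cs by (simp add: csubspace_def)
      then show "inner (c *\<^sub>C x - c *\<^sub>C f x) v = 0" using f(2) by (simp add: icomm flip: scaleC.diff_right)
    qed
    then show "P (c *\<^sub>C x) = c *\<^sub>C P x" by (simp add: P)
  qed
  have "selfadjoint P"
  proof -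
    have "inner (f x) y = inner x (f y)" for x y
      using f(2)[OF f(1)[of y], of x] f(2)[OF f(1)[of x], of y]
      by (simp add: inner_diff_left inner_commute[of y "f x"] inner_commute[of "f y" "f x"])
    then show ?thesis by (simp add: selfadjoint_def P)
  qed
  then have aP: "adj P = P" using selfadjoint_iff_adj PC by blast
  have PP: "P o\<^sub>L P = P" by (rule blinfun_eqI) (simp add: P fW f(1))
  have rP: "range P = ?W"
  proof
    show "range P \<subseteq> ?W" using f(1) by (auto simp: P)
    show "?W \<subseteq> range P" by (metis P fW rangeI subsetI)
  qed
  have "projection_onto V = P"
    unfolding projection_onto_def
  proof (rule the_equality)
    show "P \<in> cbounded_ops \<and> P o\<^sub>L P = P \<and> adj P = P \<and> range P = ?W" using PC PP aP rP by blast
    fix Q assume Q: "Q \<in> cbounded_ops \<and> Q o\<^sub>L Q = Q \<and> adj Q = Q \<and> range (blinfun_apply Q) = ?W"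
    then have Qc: "Q \<in> cbounded_ops" and Q2: "Q o\<^sub>L Q = Q" and aQ: "adj Q = Q" and rQ: "range Q = ?W" by auto
    have QQ: "Q (Q x) = Q x" for x using arg_cong[OF Q2, of "\<lambda>Z. blinfun_apply Z x"] by simp
    show "Q = P"
    proof (rule blinfun_eqI)
      fix x
      have "inner (x - Q x) v = 0" if "v \<in> ?W" for v
      proof -
        obtain z where z: "v = Q z" using \<open>v \<in> ?W\<close> rQ by blast
        have "inner (x - Q x) (Q z) = inner (Q (x - Q x)) z" using inner_adj[OF Qc, of "x - Q x" z] aQ by simp
        then show ?thesis by (simp add: z blinfun.diff_right QQ)
      qed
      moreover have "Q x \<in> ?W" using rQ by blast
      ultimately have "f x = Q x" using uniq by blast
      then show "Q x = P x" by (simp add: P)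
    qed
  qed
  then show "projection_onto V \<in> cbounded_ops" "projection_onto V o\<^sub>L projection_onto V = projection_onto V"
    "adj (projection_onto V) = projection_onto V" "range (projection_onto V) = closure V"
    using PC PP aP rP by auto
qed

lemma projection_onto_apply:
  assumes "csubspace V"
  shows "projection_onto V (projection_onto V x) = projection_onto V x"
    "inner (projection_onto V x) y = inner x (projection_onto V y)"
    "cinner (projection_onto V x) y = cinner x (projection_onto V y)"
    "projection_onto V x = x \<longleftrightarrow> x \<in> closure V"
proof -
  let ?P = "projection_onto V"
  note P = projection_onto[OF assms]
  show idem: "?P (?P x) = ?P x" for x using arg_cong[OF P(2), of "\<lambda>Z. blinfun_apply Z x"] by simp
  show "inner (?P x) y = inner x (?P y)" using inner_adj[OF P(1)] P(3) by simp
  show "cinner (?P x) y = cinner x (?P y)" using cinner_adj[OF P(1)] P(3) by simp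
  show "?P x = x \<longleftrightarrow> x \<in> closure V"
  proof
    assume "?P x = x"
    then show "x \<in> closure V" using P(4) by (metis rangeI)
  next
    assume "x \<in> closure V"
    then obtain z where "x = ?P z" using P(4) by blast
    then show "?P x = x" by (simp add: idem)
  qed
qed

text \<open>Invariance of the range under F gives P F P = F P; invariance under the adjoint G gives
  P F P = P F. F is only real linear and G its real adjoint, so that the lemma also applies to
  J.\<close>

lemma projection_onto_commutes:
  fixes V :: "'h::complex_hilbert set" and F G :: "'h \<Rightarrow>\<^sub>L 'h"
  assumes V: "csubspace V" and FG: "\<And>x y. inner (blinfun_apply F x) y = inner x (blinfun_apply G y)"
    and "F ` V \<subseteq> V" "G ` V \<subseteq> V"
  shows "projection_onto V (F x) = F (projection_onto V x)"
proof -
  let ?P = "projection_onto V"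
  have inv: "H z \<in> closure V" if "H ` V \<subseteq> V" "z \<in> closure V" for H :: "'h \<Rightarrow>\<^sub>L 'h" and z
  proof -
    have "H ` closure V \<subseteq> closure V"
    proof (rule image_closure_subset)
      show "continuous_on (closure V) (blinfun_apply H)"
        by (rule linear_continuous_on, rule blinfun.bounded_linear_right)
      show "H ` V \<subseteq> closure V" using that(1) closure_subset by blast
    qed simp
    then show ?thesis using that(2) by blast
  qed
  have r: "?P z \<in> closure V" for z using projection_onto(4)[OF V] by blast
  have fix1: "?P (F (?P z)) = F (?P z)" for z
    using inv[OF assms(3) r] projection_onto_apply(4)[OF V] by blast
  have fix2: "?P (G (?P z)) = G (?P z)" for z
    using inv[OF assms(4) r] projection_onto_apply(4)[OF V] by blast
  have "inner y (?P (F x)) = inner y (F (?P x))" for y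
  proof -
    have "inner (?P (F x)) y = inner x (?P (G (?P y)))" by (simp add: projection_onto_apply[OF V] FG fix2)
    also have "\<dots> = inner (?P (F (?P x))) y" by (simp add: projection_onto_apply[OF V] FG)
    finally show ?thesis by (simp add: fix1 inner_commute)
  qed
  then show ?thesis by (rule inner_eqI)
qed

lemma csubspace_range: "T \<in> cbounded_ops \<Longrightarrow> csubspace (range T)"
  by (auto simp: csubspace_def linear_subspace_image bounded_linear.linear[OF blinfun.bounded_linear_right] simp flip: cboundedD)

text \<open>Here e is the spectral projection of a for the negative half line.\<close>

lemma sign_projection:
  fixes a :: "'h::complex_hilbert \<Rightarrow>\<^sub>L 'h"
  assumes a: "a \<in> cbounded_ops" "selfadjoint a" "norm a \<le> 1"
  obtains e where "e \<in> cbounded_ops" "e o\<^sub>L e = e" "adj e = e"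
    "positive_op (a - 2 *\<^sub>R (a o\<^sub>L e))"
    "\<And>A. A \<in> cbounded_ops \<Longrightarrow> A o\<^sub>L a = a o\<^sub>L A \<Longrightarrow> A o\<^sub>L e = e o\<^sub>L A"
proof -
  have "norm (a o\<^sub>L a) \<le> 1"
    using norm_blinfun_compose[of a a] a(3) by (meson mult_le_one norm_ge_zero order_trans)
  moreover have "positive_op (a o\<^sub>L a)"
  proof -
    have "inner ((a o\<^sub>L a) x) x = inner (a x) (a x)" for x by (simp add: selfadjointD[OF a(2)])
    moreover have "selfadjoint (a o\<^sub>L a)" by (simp add: selfadjoint_def selfadjointD[OF a(2)])
    ultimately show ?thesis by (metis positive_op_def inner_ge_zero)
  qed
  moreover have "a o\<^sub>L a \<in> cbounded_ops" using a(1) by simp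
  ultimately obtain c where c: "c \<in> cbounded_ops" "positive_op c" "c o\<^sub>L c = a o\<^sub>L a"
    "\<And>A. A o\<^sub>L (a o\<^sub>L a) = (a o\<^sub>L a) o\<^sub>L A \<Longrightarrow> A o\<^sub>L c = c o\<^sub>L A"
    using positive_sqrt[of "a o\<^sub>L a"] by blast
  have commc: "A (c x) = c (A x)" if "A o\<^sub>L a = a o\<^sub>L A" for A x
    by (rule commutes_apply, rule c(4), rule commutesI) (simp add: commutes_apply[OF that])
  have cc: "c (c x) = a (a x)" for x using c(3) by (metis blinfun_apply_blinfun_compose)
  \<comment> \<open>Here c is the absolute value of a, so m is twice the negative part of a and e
    will be its support projection.\<close>
  define m where "m = c - a"
  have m: "m \<in> cbounded_ops" using c(1) a(1) by (simp add: m_def)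
  have sc: "selfadjoint c" using c(2) by (simp add: positive_op_def)
  have sm: "selfadjoint m" using sc a(2) by (simp add: m_def selfadjoint_def blinfun.bilinear_simps inner_simps)
  define e where "e = projection_onto (range m)"
  note V = csubspace_range[OF m]
  note e = projection_onto[OF V, folded e_def] and ea = projection_onto_apply[OF V, folded e_def]
  \<comment> \<open>c and a commute and have the same square, so c + a annihilates the range of c -
    a. Thus c equals -a on the range of e, while m vanishes on the complement and c equals a there;
    together c is a - 2 a e.\<close>
  have "(c + a) ` closure (range m) \<subseteq> {0}"
    by (rule image_closure_subset) (auto intro!: continuous_intros simp: m_def blinfun.bilinear_simps cc commc)
  then have "(c + a) (e x) = 0" for x using e(4) by blast
  then have 1: "c (e x) = - a (e x)" for x by (simp add: blinfun.add_left eq_neg_iff_add_eq_0)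
  have "m (x - e x) = 0" for x
  proof -
    have "inner y (m (x - e x)) = 0" for y
    proof -
      have "m y \<in> closure (range m)" using closure_subset[of "range m"] by blast
      then have "e (m y) = m y" using ea(4) by blast
      then have "inner (m y) (e x) = inner (m y) x" using ea(2)[of x "m y"] by (simp add: inner_commute)
      moreover have "inner y (m (x - e x)) = inner (m y) (x - e x)" by (simp only: selfadjointD[OF sm])
      ultimately show ?thesis by (simp add: inner_diff_right)
    qed
    then show ?thesis by (metis inner_eq_zero_iff)
  qed
  then have 2: "c x - c (e x) = a x - a (e x)" for x by (simp add: m_def blinfun.bilinear_simps algebra_simps)
  have "c = a - 2 *\<^sub>R (a o\<^sub>L e)"
    by (rule blinfun_eqI) (use 1 2 in \<open>simp add: blinfun.bilinear_simps scaleR_2 algebra_simps\<close>)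
  with c(2) have pos: "positive_op (a - 2 *\<^sub>R (a o\<^sub>L e))" by simp
  show thesis
  proof (rule that[OF e(1-3) pos])
    fix A assume A: "A \<in> cbounded_ops" "A o\<^sub>L a = a o\<^sub>L A"
    have A': "adj A o\<^sub>L a = a o\<^sub>L adj A"
    proof -
      have "adj a = a" using a selfadjoint_iff_adj by blast
      then show ?thesis using arg_cong[OF A(2), of adj] unfolding adj_simps(1)[OF A(1) a(1)] adj_simps(1)[OF a(1) A(1)] by simp
    qed
    have mA: "B (m x) = m (B x)" if "B o\<^sub>L a = a o\<^sub>L B" for B x
      by (simp add: m_def blinfun.diff_left blinfun.diff_right commc[OF that] commutes_apply[OF that])
    have inv: "B ` range m \<subseteq> range m" if "B o\<^sub>L a = a o\<^sub>L B" for B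
      using mA[OF that] by auto
    show "A o\<^sub>L e = e o\<^sub>L A"
      unfolding e_def
      by (rule commutesI, rule projection_onto_commutes[OF V inner_adj[OF A(1)] inv[OF A(2)] inv[OF A'], symmetric])
  qed
qed

section \<open>Vectors versus operators; strong and ultraweak limits\<close>

lemma strong_tendsto_dense:
  fixes f :: "nat \<Rightarrow> 'a::real_normed_vector \<Rightarrow>\<^sub>L 'b::real_normed_vector"
  assumes "closure D = UNIV" "\<And>n. norm (f n) \<le> C" "\<And>x. x \<in> D \<Longrightarrow> (\<lambda>n. blinfun_apply (f n) x) \<longlonglongrightarrow> blinfun_apply T x"
  shows "(\<lambda>n. blinfun_apply (f n) x) \<longlonglongrightarrow> blinfun_apply T x"
proof (rule LIMSEQ_I)
  fix e :: real assume e: "0 < e"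
  have C: "0 \<le> C" using assms(2)[of 0] norm_ge_zero order_trans by blast
  define K where "K = C + norm T + 1"
  have K: "0 < K" using C by (simp add: K_def add_nonneg_pos)
  have "x \<in> closure D" using assms(1) by simp
  then obtain d where d: "d \<in> D" "dist d x < e / (2 * K)"
    using e K unfolding closure_approachable by (metis divide_pos_pos mult_pos_pos zero_less_numeral)
  obtain k where k: "\<And>n. n \<ge> k \<Longrightarrow> norm (f n d - T d) < e / 2"
    using LIMSEQ_D[OF assms(3)[OF d(1)], of "e / 2"] e by auto
  have "norm (f n x - T x) < e" if "n \<ge> k" for n
  proof -
    have "f n x - T x = (f n - T) (x - d) + (f n d - T d)" by (simp add: blinfun.bilinear_simps)
    then have "norm (f n x - T x) \<le> norm ((f n - T) (x - d)) + norm (f n d - T d)" by (metis norm_triangle_ineq)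
    also have "norm ((f n - T) (x - d)) \<le> K * norm (x - d)"
    proof (rule order_trans[OF norm_blinfun mult_right_mono])
      show "norm (f n - T) \<le> K" using norm_triangle_ineq4[of "f n" T] assms(2)[of n] by (simp add: K_def)
    qed simp
    also have "K * norm (x - d) < e / 2" using d(2) K by (simp add: dist_norm norm_minus_commute field_simps)
    finally show ?thesis using k[OF that] by simp
  qed
  then show "\<exists>no. \<forall>n\<ge>no. norm (f n x - T x) < e" by blast
qed

text \<open>The bound makes the map from \<open>x \<Omega>\<close> to \<open>x \<eta>\<close>, for x
  in the commutant of S, extend to all of H. The extension commutes with that commutant by
  construction and therefore lies in the bicommutant.\<close>

lemma left_bounded_operator:
  assumes S: "S \<subseteq> cbounded_ops" and cyc: "closure ((\<lambda>x. blinfun_apply x \<Omega>) ` commutant S) = UNIV"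
    and "0 \<le> C" and b: "\<And>x. x \<in> commutant S \<Longrightarrow> norm (blinfun_apply x \<eta>) \<le> C * norm (blinfun_apply x \<Omega>)"
  obtains a where "a \<in> commutant (commutant S)" "a \<Omega> = \<eta>" "norm a \<le> C"
proof -
  let ?R = "(\<lambda>x. (blinfun_apply x \<Omega>, blinfun_apply x \<eta>)) ` commutant S"
  have "subspace ?R"
  proof (rule subspaceI)
    have "0 \<in> commutant S" by (auto intro!: commutantI cboundedI simp: scaleC.zero_right)
    then show "0 \<in> ?R" by (force simp: zero_prod_def)
    show "z + w \<in> ?R" if zw: "z \<in> ?R" "w \<in> ?R" for z w
    proof -
      obtain x y where "x \<in> commutant S" "z = (x \<Omega>, x \<eta>)" "y \<in> commutant S" "w = (y \<Omega>, y \<eta>)" using zw by blast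
      then show ?thesis by (intro image_eqI[of _ _ "x + y"]) (auto simp: blinfun.bilinear_simps)
    qed
    show "r *\<^sub>R z \<in> ?R" if z: "z \<in> ?R" for r z
    proof -
      obtain x where "x \<in> commutant S" "z = (x \<Omega>, x \<eta>)" using z by blast
      then show ?thesis by (intro image_eqI[of _ _ "r *\<^sub>R x"]) (auto simp: blinfun.bilinear_simps)
    qed
  qed
  moreover have "closure (fst ` ?R) = UNIV" using cyc by (simp add: image_image)
  ultimately obtain a where a: "norm a \<le> C" "\<And>x y. (x, y) \<in> ?R \<Longrightarrow> blinfun_apply a x = y"
    using bounded_extension[of ?R C] b \<open>0 \<le> C\<close> by blast
  have ax: "a (x \<Omega>) = x \<eta>" if "x \<in> commutant S" for x using a(2) that by blast
  have comm: "y o\<^sub>L a = a o\<^sub>L y" if y: "y \<in> commutant S" for y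
  proof (rule blinfun_eq_on_dense[OF cyc])
    fix z assume "z \<in> (\<lambda>x. blinfun_apply x \<Omega>) ` commutant S"
    then obtain x where x: "x \<in> commutant S" "z = x \<Omega>" by blast
    have "y o\<^sub>L x \<in> commutant S" using x y by blast
    from ax[OF this] ax[OF x(1)] show "(y o\<^sub>L a) z = (a o\<^sub>L y) z" by (simp add: x(2))
  qed
  have "a \<in> cbounded_ops"
    unfolding cbounded_iff_commutes using comm commutant_closed_ops(2)[OF S] by metis
  then have "a \<in> commutant (commutant S)" using comm by (simp add: commutant_def)
  moreover have "a \<Omega> = \<eta>" using ax[of id_blinfun] by (auto intro: commutant_closed_ops)
  ultimately show thesis using that a(1) by blast
qed

text \<open>Balls of the bicommutant are complete for the norm at \<open>\<Omega>\<close>: the f n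
  commute with the commutant, so convergence at \<open>\<Omega>\<close> spreads to its dense orbit
  and, by the uniform bound, to every vector. This is used for averages in N and for the final
  sequence of unitaries.\<close>

lemma bounded_orbit_limit:
  assumes S: "S \<subseteq> cbounded_ops" and cyc: "closure ((\<lambda>x. blinfun_apply x \<Omega>) ` commutant S) = UNIV"
    and f: "\<And>n. f n \<in> commutant (commutant S)" "\<And>n. norm (f n) \<le> C"
    and lim: "(\<lambda>n. blinfun_apply (f n) \<Omega>) \<longlonglongrightarrow> \<eta>"
  obtains a where "a \<in> commutant (commutant S)" "a \<Omega> = \<eta>" "norm a \<le> C"
    "\<And>x. (\<lambda>n. blinfun_apply (f n) x) \<longlonglongrightarrow> a x"
proof -
  have C: "0 \<le> C" using f(2)[of 0] norm_ge_zero order_trans by blast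
  have comm: "x (f n z) = f n (x z)" if "x \<in> commutant S" for x n z
    using commutant_apply[OF f(1) that] by simp
  have "norm (x \<eta>) \<le> C * norm (x \<Omega>)" if x: "x \<in> commutant S" for x
  proof (rule Lim_norm_ubound)
    show "(\<lambda>n. x (f n \<Omega>)) \<longlonglongrightarrow> x \<eta>" by (intro blinfun.tendsto tendsto_const lim)
    have "norm (x (f n \<Omega>)) \<le> C * norm (x \<Omega>)" for n
      unfolding comm[OF x] by (meson norm_blinfun f(2) mult_right_mono norm_ge_zero order_trans)
    then show "\<forall>\<^sub>F n in sequentially. norm (x (f n \<Omega>)) \<le> C * norm (x \<Omega>)" by simp
  qed simp
  then obtain a where a: "a \<in> commutant (commutant S)" "a \<Omega> = \<eta>" "norm a \<le> C"
    using left_bounded_operator[OF S cyc C] by blast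
  have "(\<lambda>n. blinfun_apply (f n) x) \<longlonglongrightarrow> a x" for x
  proof (rule strong_tendsto_dense[OF cyc f(2)])
    fix z assume "z \<in> (\<lambda>x. blinfun_apply x \<Omega>) ` commutant S"
    then obtain x where x: "x \<in> commutant S" "z = x \<Omega>" by blast
    have "(\<lambda>n. x (f n \<Omega>)) \<longlonglongrightarrow> x (a \<Omega>)" unfolding a(2) by (intro blinfun.tendsto tendsto_const lim)
    then show "(\<lambda>n. f n z) \<longlonglongrightarrow> a z"
      using commutant_apply[OF a(1) x(1)] by (simp add: x(2) comm[OF x(1)])
  qed
  with a that show thesis by blast
qed

lemma cmod_cinner_apply_le:
  "cmod (cinner (blinfun_apply x \<xi>) \<eta>) \<le> norm x * ((norm \<xi>)\<^sup>2 + (norm \<eta>)\<^sup>2)"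
proof -
  have "cmod (cinner (x \<xi>) \<eta>) \<le> norm x * norm \<xi> * norm \<eta>"
    by (rule order_trans[OF cmod_cinner_le]) (simp add: mult_right_mono norm_blinfun)
  also have "norm \<xi> * norm \<eta> \<le> (norm \<xi>)\<^sup>2 + (norm \<eta>)\<^sup>2"
    using sum_squares_bound[of "norm \<xi>" "norm \<eta>"] mult_nonneg_nonneg[OF norm_ge_zero[of \<xi>] norm_ge_zero[of \<eta>]] by linarith
  then have "norm x * norm \<xi> * norm \<eta> \<le> norm x * ((norm \<xi>)\<^sup>2 + (norm \<eta>)\<^sup>2)"
    by (simp add: mult.assoc mult_left_mono)
  finally show ?thesis .
qed

text \<open>Dominated convergence for the defining series, with the summable majorant coming from
  the uniform bound on norms.\<close>

lemma ultraweakly_continuous_tendsto: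
  assumes "ultraweakly_continuous A \<phi>" and f: "\<And>n. f n \<in> A" "\<And>n. norm (f n) \<le> C" and "T \<in> A"
    and lim: "\<And>x. (\<lambda>n. blinfun_apply (f n) x) \<longlonglongrightarrow> blinfun_apply T x"
  shows "(\<lambda>n. \<phi> (f n)) \<longlonglongrightarrow> \<phi> T"
proof -
  from assms(1) obtain \<xi> \<eta> :: "nat \<Rightarrow> 'a" where s: "summable (\<lambda>n. (norm (\<xi> n))\<^sup>2)" "summable (\<lambda>n. (norm (\<eta> n))\<^sup>2)"
    and sm: "\<And>x. x \<in> A \<Longrightarrow> (\<lambda>n. cinner (x (\<xi> n)) (\<eta> n)) sums \<phi> x"
    unfolding ultraweakly_continuous_def by blast
  let ?B = "\<lambda>k. C * ((norm (\<xi> k))\<^sup>2 + (norm (\<eta> k))\<^sup>2)"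
  have "cmod (cinner (f n (\<xi> k)) (\<eta> k)) \<le> ?B k" for n k
    by (rule order_trans[OF cmod_cinner_apply_le]) (simp add: f(2) mult_right_mono)
  then have "(\<lambda>n. \<Sum>k. cinner (f n (\<xi> k)) (\<eta> k)) \<longlonglongrightarrow> (\<Sum>k. cinner (T (\<xi> k)) (\<eta> k))"
    using s lim
    by (intro tannerys_theorem[where M = ?B, THEN conjunct2, THEN conjunct2])
      (auto intro!: always_eventually cinner.tendsto summable_mult summable_add)
  then show ?thesis using sm f(1) \<open>T \<in> A\<close> by (simp add: sums_iff)
qed

text \<open>The defining series converges for every bounded operator. The resulting F replaces a
  trace, whose values outside A are arbitrary, wherever a bounded linear functional on the whole
  operator space is required, as in differentiation.\<close>

lemma ultraweakly_continuous_extends: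
  assumes "ultraweakly_continuous A \<phi>"
  obtains F where "bounded_linear F" "\<And>x. x \<in> A \<Longrightarrow> F x = \<phi> x"
proof -
  from assms obtain \<xi> \<eta> :: "nat \<Rightarrow> 'a" where s: "summable (\<lambda>n. (norm (\<xi> n))\<^sup>2)" "summable (\<lambda>n. (norm (\<eta> n))\<^sup>2)"
    and sm: "\<And>x. x \<in> A \<Longrightarrow> (\<lambda>n. cinner (blinfun_apply x (\<xi> n)) (\<eta> n)) sums \<phi> x"
    unfolding ultraweakly_continuous_def by blast
  define F where "F = (\<lambda>x. \<Sum>n. cinner (blinfun_apply x (\<xi> n)) (\<eta> n))"
  let ?B = "\<lambda>n. (norm (\<xi> n))\<^sup>2 + (norm (\<eta> n))\<^sup>2"
  have sB: "summable ?B" using s by (rule summable_add)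
  have sumb: "summable (\<lambda>n. cinner (blinfun_apply x (\<xi> n)) (\<eta> n))" for x
    by (rule summable_comparison_test'[OF summable_mult[OF sB] cmod_cinner_apply_le])
  have "bounded_linear F"
  proof (rule bounded_linear_intro[where K = "suminf ?B"])
    show "F (x + y) = F x + F y" for x y
      unfolding F_def by (simp add: blinfun.add_left cinner.add_left suminf_add sumb)
    show "F (r *\<^sub>R x) = r *\<^sub>R F x" for r x
      unfolding F_def by (simp add: blinfun.scaleR_left cinner.scaleR_left suminf_scaleR_right sumb)
    show "norm (F x) \<le> norm x * suminf ?B" for x
      unfolding F_def suminf_mult[OF sB, symmetric] by (rule norm_suminf_le[OF cmod_cinner_apply_le summable_mult[OF sB]])
  qed
  moreover have "F x = \<phi> x" if "x \<in> A" for x using sm[OF that] by (simp add: F_def sums_iff)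
  ultimately show thesis using that by blast
qed

section \<open>Von Neumann algebras, unitaries and traces\<close>

lemma von_neumann_algebraD:
  assumes "von_neumann_algebra A"
  shows "A \<subseteq> cbounded_ops" "x \<in> A \<Longrightarrow> adj x \<in> A" "commutant (commutant A) = A"
    "id_blinfun \<in> A" "scalar_op c \<in> A" "x \<in> A \<Longrightarrow> y \<in> A \<Longrightarrow> x o\<^sub>L y \<in> A" "x \<in> A \<Longrightarrow> y \<in> A \<Longrightarrow> x + y \<in> A"
    "x \<in> A \<Longrightarrow> y \<in> A \<Longrightarrow> x - y \<in> A" "x \<in> A \<Longrightarrow> - x \<in> A" "x \<in> A \<Longrightarrow> r *\<^sub>R x \<in> A"
proof -
  show 1: "A \<subseteq> cbounded_ops" and "x \<in> A \<Longrightarrow> adj x \<in> A" and 2: "commutant (commutant A) = A"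
    using assms by (auto simp: von_neumann_algebra_def)
  have "commutant A \<subseteq> cbounded_ops" by (auto simp: commutant_cbounded)
  from commutant_closed_ops(2)[OF this] show "scalar_op c \<in> A" using 2 by simp
  note closed = commutant_closed_ops[where S = "commutant A", unfolded 2]
  show "id_blinfun \<in> A" by (rule closed(1))
  show "x \<in> A \<Longrightarrow> y \<in> A \<Longrightarrow> x o\<^sub>L y \<in> A" by (rule closed(3))
  show "x \<in> A \<Longrightarrow> y \<in> A \<Longrightarrow> x + y \<in> A" by (rule closed(4))
  show "x \<in> A \<Longrightarrow> y \<in> A \<Longrightarrow> x - y \<in> A" by (rule closed(5))
  show "x \<in> A \<Longrightarrow> - x \<in> A" by (rule closed(6))
  show "x \<in> A \<Longrightarrow> r *\<^sub>R x \<in> A" by (rule closed(7))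
qed

lemmas von_neumann_intros = von_neumann_algebraD(2,4-10)

text \<open>The standard test for membership of roots, inverses and projections. Complex linearity
  is included, because the scalars belong to the commutant.\<close>

lemma von_neumann_algebraI:
  assumes "von_neumann_algebra A" "\<And>y. y \<in> commutant A \<Longrightarrow> y o\<^sub>L x = x o\<^sub>L y"
  shows "x \<in> A"
proof -
  note A = von_neumann_algebraD[OF assms(1)]
  have "scalar_op c \<in> commutant A" for c using commutant_closed_ops(2)[OF A(1)] .
  then have "x \<in> cbounded_ops" unfolding cbounded_iff_commutes using assms(2) by metis
  then have "x \<in> commutant (commutant A)" using assms(2) by (simp add: commutant_def)
  then show ?thesis using A(3) by simp
qed

lemma von_neumann_commutant:
  assumes "S \<subseteq> cbounded_ops" "adj ` S \<subseteq> S"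
  shows "von_neumann_algebra (commutant S)"
  unfolding von_neumann_algebra_def
  using tricommutant[OF assms(1)] commutant_adj[OF assms] by (auto simp: commutant_cbounded)

lemma commutant_self_commute: "x \<in> A \<Longrightarrow> y \<in> commutant A \<Longrightarrow> y o\<^sub>L x = x o\<^sub>L y"
  by (simp add: commutant_def)

lemma norm_adj_le:
  assumes "T \<in> cbounded_ops"
  shows "norm (adj T) \<le> norm T"
proof (rule norm_blinfun_bound)
  fix x
  have "norm (adj T x) * norm (adj T x) = inner (T (adj T x)) x"
    by (simp add: inner_adj[OF assms] dot_square_norm power2_eq_square)
  also have "\<dots> \<le> norm T * norm (adj T x) * norm x"
    by (rule order_trans[OF norm_cauchy_schwarz]) (simp add: mult_right_mono norm_blinfun)
  finally show "norm (adj T x) \<le> norm T * norm x"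
    by (cases "norm (adj T x) = 0") (simp_all add: mult.commute mult.left_commute)
qed simp

lemma unitariesD:
  assumes "u \<in> unitaries A"
  shows "u \<in> A" "adj u (u x) = x" "u (adj u x) = x"
proof -
  have u: "u \<in> A" "adj u o\<^sub>L u = id_blinfun" "u o\<^sub>L adj u = id_blinfun" using assms by (auto simp: unitaries_def)
  show "u \<in> A" "adj u (u x) = x" "u (adj u x) = x"
    using u(1) arg_cong[OF u(2), of "\<lambda>Z. blinfun_apply Z x"] arg_cong[OF u(3), of "\<lambda>Z. blinfun_apply Z x"] by simp_all
qed

lemma unitariesI:
  assumes "u \<in> A" "\<And>x. adj u (blinfun_apply u x) = x" "\<And>x. u (blinfun_apply (adj u) x) = x"
  shows "u \<in> unitaries A"
proof -
  have "adj u o\<^sub>L u = id_blinfun" "u o\<^sub>L adj u = id_blinfun" by (rule blinfun_eqI, simp add: assms)+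
  with assms(1) show ?thesis by (simp add: unitaries_def)
qed

lemma unitary_norm:
  assumes "u \<in> unitaries A" "A \<subseteq> cbounded_ops"
  shows "norm (blinfun_apply u x) = norm x" "norm u \<le> 1"
proof -
  have u: "u \<in> cbounded_ops" using unitariesD(1)[OF assms(1)] assms(2) by blast
  have "inner (u x) (u x) = inner x x" for x by (simp add: inner_adj[OF u] unitariesD[OF assms(1)])
  then show *: "norm (u x) = norm x" for x by (simp add: norm_eq_sqrt_inner)
  show "norm u \<le> 1" by (rule norm_blinfun_bound) (simp_all add: *)
qed

lemma unitaries_closed:
  assumes "von_neumann_algebra A"
  shows "id_blinfun \<in> unitaries A" "u \<in> unitaries A \<Longrightarrow> adj u \<in> unitaries A"
    "u \<in> unitaries A \<Longrightarrow> v \<in> unitaries A \<Longrightarrow> u o\<^sub>L v \<in> unitaries A"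
proof -
  note A = von_neumann_algebraD[OF assms]
  show "id_blinfun \<in> unitaries A" using A(4) by (auto intro: unitariesI)
  show "adj u \<in> unitaries A" if u: "u \<in> unitaries A"
  proof -
    have "u \<in> cbounded_ops" using unitariesD(1)[OF u] A(1) by blast
    then show ?thesis using A(2) unitariesD[OF u] by (intro unitariesI) auto
  qed
  show "u o\<^sub>L v \<in> unitaries A" if u: "u \<in> unitaries A" and v: "v \<in> unitaries A"
  proof -
    have c: "u \<in> cbounded_ops" "v \<in> cbounded_ops" using unitariesD(1)[OF u] unitariesD(1)[OF v] A(1) by blast+
    show ?thesis
      by (rule unitariesI)
        (simp_all add: adj_unary adj_simps(1)[OF c] unitariesD[OF u] unitariesD[OF v] A(6))
  qed
qed

section \<open>Cayley transforms and sums of unitaries\<close>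

lemma skew_resolvent:
  assumes A: "von_neumann_algebra A" and k: "k \<in> A" "adj k = - k"
  obtains R where "R \<in> A" "R o\<^sub>L (id_blinfun - k) = id_blinfun" "(id_blinfun - k) o\<^sub>L R = id_blinfun" "norm R \<le> 1"
proof -
  note AD = von_neumann_algebraD[OF A]
  have kc: "k \<in> cbounded_ops" using k(1) AD(1) by blast
  have sk: "inner (k x) x = 0" for x
    using inner_adj[OF kc, of x x] k(2) by (simp add: blinfun.minus_left inner_commute)
  \<comment> \<open>The cross terms vanish for skew k, so both 1 - k and its adjoint 1 + k are
    bounded below by 1; this is also why the resolvent is a contraction.\<close>
  have e1: "(norm (x - k x))\<^sup>2 = (norm x)\<^sup>2 + (norm (k x))\<^sup>2" "(norm (x + k x))\<^sup>2 = (norm x)\<^sup>2 + (norm (k x))\<^sup>2" for x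
    using sk[of x] unfolding power2_norm_eq_inner by (simp_all add: inner_simps inner_commute)
  have ad: "adj (id_blinfun - k) = id_blinfun + k" using k(2) by (simp add: adj_unary adj_simps kc)
  obtain R where R: "R \<in> cbounded_ops" "R o\<^sub>L (id_blinfun - k) = id_blinfun" "(id_blinfun - k) o\<^sub>L R = id_blinfun" "norm R \<le> 1 / 1"
  proof (rule bounded_below_invertible[of "id_blinfun - k" 1])
    show "id_blinfun - k \<in> cbounded_ops" using kc by simp
    show "1 * norm x \<le> norm ((id_blinfun - k) x)" for x
      by (rule power2_le_imp_le) (simp_all add: blinfun.diff_left e1)
    show "1 * norm x \<le> norm (adj (id_blinfun - k) x)" for x
      unfolding ad by (rule power2_le_imp_le) (simp_all add: blinfun.add_left e1)
  qed simp
  have "R \<in> A"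
  proof (rule von_neumann_algebraI[OF A])
    fix y assume y: "y \<in> commutant A"
    show "y o\<^sub>L R = R o\<^sub>L y"
      by (rule inverse_commutes[OF R(2,3)], rule commutesI)
        (simp add: blinfun.diff_left blinfun.diff_right commutant_apply[OF y k(1)])
  qed
  then show thesis using that R by simp
qed

text \<open>Since (1 - k) R = 1, the operator 2 R - 1 is the Cayley transform (1 + k) R.\<close>

lemma cayley_unitary:
  assumes A: "von_neumann_algebra A" and k: "k \<in> A" "adj k = - k"
    and R: "R \<in> A" "R o\<^sub>L (id_blinfun - k) = id_blinfun" "(id_blinfun - k) o\<^sub>L R = id_blinfun"
  shows "2 *\<^sub>R R - id_blinfun \<in> unitaries A"
    and "adj R o\<^sub>L (id_blinfun + k) = id_blinfun" "(id_blinfun + k) o\<^sub>L adj R = id_blinfun"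
proof -
  note AD = von_neumann_algebraD[OF A]
  have c: "k \<in> cbounded_ops" "R \<in> cbounded_ops" "id_blinfun - k \<in> cbounded_ops" using k(1) R(1) AD(1) by auto
  have ad: "adj (id_blinfun - k) = id_blinfun + k" using k(2) by (simp add: adj_unary adj_simps c)
  show R': "adj R o\<^sub>L (id_blinfun + k) = id_blinfun" "(id_blinfun + k) o\<^sub>L adj R = id_blinfun"
    using arg_cong[OF R(3), of adj] arg_cong[OF R(2), of adj]
    unfolding adj_simps(1)[OF c(3) c(2)] adj_simps(1)[OF c(2) c(3)] ad by simp_all
  have kR: "k (R x) = R x - x" for x
    using arg_cong[OF R(3), of "\<lambda>Z. blinfun_apply Z x"] by (simp add: blinfun.diff_left algebra_simps)
  have kR': "k (adj R x) = x - adj R x" for x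
    using arg_cong[OF R'(2), of "\<lambda>Z. blinfun_apply Z x"] by (simp add: blinfun.add_left algebra_simps)
  have Rk: "R (k x) = R x - x" for x
    using arg_cong[OF R(2), of "\<lambda>Z. blinfun_apply Z x"] by (simp add: blinfun.diff_left blinfun.diff_right algebra_simps)
  have Rk': "adj R (k x) = x - adj R x" for x
    using arg_cong[OF R'(1), of "\<lambda>Z. blinfun_apply Z x"] by (simp add: blinfun.add_left blinfun.add_right algebra_simps)
  \<comment> \<open>Evaluating R k R', with R' the adjoint of R, in two ways gives 2 R R' = R + R',
    which is exactly unitarity of 2 R - 1 on one side.\<close>
  have "R (k (adj R x)) = R (adj R x) - adj R x" for x by (rule Rk)
  then have e1: "2 *\<^sub>R R (adj R x) = R x + adj R x" for x
    unfolding kR' by (simp add: blinfun.diff_right scaleR_2 algebra_simps)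
  have "adj R (k (R x)) = R x - adj R (R x)" for x by (rule Rk')
  then have e2: "2 *\<^sub>R adj R (R x) = R x + adj R x" for x
    unfolding kR by (simp add: blinfun.diff_right scaleR_2 algebra_simps)
  have adw: "adj (2 *\<^sub>R R - id_blinfun) = 2 *\<^sub>R adj R - id_blinfun" by (simp add: adj_unary adj_simps c)
  show "2 *\<^sub>R R - id_blinfun \<in> unitaries A"
  proof (rule unitariesI)
    show "2 *\<^sub>R R - id_blinfun \<in> A" by (intro von_neumann_intros[OF A] R(1))
    fix x
    show "adj (2 *\<^sub>R R - id_blinfun) ((2 *\<^sub>R R - id_blinfun) x) = x"
      unfolding adw by (simp add: blinfun.bilinear_simps e2)
    show "(2 *\<^sub>R R - id_blinfun) (adj (2 *\<^sub>R R - id_blinfun) x) = x"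
      unfolding adw by (simp add: blinfun.bilinear_simps e1)
  qed
qed

text \<open>A skew element is recovered from its Cayley transform, so b commutes with it; a general
  x is a combination of the skew elements x - x' and i (x + x'), x' being the adjoint. It shows in
  \<open>trace_N_p\<close> that an average is central.\<close>

lemma commutes_with_unitaries:
  assumes A: "von_neumann_algebra A" and b: "b \<in> cbounded_ops"
    and comm: "\<And>u. u \<in> unitaries A \<Longrightarrow> b o\<^sub>L u = u o\<^sub>L b"
  shows "b \<in> commutant A"
proof (rule commutantI[OF b])
  note AD = von_neumann_algebraD[OF A]
  have skew: "b (k x) = k (b x)" if k: "k \<in> A" "adj k = - k" for k x
  proof -
    obtain R where R: "R \<in> A" "R o\<^sub>L (id_blinfun - k) = id_blinfun" "(id_blinfun - k) o\<^sub>L R = id_blinfun" "norm R \<le> 1"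
      by (rule skew_resolvent[OF A k])
    have "b ((2 *\<^sub>R R - id_blinfun) y) = (2 *\<^sub>R R - id_blinfun) (b y)" for y
      by (rule commutes_apply[OF comm[OF cayley_unitary(1)[OF A k R(1-3)]]])
    then have "b o\<^sub>L R = R o\<^sub>L b" by (intro commutesI) (simp add: blinfun.bilinear_simps)
    from inverse_commutes[OF R(3,2) this] have "b o\<^sub>L (id_blinfun - k) = (id_blinfun - k) o\<^sub>L b" .
    from commutes_apply[OF this, of x] show ?thesis by (simp add: blinfun.diff_left blinfun.diff_right)
  qed
  fix x z assume x: "x \<in> A"
  then have xc: "x \<in> cbounded_ops" "adj x \<in> A" using AD(1,2) by auto
  have xc': "adj x \<in> cbounded_ops" using xc(2) AD(1) by blast
  let ?k = "scalar_op \<i> o\<^sub>L (x + adj x)"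
  have "?k \<in> A" "x - adj x \<in> A" by (intro von_neumann_intros[OF A] x)+
  moreover have "adj ?k = - ?k"
    by (rule blinfun_eqI) (simp add: adj_unary adj_simps adj_scalar_op xc xc' blinfun.bilinear_simps scaleC.minus_left
        cboundedD[OF xc(1)] cboundedD[OF xc'] scaleC.add_right add.commute)
  moreover have "adj (x - adj x) = - (x - adj x)" by (simp add: adj_unary adj_simps xc xc')
  ultimately have 1: "b (?k z) = ?k (b z)" and 2: "b ((x - adj x) z) = (x - adj x) (b z)" using skew by blast+
  have "\<i> *\<^sub>C b ((x + adj x) z) = \<i> *\<^sub>C (x + adj x) (b z)" using 1 by (simp add: cboundedD[OF b])
  from arg_cong[OF this, of "\<lambda>y. (- \<i>) *\<^sub>C y"] have 3: "b ((x + adj x) z) = (x + adj x) (b z)"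
    by (simp add: scaleC_scaleC)
  have "b ((x - adj x) z) + b ((x + adj x) z) = (x - adj x) (b z) + (x + adj x) (b z)" by (simp only: 2 3)
  then have "2 *\<^sub>R b (x z) = 2 *\<^sub>R x (b z)" by (simp add: blinfun.bilinear_simps scaleR_2)
  then show "b (x z) = x (b z)" by simp
qed

text \<open>A trick of Gardner: \<open>(u + a) / 2\<close> is an invertible contraction with polar decomposition \<open>W G\<close>, hence the mean of the
  unitaries \<open>W (G \<plusminus> \<i> F)\<close> where \<open>F\<^sup>2 = 1 - G\<^sup>2\<close>.\<close>

lemma unitary_plus_contraction:
  assumes A: "von_neumann_algebra A" and u: "u \<in> unitaries A" and a: "a \<in> A" "norm a < 1"
  obtains w1 w2 where "w1 \<in> unitaries A" "w2 \<in> unitaries A" "u + a = w1 + w2"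
proof -
  note AD = von_neumann_algebraD[OF A]
  have uA: "u \<in> A" by (rule unitariesD(1)[OF u])
  define T where "T = (1/2) *\<^sub>R (u + a)"
  \<comment> \<open>The strict bound on a leaves this gap: u is isometric and a shrinks, so T and
    its adjoint are bounded below by d and T is invertible.\<close>
  define d where "d = (1/2) * (1 - norm a)"
  have d: "0 < d" using a(2) by (simp add: d_def)
  have TA: "T \<in> A" unfolding T_def by (intro von_neumann_intros[OF A] uA a(1))
  have c: "u \<in> cbounded_ops" "a \<in> cbounded_ops" "T \<in> cbounded_ops" using uA a(1) TA AD(1) by blast+
  have ad: "adj T = (1/2) *\<^sub>R (adj u + adj a)" by (simp add: T_def adj_unary adj_simps c)
  have low: "d * norm x \<le> norm ((1/2) *\<^sub>R (v x + b x))"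
    if v: "v \<in> unitaries A" and b: "norm b \<le> norm a" for v b :: "'a \<Rightarrow>\<^sub>L 'a" and x
  proof -
    have "norm (b x) \<le> norm a * norm x" by (rule order_trans[OF norm_blinfun]) (simp add: b mult_right_mono)
    moreover have "norm (v x) - norm (b x) \<le> norm (v x + b x)" using norm_diff_ineq by blast
    ultimately have "norm x - norm a * norm x \<le> norm (v x + b x)" by (simp add: unitary_norm(1)[OF v AD(1)])
    then show ?thesis unfolding norm_scaleR by (simp add: d_def algebra_simps)
  qed
  have lT: "d * norm x \<le> norm (T x)" for x
    using low[OF u, of a x] by (simp add: T_def blinfun.bilinear_simps)
  have lT': "d * norm x \<le> norm (adj T x)" for x
    using low[OF unitaries_closed(2)[OF A u], of "adj a" x] norm_adj_le[OF c(2)] by (simp add: ad blinfun.bilinear_simps)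
  have nT: "norm T \<le> 1"
    using norm_triangle_ineq[of u a] unitary_norm(2)[OF u AD(1)] a(2) by (simp add: T_def)
  define B where "B = adj T o\<^sub>L T"
  have BA: "B \<in> A" unfolding B_def by (intro von_neumann_intros[OF A] TA)
  have Bc: "B \<in> cbounded_ops" using BA AD(1) by blast
  have TT: "inner (B x) x = (norm (T x))\<^sup>2" for x
    by (simp add: B_def power2_norm_eq_inner inner_adj[OF c(3), of x "T x"] inner_commute)
  have "adj B = B" by (simp add: B_def adj_unary adj_simps c adj_cbounded)
  then have sB: "selfadjoint B" using selfadjoint_iff_adj Bc by blast
  then have pB: "positive_op B" by (simp add: positive_op_def TT)
  have nTx: "(norm (T x))\<^sup>2 \<le> (norm x)\<^sup>2" for x
    using order_trans[OF norm_blinfun[of T x] mult_right_mono[OF nT norm_ge_zero]] by (intro power_mono) simp_all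
  have nB: "norm B \<le> 1" by (rule norm_selfadjoint_le[OF sB]) (simp_all add: TT nTx)
  obtain G where G: "G \<in> cbounded_ops" "positive_op G" "G o\<^sub>L G = B" "norm G \<le> 1"
    "\<And>C. C o\<^sub>L B = B o\<^sub>L C \<Longrightarrow> C o\<^sub>L G = G o\<^sub>L C" by (rule positive_sqrt[OF Bc pB nB]) blast
  have sX: "selfadjoint (id_blinfun - B)"
    using sB by (simp add: selfadjoint_def blinfun.diff_left inner_diff_left inner_diff_right)
  then have pX: "positive_op (id_blinfun - B)"
    by (simp add: positive_op_def blinfun.diff_left inner_diff_left TT dot_square_norm nTx)
  have nX: "norm (id_blinfun - B) \<le> 1"
    by (rule norm_selfadjoint_le[OF sX]) (simp_all add: blinfun.diff_left inner_diff_left TT dot_square_norm nTx abs_of_nonneg)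
  have Xc: "id_blinfun - B \<in> cbounded_ops" using Bc by simp
  obtain F where F: "F \<in> cbounded_ops" "positive_op F" "F o\<^sub>L F = id_blinfun - B" "norm F \<le> 1"
    "\<And>C. C o\<^sub>L (id_blinfun - B) = (id_blinfun - B) o\<^sub>L C \<Longrightarrow> C o\<^sub>L F = F o\<^sub>L C" by (rule positive_sqrt[OF Xc pX nX]) blast
  have Fcomm: "C o\<^sub>L F = F o\<^sub>L C" if "C o\<^sub>L B = B o\<^sub>L C" for C
    by (rule F(5), rule commutesI) (simp add: blinfun.diff_left blinfun.diff_right commutes_apply[OF that])
  have GA: "G \<in> A" by (rule von_neumann_algebraI[OF A]) (rule G(5)[OF commutant_self_commute[OF BA]])
  have FA: "F \<in> A" by (rule von_neumann_algebraI[OF A]) (rule Fcomm[OF commutant_self_commute[OF BA]])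
  have GG: "G (G x) = B x" and FF: "F (F x) = x - B x" for x
    using arg_cong[OF G(3), of "\<lambda>Z. blinfun_apply Z x"] arg_cong[OF F(3), of "\<lambda>Z. blinfun_apply Z x"]
    by (simp_all add: blinfun.diff_left)
  have "G o\<^sub>L B = B o\<^sub>L G" by (rule commutesI) (simp flip: GG)
  then have GF: "G (F x) = F (G x)" for x by (rule commutes_apply[OF Fcomm])
  have sG: "selfadjoint G" "selfadjoint F" using G(2) F(2) by (simp_all add: positive_op_def)
  have aG: "adj G = G" "adj F = F" using sG selfadjoint_iff_adj G(1) F(1) by blast+
  have "norm (G x) = norm (T x)" for x
  proof -
    have "(norm (G x))\<^sup>2 = inner (G (G x)) x" by (simp only: power2_norm_eq_inner selfadjointD[OF sG(1), of "G x" x])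
    then have "(norm (G x))\<^sup>2 = (norm (T x))\<^sup>2" by (simp only: GG TT)
    then show ?thesis by simp
  qed
  then have lG: "d * norm x \<le> norm (G x)" "d * norm x \<le> norm (adj G x)" for x using lT by (simp_all add: aG)
  obtain H where H: "H \<in> cbounded_ops" "H o\<^sub>L G = id_blinfun" "G o\<^sub>L H = id_blinfun" "norm H \<le> 1 / d"
    by (rule bounded_below_invertible[OF G(1) d lG]) blast
  obtain L where L: "L \<in> cbounded_ops" "L o\<^sub>L T = id_blinfun" "T o\<^sub>L L = id_blinfun" "norm L \<le> 1 / d"
    by (rule bounded_below_invertible[OF c(3) d lT lT']) blast
  have HG: "H (G x) = x" "G (H x) = x" and TL: "T (L x) = x" for x
    using arg_cong[OF H(2), of "\<lambda>Z. blinfun_apply Z x"] arg_cong[OF H(3), of "\<lambda>Z. blinfun_apply Z x"]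
      arg_cong[OF L(3), of "\<lambda>Z. blinfun_apply Z x"] by simp_all
  have HA: "H \<in> A"
    by (rule von_neumann_algebraI[OF A]) (rule inverse_commutes[OF H(2,3) commutant_self_commute[OF GA]])
  have aH: "adj H x = H x" for x
  proof -
    have "G (adj H x) = x"
      using arg_cong[OF H(2), of "\<lambda>Z. blinfun_apply (adj Z) x"] unfolding adj_simps(1)[OF H(1) G(1)] by (simp add: aG)
    then show ?thesis using HG(1)[of "adj H x"] by simp
  qed
  \<comment> \<open>The polar part of T: G is its absolute value and H the inverse of G. The
    operator F is the root of 1 minus the square of G, so adding plus or minus i F to G gives
    unitaries.\<close>
  define W where "W = T o\<^sub>L H"
  have WA: "W \<in> A" unfolding W_def by (intro von_neumann_intros[OF A] TA HA)
  have Wc: "W \<in> cbounded_ops" using WA AD(1) by blast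
  have aW: "adj W x = H (adj T x)" for x by (simp add: W_def adj_simps(1) c H aH)
  have WW: "adj W (W x) = x" for x
  proof -
    have "adj W (W x) = H (B (H x))" unfolding aW by (simp add: W_def B_def)
    then show ?thesis by (simp add: HG flip: GG)
  qed
  have "W (G (L x)) = x" for x by (simp add: W_def HG TL)
  then have "adj W x = G (L x)" for x using WW[of "G (L x)"] by simp
  then have "W (adj W x) = x" for x by (simp add: W_def HG TL)
  then have Wu: "W \<in> unitaries A" by (intro unitariesI WA WW)
  have su: "G + (scalar_op s o\<^sub>L F) \<in> unitaries A" if s: "s * cnj s = 1" "cnj s = - s" for s
  proof -
    have ad: "adj (G + (scalar_op s o\<^sub>L F)) = G + (F o\<^sub>L scalar_op (- s))"
      using s(2) by (simp add: adj_unary adj_simps aG G(1) F(1) adj_scalar_op)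
    have ss: "- (s * s) = 1" using s by simp
    have sF: "F (t *\<^sub>C x) = t *\<^sub>C F x" "G (t *\<^sub>C x) = t *\<^sub>C G x" for t x by (simp_all add: cboundedD F(1) G(1))
    have one: "(- (s * s)) *\<^sub>C x = x" for x :: 'a unfolding ss using scaleC_of_real[of 1 x] by simp
    show ?thesis
    proof (rule unitariesI)
      show "G + (scalar_op s o\<^sub>L F) \<in> A" by (intro von_neumann_intros[OF A] GA FA)
      fix x
      show "adj (G + (scalar_op s o\<^sub>L F)) ((G + (scalar_op s o\<^sub>L F)) x) = x"
        unfolding ad using one[of "x - B x"]
        by (simp add: blinfun.bilinear_simps sF GF scaleC.add_right scaleC_scaleC GG FF scaleC.minus_left scaleC.diff_right algebra_simps)
      show "(G + (scalar_op s o\<^sub>L F)) (adj (G + (scalar_op s o\<^sub>L F)) x) = x"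
        unfolding ad using one[of "x - B x"]
        by (simp add: blinfun.bilinear_simps sF GF scaleC.add_right scaleC_scaleC GG FF scaleC.minus_left scaleC.diff_right algebra_simps)
    qed
  qed
  have s1: "G + (scalar_op \<i> o\<^sub>L F) \<in> unitaries A" and s2: "G + (scalar_op (- \<i>) o\<^sub>L F) \<in> unitaries A"
    by (rule su; simp)+
  show thesis
  proof (rule that)
    show "W o\<^sub>L (G + (scalar_op \<i> o\<^sub>L F)) \<in> unitaries A" "W o\<^sub>L (G + (scalar_op (- \<i>) o\<^sub>L F)) \<in> unitaries A"
      using unitaries_closed(3)[OF A Wu] s1 s2 by blast+
    show "u + a = (W o\<^sub>L (G + (scalar_op \<i> o\<^sub>L F))) + (W o\<^sub>L (G + (scalar_op (- \<i>) o\<^sub>L F)))"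
    proof (rule blinfun_eqI)
      fix x
      have "W (G x) + W (G x) = 2 *\<^sub>R T x" by (simp add: W_def HG scaleR_2)
      then show "(u + a) x = ((W o\<^sub>L (G + (scalar_op \<i> o\<^sub>L F))) + (W o\<^sub>L (G + (scalar_op (- \<i>) o\<^sub>L F)))) x"
        by (simp add: blinfun.bilinear_simps T_def scaleC.minus_left)
    qed
  qed
qed

text \<open>Let S be the supremum over the unitaries. Writing u + a as a sum of two unitaries gives
  f u + f a at most 2 S for every u; the supremum over u gives S + f a at most 2 S.\<close>

lemma additive_le_sup_unitaries:
  assumes A: "von_neumann_algebra A" and f: "\<And>x y. x \<in> A \<Longrightarrow> y \<in> A \<Longrightarrow> f (x + y) = f x + (f y :: real)"
    and s: "\<And>w. w \<in> unitaries A \<Longrightarrow> f w \<le> s" and a: "a \<in> A" "norm a < 1"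
  shows "f a \<le> s"
proof -
  define S where "S = (SUP w\<in>unitaries A. f w)"
  have ne: "unitaries A \<noteq> {}" using unitaries_closed(1)[OF A] by blast
  have bdd: "bdd_above (f ` unitaries A)" using s by (intro bdd_aboveI[of _ s]) auto
  have le: "f w \<le> S" if "w \<in> unitaries A" for w unfolding S_def by (rule cSUP_upper[OF that bdd])
  have "f u \<le> 2 * S - f a" if u: "u \<in> unitaries A" for u
  proof -
    obtain w1 w2 where w: "w1 \<in> unitaries A" "w2 \<in> unitaries A" "u + a = w1 + w2"
      by (rule unitary_plus_contraction[OF A u a])
    have "f u + f a = f w1 + f w2"
      using f[OF unitariesD(1)[OF u] a(1)] f[OF unitariesD(1)[OF w(1)] unitariesD(1)[OF w(2)]] w(3) by simp
    then show ?thesis using le[OF w(1)] le[OF w(2)] by simp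
  qed
  then have "S \<le> 2 * S - f a" unfolding S_def by (rule cSUP_least[OF ne])
  moreover have "S \<le> s" unfolding S_def using s by (rule cSUP_least[OF ne])
  ultimately show ?thesis by simp
qed

section \<open>Traces\<close>

lemma normalized_traceD:
  assumes "normalized_trace A \<tau>"
  shows "x \<in> A \<Longrightarrow> y \<in> A \<Longrightarrow> \<tau> (x + y) = \<tau> x + \<tau> y" "x \<in> A \<Longrightarrow> \<tau> (scalar_op c o\<^sub>L x) = c * \<tau> x"
    "\<tau> id_blinfun = 1" "x \<in> A \<Longrightarrow> \<tau> (adj x o\<^sub>L x) \<in> \<real>\<^sub>\<ge>\<^sub>0" "x \<in> A \<Longrightarrow> \<tau> (adj x o\<^sub>L x) = 0 \<Longrightarrow> x = 0"
    "x \<in> A \<Longrightarrow> y \<in> A \<Longrightarrow> \<tau> (x o\<^sub>L y) = \<tau> (y o\<^sub>L x)" "ultraweakly_continuous A \<tau>"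
proof -
  note t1 = assms[unfolded normalized_trace_def]
  note t2 = conjunct2[OF t1] note t3 = conjunct2[OF t2] note t4 = conjunct2[OF t3]
  note t5 = conjunct2[OF t4] note t6 = conjunct2[OF t5] note t7 = conjunct2[OF t6]
  show "x \<in> A \<Longrightarrow> y \<in> A \<Longrightarrow> \<tau> (x + y) = \<tau> x + \<tau> y" by (rule conjunct1[OF t1, rule_format])
  show "x \<in> A \<Longrightarrow> \<tau> (scalar_op c o\<^sub>L x) = c * \<tau> x" by (rule conjunct1[OF t2, rule_format])
  show "\<tau> id_blinfun = 1" by (rule conjunct1[OF t3])
  show "x \<in> A \<Longrightarrow> \<tau> (adj x o\<^sub>L x) \<in> \<real>\<^sub>\<ge>\<^sub>0" by (rule conjunct1[OF t4, rule_format])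
  show "x \<in> A \<Longrightarrow> \<tau> (adj x o\<^sub>L x) = 0 \<Longrightarrow> x = 0" by (rule conjunct1[OF t5, rule_format])
  show "x \<in> A \<Longrightarrow> y \<in> A \<Longrightarrow> \<tau> (x o\<^sub>L y) = \<tau> (y o\<^sub>L x)" by (rule conjunct1[OF t6, rule_format])
  show "ultraweakly_continuous A \<tau>" by (rule t7)
qed

lemma normalized_trace_scaleR:
  assumes "normalized_trace A \<tau>" "x \<in> A"
  shows "\<tau> (r *\<^sub>R x) = r *\<^sub>R \<tau> x"
proof -
  have "scalar_op (complex_of_real r) o\<^sub>L x = r *\<^sub>R x" by (rule blinfun_eqI) (simp add: scaleC_of_real blinfun.scaleR_left)
  then show ?thesis using normalized_traceD(2)[OF assms, of "complex_of_real r"] by (simp add: scaleR_conv_of_real)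
qed

lemma trace_of_normalized: "normalized_trace A \<tau> \<Longrightarrow> normalized_trace A (trace_of A)"
  unfolding trace_of_def by (rule someI[of "normalized_trace A" \<tau>])

lemma II1_factorD:
  assumes "II1_factor A"
  shows "von_neumann_algebra A" "A \<inter> commutant A = range scalar_op" "normalized_trace A (trace_of A)"
proof -
  have "vN_factor A" "\<exists>\<tau>. normalized_trace A \<tau>" using assms unfolding II1_factor_def by blast+
  then show "von_neumann_algebra A" "A \<inter> commutant A = range scalar_op" "normalized_trace A (trace_of A)"
    unfolding vN_factor_def using trace_of_normalized by blast+
qed

section \<open>The basic construction\<close>

lemma blinfun_compose_id [simp]: "x o\<^sub>L id_blinfun = x" "id_blinfun o\<^sub>L x = x"
  by (rule blinfun_eqI, simp)+

text \<open>The last assumption is the form in which finite index enters: \<open>vN_dim\<close> is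
  infinite by definition when the commutant is not a II_1 factor. It supplies the trace from which
  that of M_1 is obtained.\<close>

locale finite_inclusion =
  fixes N M :: "('h::complex_hilbert \<Rightarrow>\<^sub>L 'h) set" and \<Omega> :: 'h
  assumes II1_N: "II1_factor N" and II1_M: "II1_factor M" and NM: "N \<subseteq> M"
    and L2: "acts_on_L2 M \<Omega>" and II1_N': "II1_factor (commutant N)"
begin

lemmas vN_N = II1_factorD(1)[OF II1_N] and vN_M = II1_factorD(1)[OF II1_M]
lemmas N_closed = von_neumann_intros[OF vN_N] and M_closed = von_neumann_intros[OF vN_M]
lemmas trM = normalized_traceD[OF II1_factorD(3)[OF II1_M]]

lemma cb: "x \<in> M \<Longrightarrow> x \<in> cbounded_ops" "x \<in> N \<Longrightarrow> x \<in> cbounded_ops" "x \<in> N \<Longrightarrow> x \<in> M"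
  using von_neumann_algebraD(1)[OF vN_M] NM by blast+

lemma bicommutant_N: "commutant (commutant N) = N"
  by (rule von_neumann_algebraD(3)[OF vN_N])

lemma N_cb: "N \<subseteq> cbounded_ops"
  by (rule von_neumann_algebraD(1)[OF vN_N])

lemma commutant_M_N: "x \<in> commutant M \<Longrightarrow> x \<in> commutant N"
  using commutant_anti[OF NM] by blast

lemma cinner_\<Omega>: "x \<in> M \<Longrightarrow> y \<in> M \<Longrightarrow> cinner (x \<Omega>) (y \<Omega>) = trace_of M (adj y o\<^sub>L x)"
  using L2 by (simp add: acts_on_L2_def)

lemma dense_\<Omega>: "closure ((\<lambda>x. blinfun_apply x \<Omega>) ` M) = UNIV"
  using L2 by (simp add: acts_on_L2_def)

text \<open>The trace property in terms of vectors. It makes the adjoint isometric on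
  \<open>M \<Omega>\<close>, which is the origin of J.\<close>

lemma cinner_adj_\<Omega>:
  assumes "x \<in> M" "y \<in> M"
  shows "cinner (adj x \<Omega>) (adj y \<Omega>) = cinner (y \<Omega>) (x \<Omega>)"
  using assms by (simp add: cinner_\<Omega> M_closed cb trM(6)[of y "adj x"])

lemma norm_adj_\<Omega>:
  assumes "x \<in> M"
  shows "norm (adj x \<Omega>) = norm (x \<Omega>)"
proof -
  have "complex_of_real ((norm (adj x \<Omega>))\<^sup>2) = complex_of_real ((norm (x \<Omega>))\<^sup>2)"
    unfolding cinner_self[symmetric] by (rule cinner_adj_\<Omega>[OF assms assms])
  then have "(norm (adj x \<Omega>))\<^sup>2 = (norm (x \<Omega>))\<^sup>2" by (simp only: of_real_eq_iff)
  then show ?thesis by simp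
qed

lemma norm_\<Omega>: "norm \<Omega> = 1"
proof -
  have "cinner \<Omega> \<Omega> = 1" using cinner_\<Omega>[of id_blinfun id_blinfun] M_closed(2) trM(3) by simp
  then have "(norm \<Omega>)\<^sup>2 = 1" unfolding cinner_self by (simp only: of_real_eq_1_iff)
  then have "norm \<Omega> = 1 \<or> norm \<Omega> = - 1" by (simp add: power2_eq_1_iff)
  then show ?thesis using norm_ge_zero[of \<Omega>] by linarith
qed

lemma cinner_comm_\<Omega>:
  assumes "x \<in> M" "y \<in> M"
  shows "cinner (x (y \<Omega>)) \<Omega> = cinner (y (x \<Omega>)) \<Omega>"
  using cinner_adj_\<Omega>[of "adj x" y] assms by (simp add: cinner_adj' cb M_closed flip: cinner_adj)

text \<open>Right multiplication by a unitary preserves the 2-norm: taking adjoints turns it into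
  left multiplication. All velocity estimates along curves depend on it.\<close>

lemma norm_mult_unitary_\<Omega>:
  assumes "y \<in> M" "u \<in> unitaries M"
  shows "norm (y (u \<Omega>)) = norm (y \<Omega>)"
proof -
  have u: "u \<in> M" by (rule unitariesD(1)[OF assms(2)])
  have "norm ((y o\<^sub>L u) \<Omega>) = norm (adj (y o\<^sub>L u) \<Omega>)"
    by (rule norm_adj_\<Omega>[symmetric]) (intro M_closed assms u)
  also have "adj (y o\<^sub>L u) \<Omega> = adj u (adj y \<Omega>)" by (simp add: adj_simps(1)[OF cb(1)[OF assms(1)] cb(1)[OF u]])
  also have "norm \<dots> = norm (adj y \<Omega>)"
    using unitary_norm(1)[OF unitaries_closed(2)[OF vN_M assms(2)]] von_neumann_algebraD(1)[OF vN_M] by blast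
  finally show ?thesis by (simp add: norm_adj_\<Omega> assms)
qed

text \<open>The modular conjugation; it is conjugate linear, but real linear maps are the ambient type.\<close>

lemma conjugation_exists: "\<exists>J :: 'h \<Rightarrow>\<^sub>L 'h. norm J \<le> 1 \<and> (\<forall>x\<in>M. blinfun_apply J (blinfun_apply x \<Omega>) = blinfun_apply (adj x) \<Omega>)"
proof -
  let ?R = "(\<lambda>x. (blinfun_apply x \<Omega>, blinfun_apply (adj x) \<Omega>)) ` M"
  have sub: "subspace ?R"
  proof (rule subspaceI)
    have "0 \<in> M" using M_closed(8)[OF M_closed(2), of 0] by simp
    moreover have "adj 0 = (0 :: 'h \<Rightarrow>\<^sub>L 'h)" by (rule adj_equality) (simp add: cinner.zero_left cinner.zero_right)
    ultimately show "0 \<in> ?R" by (intro image_eqI[of _ _ 0]) (simp_all add: zero_prod_def)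
    show "z + w \<in> ?R" if zw: "z \<in> ?R" "w \<in> ?R" for z w
    proof -
      obtain x y where "x \<in> M" "z = (x \<Omega>, adj x \<Omega>)" "y \<in> M" "w = (y \<Omega>, adj y \<Omega>)" using zw by blast
      then show ?thesis
        by (intro image_eqI[of _ _ "x + y"]) (simp_all add: blinfun.add_left adj_simps cb M_closed)
    qed
    show "r *\<^sub>R z \<in> ?R" if z: "z \<in> ?R" for r z
    proof -
      obtain x where "x \<in> M" "z = (x \<Omega>, adj x \<Omega>)" using z by blast
      then show ?thesis
        by (intro image_eqI[of _ _ "r *\<^sub>R x"]) (simp_all add: blinfun.scaleR_left adj_unary cb M_closed)
    qed
  qed
  have bound: "norm y \<le> 1 * norm x" if "(x, y) \<in> ?R" for x y using that by (auto simp: norm_adj_\<Omega>)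
  have dense: "closure (fst ` ?R) = UNIV" using dense_\<Omega> by (simp add: image_image)
  show ?thesis
  proof (rule bounded_extension[OF sub bound dense zero_le_one])
    fix F assume F: "norm F \<le> 1" "\<And>x y. (x, y) \<in> ?R \<Longrightarrow> blinfun_apply F x = y"
    have "blinfun_apply F (blinfun_apply x \<Omega>) = blinfun_apply (adj x) \<Omega>" if "x \<in> M" for x
      by (rule F(2)) (use that in blast)
    with F(1) show ?thesis by blast
  qed
qed

definition J :: "'h \<Rightarrow>\<^sub>L 'h" where
  "J = (SOME J. norm J \<le> 1 \<and> (\<forall>x\<in>M. blinfun_apply J (blinfun_apply x \<Omega>) = blinfun_apply (adj x) \<Omega>))"

lemma norm_J_le: "norm J \<le> 1" and J_\<Omega>: "x \<in> M \<Longrightarrow> J (x \<Omega>) = adj x \<Omega>"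
  using someI_ex[OF conjugation_exists, folded J_def] by blast+

lemma J_fix_\<Omega> [simp]: "J \<Omega> = \<Omega>"
  using J_\<Omega>[OF M_closed(2)] by simp

lemma J_J [simp]: "J (J x) = x"
proof -
  have "J o\<^sub>L J = id_blinfun"
    by (rule blinfun_eq_on_dense[OF dense_\<Omega>]) (auto simp: J_\<Omega> cb M_closed)
  from arg_cong[OF this, of "\<lambda>Z. blinfun_apply Z x"] show ?thesis by simp
qed

lemma J_scaleC: "J (c *\<^sub>C x) = cnj c *\<^sub>C J x"
proof -
  have "J o\<^sub>L scalar_op c = scalar_op (cnj c) o\<^sub>L J"
  proof (rule blinfun_eq_on_dense[OF dense_\<Omega>])
    fix z assume "z \<in> (\<lambda>x. blinfun_apply x \<Omega>) ` M"
    then obtain x where x: "x \<in> M" "z = x \<Omega>" by blast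
    have "J ((scalar_op c o\<^sub>L x) \<Omega>) = adj (scalar_op c o\<^sub>L x) \<Omega>"
      by (rule J_\<Omega>) (intro M_closed x)
    also have "\<dots> = cnj c *\<^sub>C adj x \<Omega>"
      by (simp add: adj_simps adj_scalar_op cb(1)[OF x(1)] cboundedD[OF adj_cbounded[OF cb(1)[OF x(1)]]])
    finally show "(J o\<^sub>L scalar_op c) z = (scalar_op (cnj c) o\<^sub>L J) z" by (simp add: x J_\<Omega>)
  qed
  from arg_cong[OF this, of "\<lambda>Z. blinfun_apply Z x"] show ?thesis by simp
qed

lemma norm_J: "norm (J x) = norm x"
proof -
  have le: "norm (J y) \<le> norm y" for y
    using order_trans[OF norm_blinfun[of J y] mult_right_mono[OF norm_J_le norm_ge_zero]] by simp
  show ?thesis using le[of x] le[of "J x"] by simp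
qed

lemma inner_J: "inner (J x) y = inner x (J y)"
proof -
  have "4 * inner a b = (norm (a + b))\<^sup>2 - (norm (a - b))\<^sup>2" for a b :: 'h
    unfolding power2_norm_eq_inner by (simp add: inner_simps inner_commute[of b a])
  from this[of "J x" y] this[of x "J y"] show ?thesis
    using norm_J[of "x + J y"] norm_J[of "x - J y"] by (simp add: blinfun.add_right blinfun.diff_right)
qed

lemma cinner_J: "cinner (J x) y = cinner (J y) x"
proof (rule complex_eqI)
  show "Re (cinner (J x) y) = Re (cinner (J y) x)"
    unfolding inner_eq_Re_cinner[symmetric] by (metis inner_J inner_commute)
  have "\<i> *\<^sub>C J x = - J (\<i> *\<^sub>C x)" by (simp add: J_scaleC scaleC.minus_left)
  then have "Im (cinner (J x) y) = inner (\<i> *\<^sub>C x) (J y)" by (simp add: Im_cinner inner_J)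
  also have "\<dots> = - Im (cinner x (J y))" by (simp add: Im_cinner)
  also have "\<dots> = Im (cinner (J y) x)" by (subst cinner_commute) simp
  finally show "Im (cinner (J x) y) = Im (cinner (J y) x)" .
qed

text \<open>On the dense set \<open>M \<Omega>\<close>, for x in M, this is right multiplication by
  \<open>adj x\<close>. The two conjugations cancel, so it is complex linear again.\<close>

definition jconj :: "('h \<Rightarrow>\<^sub>L 'h) \<Rightarrow> 'h \<Rightarrow>\<^sub>L 'h" where
  "jconj x = J o\<^sub>L x o\<^sub>L J"

lemma jconj_apply: "jconj x z = J (x (J z))"
  by (simp add: jconj_def)

lemma jconj_cbounded [intro]: "x \<in> cbounded_ops \<Longrightarrow> jconj x \<in> cbounded_ops"
  by (rule cboundedI) (simp add: jconj_apply J_scaleC cboundedD)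

lemma jconj_algebra:
  "jconj (x o\<^sub>L y) = jconj x o\<^sub>L jconj y" "jconj (x + y) = jconj x + jconj y" "jconj (jconj x) = x"
  by (rule blinfun_eqI, simp add: jconj_apply blinfun.add_left blinfun.add_right)+

lemma jconj_scalar_op: "jconj (scalar_op c) = scalar_op (cnj c)"
  by (rule blinfun_eqI) (simp add: jconj_apply J_scaleC)

lemma jconj_id [simp]: "jconj id_blinfun = id_blinfun"
  by (rule blinfun_eqI) (simp add: jconj_apply)

lemma adj_jconj: "x \<in> cbounded_ops \<Longrightarrow> adj (jconj x) = jconj (adj x)"
proof (rule adj_equality)
  fix a b assume x: "x \<in> cbounded_ops"
  have "cinner (J (x (J a))) b = cinner (J b) (x (J a))" by (rule cinner_J)
  also have "\<dots> = cinner (adj x (J b)) (J a)" by (rule cinner_adj'[OF x, symmetric])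
  also have "\<dots> = cnj (cinner (J a) (adj x (J b)))" by (rule cinner_commute)
  also have "\<dots> = cnj (cinner (J (adj x (J b))) a)" by (simp add: cinner_J[of _ a])
  also have "\<dots> = cinner a (J (adj x (J b)))" by (rule cinner_commute[symmetric])
  finally show "cinner (jconj x a) b = cinner a (jconj (adj x) b)" by (simp add: jconj_apply)
qed

lemma jconj_\<Omega>: "x \<in> M \<Longrightarrow> jconj x \<Omega> = adj x \<Omega>"
  by (simp add: jconj_apply J_\<Omega>)

text \<open>Right multiplications commute with left ones; this is the easy inclusion of J M J in the
  commutant of M.\<close>

lemma jconj_commutant:
  assumes x: "x \<in> M"
  shows "jconj x \<in> commutant M"
proof (rule commutantI)
  show "jconj x \<in> cbounded_ops" using x cb by blast
  have step: "jconj x (y \<Omega>) = y (adj x \<Omega>)" if y: "y \<in> M" for y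
  proof -
    have "J ((x o\<^sub>L adj y) \<Omega>) = adj (x o\<^sub>L adj y) \<Omega>" by (rule J_\<Omega>) (intro M_closed x y)
    then show ?thesis by (simp add: jconj_apply J_\<Omega> y adj_simps cb x M_closed)
  qed
  fix y z assume y: "y \<in> M"
  have "jconj x o\<^sub>L y = y o\<^sub>L jconj x"
  proof (rule blinfun_eq_on_dense[OF dense_\<Omega>])
    fix z assume "z \<in> (\<lambda>x. blinfun_apply x \<Omega>) ` M"
    then obtain a where a: "a \<in> M" "z = a \<Omega>" by blast
    have "jconj x ((y o\<^sub>L a) \<Omega>) = (y o\<^sub>L a) (adj x \<Omega>)" by (rule step) (intro M_closed y a)
    then show "(jconj x o\<^sub>L y) z = (y o\<^sub>L jconj x) z" by (simp add: a step)
  qed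
  then show "jconj x (y z) = y (jconj x z)" by (rule commutes_apply)
qed

text \<open>The vector \<open>x \<Omega>\<close> is also the value at \<open>\<Omega>\<close> of
  \<open>jconj (adj x)\<close>. Cyclicity for the commutants is what allows vectors to be turned
  back into operators of M or N.\<close>

lemma commutant_cyclic:
  "closure ((\<lambda>x. blinfun_apply x \<Omega>) ` commutant M) = UNIV" "closure ((\<lambda>x. blinfun_apply x \<Omega>) ` commutant N) = UNIV"
proof -
  have "x \<Omega> = jconj (adj x) \<Omega>" if "x \<in> M" for x using that by (simp add: jconj_\<Omega> M_closed cb)
  then have "(\<lambda>x. blinfun_apply x \<Omega>) ` M \<subseteq> (\<lambda>x. blinfun_apply x \<Omega>) ` commutant M"
    using jconj_commutant M_closed(1) by blast
  from closure_mono[OF this] show 1: "closure ((\<lambda>x. blinfun_apply x \<Omega>) ` commutant M) = UNIV" using dense_\<Omega> by auto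
  have "(\<lambda>x. blinfun_apply x \<Omega>) ` commutant M \<subseteq> (\<lambda>x. blinfun_apply x \<Omega>) ` commutant N"
    using commutant_anti[OF NM] by blast
  from closure_mono[OF this] show "closure ((\<lambda>x. blinfun_apply x \<Omega>) ` commutant N) = UNIV" using 1 by auto
qed

lemma separating: "x \<in> M \<Longrightarrow> y \<in> M \<Longrightarrow> x \<Omega> = y \<Omega> \<Longrightarrow> x = y"
proof (rule blinfun_eq_on_dense[OF commutant_cyclic(1)])
  fix z assume xy: "x \<in> M" "y \<in> M" "x \<Omega> = y \<Omega>" and "z \<in> (\<lambda>x. blinfun_apply x \<Omega>) ` commutant M"
  then obtain a where a: "a \<in> commutant M" "z = a \<Omega>" by blast
  show "x z = y z" using commutant_apply[OF a(1) xy(1), of \<Omega>] commutant_apply[OF a(1) xy(2), of \<Omega>] xy(3) a(2) by simp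
qed

section \<open>The Jones projection and the algebra it generates with M\<close>

abbreviation V where "V \<equiv> (\<lambda>x. blinfun_apply x \<Omega>) ` N"
abbreviation p where "p \<equiv> jones_projection N \<Omega>"
abbreviation M\<^sub>1 where "M\<^sub>1 \<equiv> basic_construction M N \<Omega>"
abbreviation \<tau>\<^sub>1 where "\<tau>\<^sub>1 \<equiv> trace_of M\<^sub>1"

lemma csubspace_V: "csubspace V"
  unfolding csubspace_def
proof (intro conjI subspaceI allI ballI)
  show "0 \<in> V" using N_closed(8)[OF N_closed(2), of 0] by (intro image_eqI[of _ _ 0]) simp_all
  fix x y assume "x \<in> V" "y \<in> V"
  then obtain a b where "a \<in> N" "x = a \<Omega>" "b \<in> N" "y = b \<Omega>" by blast
  then show "x + y \<in> V" by (intro image_eqI[of _ _ "a + b"]) (simp_all add: blinfun.add_left N_closed)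
next
  fix x and r :: real assume "x \<in> V"
  then obtain a where "a \<in> N" "x = a \<Omega>" by blast
  then show "r *\<^sub>R x \<in> V" by (intro image_eqI[of _ _ "r *\<^sub>R a"]) (simp_all add: blinfun.scaleR_left N_closed)
next
  fix x c assume "x \<in> V"
  then obtain a where "a \<in> N" "x = a \<Omega>" by blast
  then show "c *\<^sub>C x \<in> V" by (intro image_eqI[of _ _ "scalar_op c o\<^sub>L a"]) (simp_all add: N_closed)
qed

lemmas p = projection_onto[OF csubspace_V, folded jones_projection_def]
  and p_apply = projection_onto_apply[OF csubspace_V, folded jones_projection_def]

lemma p_N\<Omega>: "y \<in> N \<Longrightarrow> p (y \<Omega>) = y \<Omega>"
  using p_apply(4) closure_subset[of V] by blast

lemma p_\<Omega> [simp]: "p \<Omega> = \<Omega>"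
  using p_N\<Omega>[OF N_closed(2)] by simp

lemma p_commutes_N: "y \<in> N \<Longrightarrow> p (y x) = y (p x)"
  unfolding jones_projection_def
proof (rule projection_onto_commutes[OF csubspace_V])
  assume y: "y \<in> N"
  show "inner (y a) b = inner a (adj y b)" for a b by (rule inner_adj[OF cb(2)[OF y]])
  have inv: "z ` V \<subseteq> V" if z: "z \<in> N" for z
  proof
    fix v assume "v \<in> z ` V"
    then obtain a where "a \<in> N" "v = (z o\<^sub>L a) \<Omega>" by auto
    then show "v \<in> V" using N_closed(4)[OF z] by blast
  qed
  show "y ` V \<subseteq> V" "adj y ` V \<subseteq> V" using inv y N_closed(1) by blast+
qed

lemma p_commutant: "p \<in> commutant N"
  by (rule commutantI[OF p(1) p_commutes_N])

lemma p_J: "p (J x) = J (p x)"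
  unfolding jones_projection_def
proof (rule projection_onto_commutes[OF csubspace_V inner_J])
  show "J ` V \<subseteq> V"
  proof
    fix v assume "v \<in> J ` V"
    then obtain a where "a \<in> N" "v = J (a \<Omega>)" by blast
    then have "adj a \<in> N" "v = adj a \<Omega>" by (simp_all add: J_\<Omega> cb N_closed)
    then show "v \<in> V" by blast
  qed
  then show "J ` V \<subseteq> V" .
qed

lemma jconj_p: "jconj p = p"
  by (rule blinfun_eqI) (simp add: jconj_apply flip: p_J)

lemma M1_eq: "M\<^sub>1 = commutant (commutant (insert p M))"
proof -
  have "adj ` insert p M \<subseteq> insert p M" using M_closed(1) p(3) by auto
  then have "insert p M \<union> adj ` insert p M = insert p M" by blast
  then show ?thesis by (simp add: basic_construction_def generated_vN_def)
qed

lemma vN_M1: "von_neumann_algebra M\<^sub>1"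
proof -
  have S: "insert p M \<subseteq> cbounded_ops" "adj ` insert p M \<subseteq> insert p M" using M_closed(1) p cb by auto
  have "adj ` commutant (insert p M) \<subseteq> commutant (insert p M)" using commutant_adj[OF S] by blast
  then show ?thesis unfolding M1_eq by (intro von_neumann_commutant) (auto simp: commutant_cbounded)
qed

lemmas M1_closed = von_neumann_intros[OF vN_M1]

lemma in_M1: "p \<in> M\<^sub>1" "x \<in> M \<Longrightarrow> x \<in> M\<^sub>1"
proof -
  have "insert p M \<subseteq> cbounded_ops" using p(1) cb by auto
  from subset_bicommutant[OF this] show "p \<in> M\<^sub>1" "x \<in> M \<Longrightarrow> x \<in> M\<^sub>1" unfolding M1_eq by blast+
qed

lemma M1_cb: "x \<in> M\<^sub>1 \<Longrightarrow> x \<in> cbounded_ops"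
  using von_neumann_algebraD(1)[OF vN_M1] by blast

text \<open>It suffices to check the generators: M commutes with right multiplications, and p
  commutes with both N and J.\<close>

lemma M1_commutes_right:
  assumes x: "x \<in> M\<^sub>1" and y: "y \<in> N"
  shows "x (jconj y z) = jconj y (x z)"
proof -
  have "insert p M \<subseteq> commutant {jconj y}"
  proof
    fix a assume "a \<in> insert p M"
    then consider "a = p" | "a \<in> M" by blast
    then show "a \<in> commutant {jconj y}"
    proof cases
      case 1
      show ?thesis unfolding 1
        by (rule commutantI[OF p(1)]) (simp add: jconj_apply p_J p_commutes_N[OF y])
    next
      case 2
      show ?thesis
        by (rule commutantI[OF cb(1)[OF 2]]) (simp add: commutant_apply[OF jconj_commutant[OF cb(3)[OF y]] 2])
    qed
  qed
  then have "commutant (commutant (insert p M)) \<subseteq> commutant {jconj y}"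
    using y cb by (intro bicommutant_least) auto
  then have "x \<in> commutant {jconj y}" using x unfolding M1_eq by blast
  then show ?thesis by (rule commutant_apply) simp
qed

lemma jconj_M1: "x \<in> M\<^sub>1 \<Longrightarrow> jconj x \<in> commutant N"
proof (rule commutantI)
  assume x: "x \<in> M\<^sub>1"
  then show "jconj x \<in> cbounded_ops" using M1_cb by blast
  fix y z assume y: "y \<in> N"
  have "jconj x (y z) = J (x (jconj y (J z)))" by (simp add: jconj_apply)
  also have "\<dots> = y (jconj x z)" unfolding M1_commutes_right[OF x y] by (simp add: jconj_apply)
  finally show "jconj x (y z) = y (jconj x z)" .
qed

text \<open>Since J conjugates the basic construction into the commutant of N, the trace of the latter yields one of the former.\<close>

lemma trace_M1: "normalized_trace M\<^sub>1 \<tau>\<^sub>1"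
proof -
  let ?t = "trace_of (commutant N)"
  \<comment> \<open>Adjoint and conjugation by J are both conjugate linear, so the composite is
    linear; it reverses products, which a trace does not notice.\<close>
  let ?j = "\<lambda>x. jconj (adj x)"
  note t = normalized_traceD[OF II1_factorD(3)[OF II1_N']]
  have j: "?j x \<in> commutant N" if "x \<in> M\<^sub>1" for x by (rule jconj_M1) (intro M1_closed that)
  have jm: "?j (x o\<^sub>L y) = ?j y o\<^sub>L ?j x" if "x \<in> M\<^sub>1" "y \<in> M\<^sub>1" for x y
    by (simp only: adj_simps(1)[OF M1_cb[OF that(1)] M1_cb[OF that(2)]] jconj_algebra)
  have ja: "?j (adj x o\<^sub>L x) = adj (jconj x) o\<^sub>L jconj x" if "x \<in> M\<^sub>1" for x
    using that by (simp add: jm M1_closed M1_cb adj_jconj)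
  have "normalized_trace M\<^sub>1 (\<lambda>x. ?t (?j x))"
    unfolding normalized_trace_def
  proof (intro conjI ballI allI impI)
    fix x y assume xy: "x \<in> M\<^sub>1" "y \<in> M\<^sub>1"
    show "?t (?j (x + y)) = ?t (?j x) + ?t (?j y)"
      using t(1)[OF j[OF xy(1)] j[OF xy(2)]] by (simp add: adj_simps M1_cb xy jconj_algebra)
    show "?t (?j (x o\<^sub>L y)) = ?t (?j (y o\<^sub>L x))"
      unfolding jm[OF xy] jm[OF xy(2,1)] by (rule t(6)[OF j[OF xy(2)] j[OF xy(1)]])
  next
    fix c x assume x: "x \<in> M\<^sub>1"
    have "?j (scalar_op c o\<^sub>L x) = ?j x o\<^sub>L scalar_op c"
      unfolding jm[OF M1_closed(3)[of c] x] by (simp add: adj_scalar_op jconj_scalar_op)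
    also have "\<dots> = scalar_op c o\<^sub>L ?j x"
      using commutant_cbounded[OF j[OF x]] unfolding cbounded_iff_commutes by blast
    finally show "?t (?j (scalar_op c o\<^sub>L x)) = c * ?t (?j x)" by (simp only: t(2)[OF j[OF x]])
  next
    show "?t (?j id_blinfun) = 1" by (simp add: t(3))
    fix x assume x: "x \<in> M\<^sub>1"
    show "?t (?j (adj x o\<^sub>L x)) \<in> \<real>\<^sub>\<ge>\<^sub>0" unfolding ja[OF x] by (rule t(4)[OF jconj_M1[OF x]])
    assume "?t (?j (adj x o\<^sub>L x)) = 0"
    then have "jconj x = 0" unfolding ja[OF x] by (rule t(5)[OF jconj_M1[OF x]])
    then have "jconj (jconj x) = jconj 0" by simp
    then show "x = 0" unfolding jconj_algebra by (simp add: blinfun_eqI jconj_apply)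
  next
    from t(7) obtain \<xi> \<eta> :: "nat \<Rightarrow> 'h" where s: "summable (\<lambda>n. (norm (\<xi> n))\<^sup>2)" "summable (\<lambda>n. (norm (\<eta> n))\<^sup>2)"
      and sm: "\<And>x. x \<in> commutant N \<Longrightarrow> (\<lambda>n. cinner (x (\<xi> n)) (\<eta> n)) sums ?t x"
      unfolding ultraweakly_continuous_def by blast
    \<comment> \<open>The two vector sequences of the trace on the commutant exchange their roles
      under J, giving an ultraweak representation of the transported trace.\<close>
    have "cinner (x (J (\<eta> n))) (J (\<xi> n)) = cinner (?j x (\<xi> n)) (\<eta> n)" if "x \<in> M\<^sub>1" for x n
      using that by (simp add: jconj_apply cinner_J[of _ "\<eta> n"] cinner_adj M1_cb)
    then have "(\<lambda>n. cinner (x (J (\<eta> n))) (J (\<xi> n))) sums ?t (?j x)" if "x \<in> M\<^sub>1" for x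
      using sm[OF j[OF that]] that by simp
    then show "ultraweakly_continuous M\<^sub>1 (\<lambda>x. ?t (?j x))"
      unfolding ultraweakly_continuous_def using s
      by (intro exI[of _ "\<lambda>n. J (\<eta> n)"] exI[of _ "\<lambda>n. J (\<xi> n)"]) (simp add: norm_J)
  qed
  then show ?thesis by (rule trace_of_normalized)
qed

lemmas tr1 = normalized_traceD[OF trace_M1]

section \<open>Corners of the basic construction\<close>

text \<open>This is p N' p, where N' is the commutant of N: the commutant of N acting on L2(N),
  extended by 0 to the whole space.\<close>

definition corner :: "('h \<Rightarrow>\<^sub>L 'h) set" where
  "corner = {c \<in> commutant N. (\<forall>x. p (c x) = c x) \<and> (\<forall>x. c (p x) = c x)}"

lemma cornerD: "c \<in> corner \<Longrightarrow> c \<in> commutant N" "c \<in> corner \<Longrightarrow> p (c x) = c x" "c \<in> corner \<Longrightarrow> c (p x) = c x"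
  "c \<in> corner \<Longrightarrow> c \<in> cbounded_ops"
  by (auto simp: corner_def commutant_cbounded)

lemma corner_closed: "c \<in> corner \<Longrightarrow> d \<in> corner \<Longrightarrow> c o\<^sub>L d \<in> corner" "c \<in> corner \<Longrightarrow> adj c \<in> corner"
  "c \<in> commutant N \<Longrightarrow> p o\<^sub>L c o\<^sub>L p \<in> corner"
proof -
  show "c o\<^sub>L d \<in> corner" if "c \<in> corner" "d \<in> corner"
    using cornerD[OF that(1)] cornerD[OF that(2)] commutant_closed_ops(3) by (simp add: corner_def)
  show "p o\<^sub>L c o\<^sub>L p \<in> corner" if c: "c \<in> commutant N"
    using commutant_closed_ops(3)[OF commutant_closed_ops(3)[OF p_commutant c] p_commutant]
    by (simp add: corner_def p_apply(1))
  show "adj c \<in> corner" if c: "c \<in> corner"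
  proof -
    note cc = cornerD(4)[OF c]
    have 1: "p o\<^sub>L c = c" "c o\<^sub>L p = c" by (rule blinfun_eqI, simp add: cornerD[OF c])+
    have "adj c o\<^sub>L p = adj c" "p o\<^sub>L adj c = adj c"
      using arg_cong[OF 1(1), of adj] arg_cong[OF 1(2), of adj]
      unfolding adj_simps(1)[OF p(1) cc] adj_simps(1)[OF cc p(1)] p(3) by simp_all
    then have "\<And>x. adj c (p x) = adj c x" "\<And>x. p (adj c x) = adj c x" by (metis blinfun_apply_blinfun_compose)+
    moreover have "adj c \<in> commutant N"
      by (rule commutant_adj[OF N_cb _ cornerD(1)[OF c]]) (auto intro: N_closed)
    ultimately show ?thesis by (simp add: corner_def)
  qed
qed

lemma orthogonal_V_zero:
  assumes "p d = d" "\<And>y. y \<in> N \<Longrightarrow> cinner d (y \<Omega>) = 0"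
  shows "d = 0"
proof -
  have "closed {v. cinner d v = 0}" by (intro closed_Collect_eq continuous_intros cinner.continuous_on)
  then have "closure V \<subseteq> {v. cinner d v = 0}" using assms(2) by (intro closure_minimal) auto
  moreover have "d \<in> closure V" using assms(1) p_apply(4) by blast
  ultimately have "cinner d d = 0" by blast
  then show ?thesis by (simp add: cinner_self)
qed

text \<open>J acts on N' through L2(N) as it does on M. Both vectors lie in L2(N), so it is enough
  to test against \<open>y \<Omega>\<close> with y in N, and c commutes with such y.\<close>

lemma J_corner:
  assumes c: "c \<in> corner"
  shows "J (c \<Omega>) = adj c \<Omega>"
proof -
  have "J (c \<Omega>) - adj c \<Omega> = 0"
  proof (rule orthogonal_V_zero)
    show "p (J (c \<Omega>) - adj c \<Omega>) = J (c \<Omega>) - adj c \<Omega>"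
      by (simp add: blinfun.diff_right p_J cornerD(2)[OF c] cornerD(2)[OF corner_closed(2)[OF c]])
    fix y assume y: "y \<in> N"
    have "cinner (J (c \<Omega>)) (y \<Omega>) = cinner (adj y \<Omega>) (c \<Omega>)" by (simp add: cinner_J[of _ "y \<Omega>"] J_\<Omega> cb y)
    also have "\<dots> = cinner \<Omega> (y (c \<Omega>))" by (rule cinner_adj'[OF cb(2)[OF y]])
    also have "\<dots> = cinner (adj c \<Omega>) (y \<Omega>)"
      by (simp add: cinner_adj'[OF cornerD(4)[OF c]] commutant_apply[OF cornerD(1)[OF c] y])
    finally show "cinner (J (c \<Omega>) - adj c \<Omega>) (y \<Omega>) = 0" by (simp add: cinner.diff_left)
  qed
  then show ?thesis by simp
qed

lemma eq_on_V:
  assumes "\<And>y. y \<in> N \<Longrightarrow> blinfun_apply F (y \<Omega>) = blinfun_apply G (y \<Omega>)"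
  shows "F (p x) = G (p x)"
proof -
  have "closed {v. blinfun_apply F v = blinfun_apply G v}" by (intro closed_Collect_eq continuous_intros)
  then have "closure V \<subseteq> {v. blinfun_apply F v = blinfun_apply G v}" using assms by (intro closure_minimal) auto
  moreover have "p x \<in> closure V" using p_apply(4) p_apply(1) by blast
  ultimately show ?thesis by blast
qed

text \<open>As J acts as the adjoint on the vectors \<open>c \<Omega>\<close>, both sides map \<open>x \<Omega>\<close> to \<open>s x t* \<Omega>\<close>.\<close>

lemma corner_commutes:
  assumes s: "s \<in> corner" and t: "t \<in> corner"
  shows "jconj t (s z) = s (jconj t z)"
proof -
  have "(jconj t o\<^sub>L s) (p z) = (s o\<^sub>L jconj t) (p z)"
  proof (rule eq_on_V)
    fix y assume y: "y \<in> N"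
    \<comment> \<open>Right multiplication by y, compressed to L2(N): an element of the corner with
      the same value at \<open>\<Omega>\<close> as y. So \<open>J_corner\<close> applies to products
      of corner elements evaluated at \<open>\<Omega>\<close>.\<close>
    define x where "x = p o\<^sub>L jconj (adj y) o\<^sub>L p"
    have ay: "adj y \<in> M" by (intro M_closed cb(3)[OF y])
    have x: "x \<in> corner" unfolding x_def by (rule corner_closed(3)[OF commutant_M_N[OF jconj_commutant[OF ay]]])
    have x\<Omega>: "x \<Omega> = y \<Omega>" by (simp add: x_def jconj_\<Omega>[OF ay] cb(2)[OF y] p_N\<Omega>[OF y])
    note cbs = cornerD(4)[OF s] cornerD(4)[OF t] cornerD(4)[OF x]
    have sx: "s o\<^sub>L x \<in> corner" and txs: "t o\<^sub>L (adj x o\<^sub>L adj s) \<in> corner" and tx: "t o\<^sub>L adj x \<in> corner"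
      by (intro corner_closed s x t)+
    have "J (t (J (s (x \<Omega>)))) = J (t (adj x (adj s \<Omega>)))"
      using J_corner[OF sx] by (simp add: adj_simps(1)[OF cbs(1) cbs(3)])
    also have "\<dots> = s (x (adj t \<Omega>))"
      using J_corner[OF txs] by (simp add: adj_simps cbs adj_cbounded)
    also have "\<dots> = s (J (t (J (x \<Omega>))))"
      using J_corner[OF tx] J_corner[OF x] by (simp add: adj_simps cbs adj_cbounded)
    finally show "(jconj t o\<^sub>L s) (y \<Omega>) = (s o\<^sub>L jconj t) (y \<Omega>)" by (simp add: jconj_apply x\<Omega>)
  qed
  then show ?thesis
    by (simp add: jconj_apply cornerD(3)[OF s]) (simp add: cornerD(3)[OF t] flip: p_J)
qed

text \<open>The vector \<open>jconj t \<Omega>\<close> is bounded with respect to N': for x in N',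
  compressing \<open>adj x o\<^sub>L x\<close> by p gives a positive c in the corner, which commutes
  with \<open>jconj t\<close>, and \<open>commuting_positive_le\<close> bounds the norm. Hence the
  vector comes from an operator in the bicommutant of N.\<close>

lemma corner_conditional_expectation:
  assumes t: "t \<in> corner"
  obtains a where "a \<in> N" "a \<Omega> = jconj t \<Omega>" "norm a \<le> norm (jconj t)"
proof -
  let ?T = "jconj t"
  have pT: "p (?T x) = ?T x" for x by (simp add: jconj_apply p_J cornerD(2)[OF t])
  have "norm (x (?T \<Omega>)) \<le> norm ?T * norm (x \<Omega>)" if x: "x \<in> commutant N" for x
  proof -
    note xc = commutant_cbounded[OF x]
    have ax: "adj x \<in> commutant N" by (rule commutant_adj[OF N_cb _ x]) (auto intro: N_closed)
    define c where "c = p o\<^sub>L (adj x o\<^sub>L x) o\<^sub>L p"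
    have c: "c \<in> corner" unfolding c_def by (rule corner_closed(3)[OF commutant_closed_ops(3)[OF ax x]])
    have ic: "inner (c a) b = inner (x (p a)) (x (p b))" for a b
      by (simp add: c_def p_apply(2) inner_adj[OF adj_cbounded[OF xc]] xc)
    have pos: "positive_op c"
      unfolding positive_op_def selfadjoint_def using ic by (simp add: inner_commute)
    have comm: "?T o\<^sub>L c = c o\<^sub>L ?T" by (rule commutesI, rule corner_commutes[OF c t])
    have "inner (c (?T \<Omega>)) (?T \<Omega>) \<le> (norm ?T)\<^sup>2 * inner (c \<Omega>) \<Omega>"
      by (rule commuting_positive_le[OF cornerD(4)[OF c] pos comm])
    then have "(norm (x (?T \<Omega>)))\<^sup>2 \<le> (norm ?T * norm (x \<Omega>))\<^sup>2"
      unfolding ic by (simp add: pT power2_norm_eq_inner power_mult_distrib)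
    then show ?thesis by (rule power2_le_imp_le) simp
  qed
  then obtain a where "a \<in> commutant (commutant N)" "a \<Omega> = ?T \<Omega>" "norm a \<le> norm ?T"
    by (rule left_bounded_operator[OF N_cb commutant_cyclic(2) norm_ge_zero]) blast
  then show thesis using that by (simp add: bicommutant_N)
qed

text \<open>The J-conjugate of p S p lies in the corner, which yields a with the right value at
  \<open>\<Omega>\<close>. Both p S p and a commute with right multiplication by N, so they agree on
  all of L2(N). On M the element a is the conditional expectation.\<close>

lemma compression_in_N:
  assumes S: "S \<in> M\<^sub>1"
  obtains a where "a \<in> N" "a \<Omega> = p (S \<Omega>)" "norm a \<le> norm (p o\<^sub>L S o\<^sub>L p)" "p o\<^sub>L S o\<^sub>L p = a o\<^sub>L p"
proof -
  let ?T = "p o\<^sub>L S o\<^sub>L p"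
  have T: "?T \<in> M\<^sub>1" by (intro M1_closed in_M1 S)
  have jT: "jconj ?T = p o\<^sub>L jconj S o\<^sub>L p" by (simp only: jconj_algebra jconj_p)
  have "jconj ?T \<in> corner" unfolding jT by (rule corner_closed(3)[OF jconj_M1[OF S]])
  then obtain a where a: "a \<in> N" "a \<Omega> = jconj (jconj ?T) \<Omega>" "norm a \<le> norm (jconj (jconj ?T))"
    by (rule corner_conditional_expectation)
  have "?T (p x) = a (p x)" for x
  proof (rule eq_on_V)
    fix y assume y: "y \<in> N"
    have ay: "adj y \<in> N" by (intro N_closed y)
    have y\<Omega>: "y \<Omega> = jconj (adj y) \<Omega>" using ay y by (simp add: jconj_\<Omega> cb)
    have "?T (y \<Omega>) = jconj (adj y) (?T \<Omega>)" unfolding y\<Omega> by (rule M1_commutes_right[OF T ay])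
    also have "?T \<Omega> = a \<Omega>" using a(2) unfolding jconj_algebra by simp
    also have "jconj (adj y) (a \<Omega>) = a (jconj (adj y) \<Omega>)"
      by (rule commutant_apply[OF jconj_commutant[OF cb(3)[OF ay]] cb(3)[OF a(1)]])
    finally show "?T (y \<Omega>) = a (y \<Omega>)" by (simp only: y\<Omega>)
  qed
  then have "?T x = (a o\<^sub>L p) x" for x by (simp add: p_apply(1))
  then have eq: "?T = a o\<^sub>L p" by (rule blinfun_eqI)
  have "a \<Omega> = p (S \<Omega>)" "norm a \<le> norm ?T" using a(2,3) unfolding jconj_algebra(3) by simp_all
  then show thesis using that[OF a(1)] eq by blast
qed

section \<open>The trace of the basic construction on compressions\<close>

lemma trace_scaleR: "x \<in> M\<^sub>1 \<Longrightarrow> \<tau>\<^sub>1 (r *\<^sub>R x) = r *\<^sub>R \<tau>\<^sub>1 x"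
  by (rule normalized_trace_scaleR[OF trace_M1])

lemma trace_diff: "x \<in> M\<^sub>1 \<Longrightarrow> y \<in> M\<^sub>1 \<Longrightarrow> \<tau>\<^sub>1 (x - y) = \<tau>\<^sub>1 x - \<tau>\<^sub>1 y"
  using tr1(1)[of "x - y" y] by (simp add: M1_closed)

lemma unitary_N_M: "u \<in> unitaries N \<Longrightarrow> u \<in> unitaries M"
  using NM by (auto simp: unitaries_def)

text \<open>Averaging over the unitary group of N: the element of minimal 2-norm in the closed convex hull of the unitary
  conjugates of a is central, hence a scalar.\<close>

lemma trace_N_p:
  assumes a: "a \<in> N"
  shows "\<tau>\<^sub>1 (a o\<^sub>L p) = cinner (a \<Omega>) \<Omega> * \<tau>\<^sub>1 p"
proof -
  define U where "U = (\<lambda>u. u o\<^sub>L a o\<^sub>L adj u) ` unitaries N"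
  define B where "B = convex hull U"
  \<comment> \<open>These constraints are convex and hold for all unitary conjugates of a: the trace
    condition since p commutes with N, the vector state since it is tracial on M. Averaging thus
    preserves both sides of the claim.\<close>
  define G where "G = {x \<in> N. norm x \<le> norm a \<and> \<tau>\<^sub>1 (x o\<^sub>L p) = \<tau>\<^sub>1 (a o\<^sub>L p) \<and> cinner (blinfun_apply x \<Omega>) \<Omega> = cinner (a \<Omega>) \<Omega>}"
  have "convex G"
  proof (rule convexI)
    fix x y and r s :: real
    assume "x \<in> G" "y \<in> G" and rs: "0 \<le> r" "0 \<le> s" "r + s = 1"
    then have x: "x \<in> N" "norm x \<le> norm a" "\<tau>\<^sub>1 (x o\<^sub>L p) = \<tau>\<^sub>1 (a o\<^sub>L p)" "cinner (x \<Omega>) \<Omega> = cinner (a \<Omega>) \<Omega>"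
      and y: "y \<in> N" "norm y \<le> norm a" "\<tau>\<^sub>1 (y o\<^sub>L p) = \<tau>\<^sub>1 (a o\<^sub>L p)" "cinner (y \<Omega>) \<Omega> = cinner (a \<Omega>) \<Omega>"
      by (simp_all add: G_def)
    have "norm (r *\<^sub>R x + s *\<^sub>R y) \<le> r * norm a + s * norm a"
      using rs x(2) y(2) by (intro order_trans[OF norm_triangle_ineq] add_mono) (simp_all add: mult_left_mono)
    moreover have "(r *\<^sub>R x + s *\<^sub>R y) o\<^sub>L p = r *\<^sub>R (x o\<^sub>L p) + s *\<^sub>R (y o\<^sub>L p)"
      by (rule blinfun_eqI) (simp add: blinfun.bilinear_simps)
    moreover have "x o\<^sub>L p \<in> M\<^sub>1" "y o\<^sub>L p \<in> M\<^sub>1" by (intro M1_closed in_M1 cb(3) x y)+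
    moreover have "r *\<^sub>R z + s *\<^sub>R z = z" for z :: complex using rs(3) by (simp flip: scaleR_left_distrib)
    moreover have "r * norm a + s * norm a = norm a" using rs(3) by (simp flip: distrib_right)
    ultimately show "r *\<^sub>R x + s *\<^sub>R y \<in> G"
      using x y by (simp add: G_def N_closed tr1(1) trace_scaleR M1_closed blinfun.bilinear_simps
          cinner.add_left cinner.scaleR_left)
  qed
  moreover have "U \<subseteq> G"
  proof
    fix x assume "x \<in> U"
    then obtain u where u: "u \<in> unitaries N" and x: "x = u o\<^sub>L a o\<^sub>L adj u" by (auto simp: U_def)
    note uN = unitariesD(1)[OF u]
    have "norm x \<le> norm u * norm a * norm (adj u)"
      unfolding x by (rule order_trans[OF norm_blinfun_compose]) (simp add: mult_right_mono norm_blinfun_compose)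
    also have "\<dots> \<le> 1 * norm a * 1"
      using unitary_norm(2)[OF u N_cb] unitary_norm(2)[OF unitaries_closed(2)[OF vN_N u] N_cb]
      by (intro mult_mono) simp_all
    finally have "norm x \<le> norm a" by simp
    moreover have "\<tau>\<^sub>1 (x o\<^sub>L p) = \<tau>\<^sub>1 (a o\<^sub>L p)"
    proof -
      have "x o\<^sub>L p = u o\<^sub>L (a o\<^sub>L adj u o\<^sub>L p)" by (rule blinfun_eqI) (simp add: x)
      also have "\<tau>\<^sub>1 \<dots> = \<tau>\<^sub>1 ((a o\<^sub>L adj u o\<^sub>L p) o\<^sub>L u)"
        by (rule tr1(6)) (intro M1_closed in_M1 cb(3) uN a)+
      also have "(a o\<^sub>L adj u o\<^sub>L p) o\<^sub>L u = a o\<^sub>L p"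
        by (rule blinfun_eqI) (simp add: p_commutes_N[OF uN] unitariesD[OF u])
      finally show ?thesis .
    qed
    moreover have "cinner (x \<Omega>) \<Omega> = cinner (a \<Omega>) \<Omega>"
    proof -
      have "a o\<^sub>L adj u \<in> M" by (intro M_closed cb(3) uN a)
      from cinner_comm_\<Omega>[OF cb(3)[OF uN] this] show ?thesis by (simp add: x unitariesD[OF u])
    qed
    ultimately show "x \<in> G" unfolding G_def x using N_closed uN a by simp
  qed
  ultimately have BG: "B \<subseteq> G" unfolding B_def by (intro hull_minimal)
  have aB: "a \<in> B"
    unfolding B_def by (rule hull_inc) (use unitaries_closed(1)[OF vN_N] in \<open>force simp: U_def intro: image_eqI[of _ _ id_blinfun]\<close>)
  let ?E = "\<lambda>x. blinfun_apply x \<Omega>"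
  define K where "K = closure (?E ` B)"
  have linE: "linear ?E" by (rule bounded_linear.linear, rule blinfun.bounded_linear_left)
  have cvx: "convex K"
    unfolding K_def B_def by (intro convex_closure convex_linear_image[OF linE] convex_convex_hull)
  obtain \<xi> where \<xi>: "\<xi> \<in> K" "\<And>y. y \<in> K \<Longrightarrow> norm \<xi> \<le> norm y"
  proof (rule closed_convex_min_norm[OF _ cvx])
    show "closed K" by (simp add: K_def)
    show "K \<noteq> {}" using aB closure_subset[of "?E ` B"] by (auto simp: K_def)
  qed blast
  from \<xi>(1) obtain g where g: "\<forall>n. g n \<in> ?E ` B" "g \<longlonglongrightarrow> \<xi>" unfolding K_def closure_sequential by blast
  then have "\<forall>n. \<exists>x. x \<in> B \<and> g n = x \<Omega>" by blast
  then obtain b where b: "\<And>n. b n \<in> B" "\<And>n. g n = b n \<Omega>" by metis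
  have bG: "b n \<in> N" "norm (b n) \<le> norm a" "\<tau>\<^sub>1 (b n o\<^sub>L p) = \<tau>\<^sub>1 (a o\<^sub>L p)" "cinner (b n \<Omega>) \<Omega> = cinner (a \<Omega>) \<Omega>" for n
    using b(1)[of n] BG by (auto simp: G_def)
  have lim: "(\<lambda>n. b n \<Omega>) \<longlonglongrightarrow> \<xi>" using g(2) unfolding b(2) .
  have bN: "b n \<in> commutant (commutant N)" for n using bG(1) by (simp add: bicommutant_N)
  obtain c0 where c0': "c0 \<in> commutant (commutant N)" and c0: "c0 \<Omega> = \<xi>" "norm c0 \<le> norm a" "\<And>x. (\<lambda>n. b n x) \<longlonglongrightarrow> c0 x"
    by (rule bounded_orbit_limit[OF N_cb commutant_cyclic(2) bN bG(2) lim]) blast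
  then have c0N: "c0 \<in> N" by (simp add: bicommutant_N)
  have inv: "c0 o\<^sub>L v = v o\<^sub>L c0" if v: "v \<in> unitaries N" for v
  proof -
    note vN = unitariesD(1)[OF v]
    \<comment> \<open>On vectors, conjugation by v is left multiplication by v followed by right
      multiplication by its adjoint.\<close>
    let ?W = "v o\<^sub>L jconj v" and ?f = "\<lambda>x. v o\<^sub>L x o\<^sub>L adj v"
    have Wf: "?W (x \<Omega>) = (?f x) \<Omega>" if "x \<in> N" for x
      using commutant_apply[OF jconj_commutant[OF cb(3)[OF vN]] cb(3)[OF that]]
      by (simp add: jconj_\<Omega>[OF cb(3)[OF vN]])
    have linf: "linear ?f" by (rule linearI; rule blinfun_eqI; simp add: blinfun.bilinear_simps)
    have "?f ` U \<subseteq> U"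
    proof
      fix y assume "y \<in> ?f ` U"
      then obtain u where u: "u \<in> unitaries N" "y = v o\<^sub>L (u o\<^sub>L a o\<^sub>L adj u) o\<^sub>L adj v" by (auto simp: U_def)
      have "y = (v o\<^sub>L u) o\<^sub>L a o\<^sub>L adj (v o\<^sub>L u)"
        by (rule blinfun_eqI) (simp add: u(2) adj_simps(1)[OF cb(2)[OF vN] cb(2)[OF unitariesD(1)[OF u(1)]]])
      then show "y \<in> U" using unitaries_closed(3)[OF vN_N v u(1)] by (auto simp: U_def)
    qed
    then have fB: "?f ` B \<subseteq> B" unfolding B_def convex_hull_linear_image[OF linf] by (rule hull_mono)
    have "?W ` K \<subseteq> K"
      unfolding K_def
    proof (rule image_closure_subset)
      show "continuous_on (closure (?E ` B)) (blinfun_apply ?W)"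
        by (rule linear_continuous_on, rule blinfun.bounded_linear_right)
      show "?W ` ?E ` B \<subseteq> closure (?E ` B)"
      proof
        fix y assume "y \<in> ?W ` ?E ` B"
        then obtain x where x: "x \<in> B" "y = ?W (x \<Omega>)" by (elim imageE) simp
        have "x \<in> N" using x(1) BG by (auto simp: G_def)
        then have "y = ?E (?f x)" unfolding x(2) by (rule Wf)
        moreover have "?f x \<in> B" by (rule subsetD[OF fB imageI[OF x(1)]])
        ultimately have "y \<in> ?E ` B" by (rule image_eqI)
        then show "y \<in> closure (?E ` B)" by (rule subsetD[OF closure_subset])
      qed
    qed simp
    then have "?W \<xi> \<in> K" using \<xi>(1) by blast
    moreover have nW: "norm (?W \<xi>) = norm \<xi>"
      by (simp add: unitary_norm(1)[OF v N_cb] jconj_apply norm_J)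
    \<comment> \<open>W is isometric and preserves K, so it must fix the unique vector of least
      norm; separation by \<open>\<Omega>\<close> lifts this to c0.\<close>
    ultimately have "?W \<xi> = \<xi>" using \<xi> by (intro min_norm_unique[OF cvx]) simp_all
    then have "(?f c0) \<Omega> = c0 \<Omega>" using Wf[OF c0N] c0(1) by simp
    moreover have "?f c0 \<in> M" "c0 \<in> M" by (intro M_closed cb(3) vN c0N)+
    ultimately have "?f c0 = c0" by (intro separating)
    then have "c0 (v x) = (?f c0) (v x)" for x by simp
    then show ?thesis by (intro commutesI) (simp add: unitariesD(2)[OF v])
  qed
  have "c0 \<in> commutant N" by (rule commutes_with_unitaries[OF vN_N cb(2)[OF c0N] inv])
  with c0N have "c0 \<in> range scalar_op" using II1_factorD(2)[OF II1_N] by blast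
  then obtain c where c: "c0 = scalar_op c" by blast
  have "(\<lambda>n. cinner (b n \<Omega>) \<Omega>) \<longlonglongrightarrow> cinner (c0 \<Omega>) \<Omega>" unfolding c0(1) by (intro cinner.tendsto lim tendsto_const)
  then have "cinner (a \<Omega>) \<Omega> = cinner (c0 \<Omega>) \<Omega>" unfolding bG(4) by (simp add: LIMSEQ_const_iff)
  then have c_eq: "cinner (a \<Omega>) \<Omega> = c" by (simp add: c cinner_scaleC_left cinner_self norm_\<Omega>)
  have "(\<lambda>n. \<tau>\<^sub>1 (b n o\<^sub>L p)) \<longlonglongrightarrow> \<tau>\<^sub>1 (c0 o\<^sub>L p)"
  proof (rule ultraweakly_continuous_tendsto[OF tr1(7)])
    show "b n o\<^sub>L p \<in> M\<^sub>1" "c0 o\<^sub>L p \<in> M\<^sub>1" for n by (intro M1_closed in_M1 cb(3) bG(1) c0N)+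
    show "norm (b n o\<^sub>L p) \<le> norm a * norm p" for n
      by (rule order_trans[OF norm_blinfun_compose]) (simp add: bG(2) mult_right_mono)
    show "(\<lambda>n. (b n o\<^sub>L p) x) \<longlonglongrightarrow> (c0 o\<^sub>L p) x" for x using c0(3) by simp
  qed
  then have "\<tau>\<^sub>1 (a o\<^sub>L p) = \<tau>\<^sub>1 (c0 o\<^sub>L p)" unfolding bG(3) by (simp add: LIMSEQ_const_iff)
  then show ?thesis by (simp add: c c_eq tr1(2)[OF in_M1(1)])
qed

lemma trace_compression:
  assumes S: "S \<in> M\<^sub>1"
  shows "\<tau>\<^sub>1 (p o\<^sub>L S o\<^sub>L p) = cinner (S \<Omega>) \<Omega> * \<tau>\<^sub>1 p"
proof -
  obtain a where a: "a \<in> N" "a \<Omega> = p (S \<Omega>)" "norm a \<le> norm (p o\<^sub>L S o\<^sub>L p)" "p o\<^sub>L S o\<^sub>L p = a o\<^sub>L p"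
    by (rule compression_in_N[OF S])
  have "cinner (a \<Omega>) \<Omega> = cinner (S \<Omega>) \<Omega>" by (simp add: a(2) p_apply(3))
  then show ?thesis unfolding a(4) trace_N_p[OF a(1)] by simp
qed

text \<open>In Jones' theory this is the reciprocal of the index.\<close>

definition lam :: real where "lam = Re (\<tau>\<^sub>1 p)"

lemma lam: "0 < lam" "\<tau>\<^sub>1 p = complex_of_real lam"
proof -
  have pp: "adj p o\<^sub>L p = p" using p(2,3) by simp
  have "\<tau>\<^sub>1 p \<in> \<real>\<^sub>\<ge>\<^sub>0" using tr1(4)[OF in_M1(1)] unfolding pp .
  then have r: "0 \<le> lam" "\<tau>\<^sub>1 p = complex_of_real lam"
    by (auto simp: lam_def complex_nonneg_Reals_iff complex_eq_iff)
  then show "\<tau>\<^sub>1 p = complex_of_real lam" by blast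
  have "p \<noteq> 0" using p_\<Omega> norm_\<Omega> by force
  then have "\<tau>\<^sub>1 p \<noteq> 0" using tr1(5)[OF in_M1(1)] unfolding pp by blast
  with r show "0 < lam" by auto
qed

text \<open>The squared distance from \<open>w \<Omega>\<close> to \<open>z \<Omega>\<close> is 2 -
  2 f w. If every w were too far away, f would stay below K - d / 2 on unitaries of N, hence on
  strict contractions, whereas the conditional expectation a of z satisfies f a = K.\<close>

lemma near_unitary:
  assumes z: "z \<in> unitaries M" and \<delta>: "0 < \<delta>"
  obtains w where "w \<in> unitaries N" "(norm (z \<Omega> - w \<Omega>))\<^sup>2 \<le> 2 * (1 - (norm (p (z \<Omega>)))\<^sup>2) + \<delta>"
proof (rule ccontr)
  assume no: "\<not> thesis"
  note witness = that
  note zM = unitariesD(1)[OF z]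
  have M_cb: "M \<subseteq> cbounded_ops" using cb by blast
  let ?K = "(norm (p (z \<Omega>)))\<^sup>2"
  define f where "f = (\<lambda>x. inner (z \<Omega>) (blinfun_apply x \<Omega>))"
  \<comment> \<open>The cap at 1 keeps r = 1 - d / 4 positive. Scaling a by r makes it a strict
    contraction and costs at most d / 4, since K is at most 1, which is less than the gap d /
    2.\<close>
  define d where "d = min \<delta> 1"
  have d: "0 < d" "d \<le> 1" "d \<le> \<delta>" using \<delta> by (auto simp: d_def)
  have n1: "norm (u \<Omega>) = 1" if "u \<in> unitaries M" for u using unitary_norm(1)[OF that M_cb] norm_\<Omega> by simp
  have le: "f w \<le> ?K - d / 2" if w: "w \<in> unitaries N" for w
  proof -
    have "\<not> (norm (z \<Omega> - w \<Omega>))\<^sup>2 \<le> 2 * (1 - ?K) + \<delta>" using witness[OF w] no by blast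
    then have "2 * (1 - ?K) + d < (norm (z \<Omega> - w \<Omega>))\<^sup>2" using d(3) by simp
    also have "\<dots> = 2 - 2 * f w"
      using n1[OF z] n1[OF unitary_N_M[OF w]]
      by (simp add: f_def power2_norm_eq_inner inner_diff_left inner_diff_right inner_commute norm_eq_1)
    finally show ?thesis by simp
  qed
  obtain a where a: "a \<in> N" "a \<Omega> = p (z \<Omega>)" "norm a \<le> norm (p o\<^sub>L z o\<^sub>L p)"
    by (rule compression_in_N[OF in_M1(2)[OF zM]])
  have np: "norm (p x) \<le> norm x" for x
  proof -
    have "norm (p x) * norm (p x) = inner (p x) x"
      by (metis dot_square_norm p_apply(1,2) power2_eq_square)
    also have "\<dots> \<le> norm (p x) * norm x" by (rule norm_cauchy_schwarz)
    finally show ?thesis by (cases "norm (p x) = 0") simp_all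
  qed
  have "norm (p o\<^sub>L z o\<^sub>L p) \<le> 1"
  proof (rule norm_blinfun_bound)
    show "norm ((p o\<^sub>L z o\<^sub>L p) x) \<le> 1 * norm x" for x
      using np[of "z (p x)"] np[of x] unitary_norm(1)[OF z M_cb, of "p x"] by simp
  qed simp
  then have na: "norm a \<le> 1" using a(3) by simp
  define r where "r = 1 - d / 4"
  have r: "0 < r" "r < 1" using d by (auto simp: r_def)
  have "f (r *\<^sub>R a) \<le> ?K - d / 2"
  proof (rule additive_le_sup_unitaries[OF vN_N _ le])
    show "f (x + y) = f x + f y" for x y by (simp add: f_def blinfun.add_left inner_add_right)
    show "r *\<^sub>R a \<in> N" by (intro N_closed a)
    have "r * norm a \<le> r" using mult_left_mono[OF na, of r] r by simp
    moreover have "norm (r *\<^sub>R a) = r * norm a" using r by simp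
    ultimately show "norm (r *\<^sub>R a) < 1" using r by linarith
  qed
  moreover have "f a = ?K"
  proof -
    have "inner (z \<Omega>) (p (z \<Omega>)) = inner (p (z \<Omega>)) (p (z \<Omega>))" by (simp add: p_apply(1,2))
    then show ?thesis by (simp add: f_def a(2) power2_norm_eq_inner)
  qed
  ultimately have "r * ?K \<le> ?K - d / 2" by (simp add: f_def blinfun.scaleR_left)
  then have "d / 2 \<le> d / 4 * ?K" by (simp add: r_def algebra_simps)
  moreover have "?K \<le> 1" using np[of "z \<Omega>"] n1[OF z] power_le_one[of "norm (p (z \<Omega>))" 2] by simp
  then have "d / 4 * ?K \<le> d / 4 * 1" using d by (intro mult_left_mono) simp_all
  ultimately show False using d by simp
qed

section \<open>The 2-norm\<close>

abbreviation nrm where "nrm \<equiv> norm2 M\<^sub>1"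

definition ip :: "('h \<Rightarrow>\<^sub>L 'h) \<Rightarrow> ('h \<Rightarrow>\<^sub>L 'h) \<Rightarrow> real" where
  "ip x y = Re (\<tau>\<^sub>1 (adj x o\<^sub>L y))"

lemma ip_simps:
  assumes "x \<in> M\<^sub>1" "y \<in> M\<^sub>1" "z \<in> M\<^sub>1"
  shows "ip (x + y) z = ip x z + ip y z" "ip z (x + y) = ip z x + ip z y"
    "ip (x - y) z = ip x z - ip y z" "ip z (x - y) = ip z x - ip z y"
    "ip (r *\<^sub>R x) z = r * ip x z" "ip z (r *\<^sub>R x) = r * ip z x"
proof -
  have m: "adj x o\<^sub>L z \<in> M\<^sub>1" "adj y o\<^sub>L z \<in> M\<^sub>1" "adj z o\<^sub>L x \<in> M\<^sub>1" "adj z o\<^sub>L y \<in> M\<^sub>1" by (intro M1_closed assms)+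
  have e: "adj (x + y) o\<^sub>L z = (adj x o\<^sub>L z) + (adj y o\<^sub>L z)" "adj z o\<^sub>L (x + y) = (adj z o\<^sub>L x) + (adj z o\<^sub>L y)"
    "adj (x - y) o\<^sub>L z = (adj x o\<^sub>L z) - (adj y o\<^sub>L z)" "adj z o\<^sub>L (x - y) = (adj z o\<^sub>L x) - (adj z o\<^sub>L y)"
    "adj (r *\<^sub>R x) o\<^sub>L z = r *\<^sub>R (adj x o\<^sub>L z)" "adj z o\<^sub>L (r *\<^sub>R x) = r *\<^sub>R (adj z o\<^sub>L x)"
    by (rule blinfun_eqI, simp add: adj_simps adj_unary M1_cb assms blinfun.bilinear_simps)+
  show "ip (x + y) z = ip x z + ip y z" "ip z (x + y) = ip z x + ip z y"
    "ip (x - y) z = ip x z - ip y z" "ip z (x - y) = ip z x - ip z y"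
    "ip (r *\<^sub>R x) z = r * ip x z" "ip z (r *\<^sub>R x) = r * ip z x"
    unfolding ip_def e by (simp_all add: tr1(1) trace_diff trace_scaleR m)
qed

lemma ip_nonneg: "x \<in> M\<^sub>1 \<Longrightarrow> 0 \<le> ip x x"
  using tr1(4)[of x] by (simp add: ip_def complex_nonneg_Reals_iff)

lemma ip_eq_0: "x \<in> M\<^sub>1 \<Longrightarrow> ip x x = 0 \<Longrightarrow> x = 0"
  using tr1(4)[of x] tr1(5)[of x] by (simp add: ip_def complex_nonneg_Reals_iff complex_eq_iff)

lemma nrm_square: "x \<in> M\<^sub>1 \<Longrightarrow> (nrm x)\<^sup>2 = ip x x"
  using ip_nonneg[of x] by (simp add: norm2_def ip_def)

lemma nrm_nonneg: "x \<in> M\<^sub>1 \<Longrightarrow> 0 \<le> nrm x"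
  using ip_nonneg[of x] by (simp add: norm2_def ip_def)

lemma nrm_eq_0: "x \<in> M\<^sub>1 \<Longrightarrow> nrm x = 0 \<Longrightarrow> x = 0"
  using nrm_square[of x] ip_eq_0[of x] by simp

lemma nrm_scaleR: "x \<in> M\<^sub>1 \<Longrightarrow> nrm (r *\<^sub>R x) = \<bar>r\<bar> * nrm x"
proof -
  assume x: "x \<in> M\<^sub>1"
  have rx: "r *\<^sub>R x \<in> M\<^sub>1" by (intro M1_closed x)
  have "(nrm (r *\<^sub>R x))\<^sup>2 = (\<bar>r\<bar> * nrm x)\<^sup>2"
    unfolding nrm_square[OF rx] power_mult_distrib nrm_square[OF x] power2_abs
    by (simp add: ip_simps(5)[OF x x rx] ip_simps(6)[OF x x x] power2_eq_square)
  then show ?thesis using nrm_nonneg[OF rx] nrm_nonneg[OF x] by (simp add: power2_eq_iff_nonneg)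
qed

text \<open>Hermitian symmetry of the trace is extracted from positivity: the trace of the absolute
  square of x + i y is real, and its imaginary part is the real part of the trace of
  \<open>(adj x o\<^sub>L y) - (adj y o\<^sub>L x)\<close>.\<close>

lemma ip_real_sym: "x \<in> M\<^sub>1 \<Longrightarrow> y \<in> M\<^sub>1 \<Longrightarrow> ip x y = ip y x"
proof -
  assume xy: "x \<in> M\<^sub>1" "y \<in> M\<^sub>1"
  let ?s = "scalar_op \<i> o\<^sub>L y"
  have s: "?s \<in> M\<^sub>1" and iy: "adj ?s o\<^sub>L ?s = adj y o\<^sub>L y" and xi: "x + ?s \<in> M\<^sub>1"
      and aux: "adj (x + ?s) o\<^sub>L (x + ?s) = ((adj x o\<^sub>L x) + (adj y o\<^sub>L y)) + (scalar_op \<i> o\<^sub>L ((adj x o\<^sub>L y) - (adj y o\<^sub>L x)))"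
    using xy by (auto intro!: M1_closed blinfun_eqI simp: adj_simps adj_scalar_op M1_cb scaleC_scaleC
        cboundedD[OF M1_cb] M1_closed blinfun.bilinear_simps scaleC.diff_right scaleC.minus_left cboundedD[OF adj_cbounded[OF M1_cb]])
  have m: "adj x o\<^sub>L x \<in> M\<^sub>1" "adj y o\<^sub>L y \<in> M\<^sub>1" "adj x o\<^sub>L y \<in> M\<^sub>1" "adj y o\<^sub>L x \<in> M\<^sub>1" by (intro M1_closed xy)+
  have "Im (\<tau>\<^sub>1 (adj (x + ?s) o\<^sub>L (x + ?s))) = 0" "Im (\<tau>\<^sub>1 (adj x o\<^sub>L x)) = 0" "Im (\<tau>\<^sub>1 (adj y o\<^sub>L y)) = 0"
    using tr1(4) xi xy by (auto simp: complex_nonneg_Reals_iff)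
  then have "Re (\<tau>\<^sub>1 ((adj x o\<^sub>L y) - (adj y o\<^sub>L x))) = 0"
    unfolding aux by (simp add: tr1(1,2) m M1_closed)
  then show ?thesis by (simp add: ip_def trace_diff m)
qed

lemma ip_le: "x \<in> M\<^sub>1 \<Longrightarrow> y \<in> M\<^sub>1 \<Longrightarrow> ip x y \<le> nrm x * nrm y"
proof (cases "ip y y = 0")
  case True
  assume xy: "x \<in> M\<^sub>1" "y \<in> M\<^sub>1"
  with True have "y = 0" using ip_eq_0 by blast
  then have "ip x y = 0" using ip_simps(6)[of y x x 0] xy by simp
  then show ?thesis by (simp add: nrm_nonneg xy)
next
  case False
  assume xy: "x \<in> M\<^sub>1" "y \<in> M\<^sub>1"
  with False have pos: "0 < ip y y" using ip_nonneg[of y] by simp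
  let ?t = "ip x y / ip y y"
  have ty: "?t *\<^sub>R y \<in> M\<^sub>1" by (intro M1_closed xy)
  have xty: "x - ?t *\<^sub>R y \<in> M\<^sub>1" by (intro M1_closed xy)
  have "0 \<le> ip (x - ?t *\<^sub>R y) (x - ?t *\<^sub>R y)" by (rule ip_nonneg[OF xty])
  also have "\<dots> = ip x x - 2 * ?t * ip x y + ?t * (?t * ip y y)"
    unfolding ip_simps(3)[OF xy(1) ty xty] ip_simps(4)[OF xy(1) ty xy(1)] ip_simps(4)[OF xy(1) ty ty]
      ip_simps(5)[OF xy(2) xy(2) xy(1)] ip_simps(6)[OF xy(2) xy(2) xy(1)] ip_simps(6)[OF xy(2) xy(2) ty] ip_simps(5)[OF xy(2) xy(2) xy(2)]
      ip_real_sym[OF xy(2,1)] by (simp add: algebra_simps)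
  also have "?t * (?t * ip y y) = ?t * ip x y" using pos by simp
  finally have "ip x y * ip x y \<le> ip x x * ip y y" using pos by (simp add: field_simps)
  then have "(ip x y)\<^sup>2 \<le> (nrm x * nrm y)\<^sup>2"
    by (simp add: power_mult_distrib nrm_square xy power2_eq_square[of "ip x y"])
  then show ?thesis by (rule power2_le_imp_le) (simp add: nrm_nonneg xy)
qed

lemma nrm_triangle: "x \<in> M\<^sub>1 \<Longrightarrow> y \<in> M\<^sub>1 \<Longrightarrow> nrm (x + y) \<le> nrm x + nrm y"
proof (rule power2_le_imp_le)
  assume xy: "x \<in> M\<^sub>1" "y \<in> M\<^sub>1"
  have s: "x + y \<in> M\<^sub>1" by (intro M1_closed xy)
  have "(nrm (x + y))\<^sup>2 = ip x x + 2 * ip x y + ip y y"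
    unfolding nrm_square[OF s] ip_simps(1)[OF xy s] ip_simps(2)[OF xy xy(1)] ip_simps(2)[OF xy xy(2)] ip_real_sym[OF xy(2,1)] by simp
  also have "\<dots> \<le> (nrm x + nrm y)\<^sup>2"
    using ip_le[OF xy] by (simp add: power2_sum nrm_square xy)
  finally show "(nrm (x + y))\<^sup>2 \<le> (nrm x + nrm y)\<^sup>2" .
  show "0 \<le> nrm x + nrm y" by (simp add: nrm_nonneg xy)
qed

lemma nrm_adj: "x \<in> M\<^sub>1 \<Longrightarrow> nrm (adj x) = nrm x"
  by (simp add: norm2_def M1_cb M1_closed tr1(6)[of x "adj x"])

text \<open>The 2-norm is continuous for the operator norm because an ultraweakly continuous trace
  is bounded; continuity of the speed on smooth arcs follows.\<close>

lemma nrm_le_norm: obtains C where "0 \<le> C" "\<And>x. x \<in> M\<^sub>1 \<Longrightarrow> nrm x \<le> C * norm x"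
proof -
  obtain F where F: "bounded_linear F" "\<And>x. x \<in> M\<^sub>1 \<Longrightarrow> F x = \<tau>\<^sub>1 x" by (rule ultraweakly_continuous_extends[OF tr1(7)]) blast
  obtain K where K: "0 \<le> K" "\<forall>x. cmod (F x) \<le> norm x * K" using bounded_linear.nonneg_bounded[OF F(1)] by blast
  show thesis
  proof (rule that[of "sqrt K"])
    fix x assume x: "x \<in> M\<^sub>1"
    have "(nrm x)\<^sup>2 \<le> cmod (\<tau>\<^sub>1 (adj x o\<^sub>L x))" unfolding nrm_square[OF x] ip_def by (rule complex_Re_le_cmod)
    also have "\<dots> = cmod (F (adj x o\<^sub>L x))" by (subst F(2)) (intro M1_closed x refl)+
    also have "\<dots> \<le> K * norm (adj x o\<^sub>L x)" using K(2) by (simp add: mult.commute)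
    also have "norm (adj x o\<^sub>L x) \<le> norm x * norm x"
      by (rule order_trans[OF norm_blinfun_compose]) (simp add: norm_adj_le[OF M1_cb[OF x]] mult_right_mono)
    then have "K * norm (adj x o\<^sub>L x) \<le> (sqrt K * norm x)\<^sup>2"
      using K(1) by (simp add: power_mult_distrib power2_eq_square[of "norm x"] mult_left_mono)
    finally show "nrm x \<le> sqrt K * norm x" by (rule power2_le_imp_le) (simp add: K(1))
  qed (simp add: K(1))
qed

lemma continuous_on_nrm:
  assumes "continuous_on S f" "f ` S \<subseteq> M\<^sub>1"
  shows "continuous_on S (\<lambda>t. nrm (f t))"
proof -
  obtain C where C: "0 \<le> C" "\<And>x. x \<in> M\<^sub>1 \<Longrightarrow> nrm x \<le> C * norm x" by (rule nrm_le_norm) blast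
  have le: "nrm x - nrm y \<le> C * norm (x - y)" if "x \<in> M\<^sub>1" "y \<in> M\<^sub>1" for x y
    using nrm_triangle[of "x - y" y] C(2)[of "x - y"] that by (simp add: M1_closed)
  have "C-lipschitz_on M\<^sub>1 nrm"
  proof (rule lipschitz_onI[OF _ C(1)])
    fix x y assume "x \<in> M\<^sub>1" "y \<in> M\<^sub>1"
    with le[of x y] le[of y x] show "dist (nrm x) (nrm y) \<le> C * dist x y"
      by (simp add: dist_norm norm_minus_commute abs_le_iff)
  qed
  then have "continuous_on M\<^sub>1 nrm" by (rule lipschitz_on_continuous_on)
  from continuous_on_compose2[OF this assms] show ?thesis .
qed

section \<open>Distances in the orbit\<close>

abbreviation Op where "Op \<equiv> unitary_orbit M p"

definition conj_p :: "('h \<Rightarrow>\<^sub>L 'h) \<Rightarrow> 'h \<Rightarrow>\<^sub>L 'h" where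
  "conj_p u = u o\<^sub>L p o\<^sub>L adj u"

lemma Op_eq: "Op = conj_p ` unitaries M"
  by (auto simp: unitary_orbit_def conj_p_def)

lemma conj_p_M1: "u \<in> unitaries M \<Longrightarrow> conj_p u \<in> M\<^sub>1"
  unfolding conj_p_def by (intro M1_closed in_M1 unitariesD(1)[of u M])

lemma Op_M1: "Op \<subseteq> M\<^sub>1"
  using conj_p_M1 by (auto simp: Op_eq)

lemma conj_p_mult:
  assumes "u \<in> M" "v \<in> M"
  shows "conj_p (u o\<^sub>L v) = u o\<^sub>L conj_p v o\<^sub>L adj u"
  by (rule blinfun_eqI) (simp add: conj_p_def adj_simps(1)[OF cb(1)[OF assms(1)] cb(1)[OF assms(2)]])

lemma conj_p_mult_N:
  assumes "u \<in> unitaries M" "w \<in> unitaries N"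
  shows "conj_p (u o\<^sub>L w) = conj_p u"
  using assms unitariesD[OF assms(2)] unitariesD(1)[OF assms(1)]
  by (intro blinfun_eqI) (simp add: conj_p_mult cb, simp add: conj_p_def p_commutes_N N_closed)

lemma conj_p_selfadjoint: "u \<in> M \<Longrightarrow> adj (conj_p u) = conj_p u"
  by (rule blinfun_eqI) (simp add: conj_p_def adj_simps(1) cb(1) p(1,3) adj_cbounded)

text \<open>Cyclicity moves the outer unitary away and leaves the compression of an absolute square,
  whose trace is lam times the squared norm of \<open>y (u \<Omega>)\<close>; the unitary u does not
  change that norm. It converts speeds in the orbit into norms in L2(M).\<close>

lemma nrm_mult_conj_p:
  assumes y: "y \<in> M" and u: "u \<in> unitaries M"
  shows "nrm (y o\<^sub>L conj_p u) = sqrt lam * norm (y \<Omega>)"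
proof -
  note uM = unitariesD(1)[OF u]
  let ?q = "conj_p u" and ?S = "adj (y o\<^sub>L u) o\<^sub>L (y o\<^sub>L u)"
  have yu: "y o\<^sub>L u \<in> M" by (intro M_closed y uM)
  have m: "y o\<^sub>L ?q \<in> M\<^sub>1" "?S \<in> M\<^sub>1" "u \<in> M\<^sub>1" "p o\<^sub>L ?S o\<^sub>L p o\<^sub>L adj u \<in> M\<^sub>1"
    by (intro M1_closed in_M1 conj_p_M1 y u uM)+
  have e: "adj (y o\<^sub>L ?q) o\<^sub>L (y o\<^sub>L ?q) = u o\<^sub>L (p o\<^sub>L ?S o\<^sub>L p o\<^sub>L adj u)"
    by (rule blinfun_eqI) (simp add: adj_simps(1) cb y uM M1_cb conj_p_M1[OF u] conj_p_selfadjoint adj_cbounded,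
      simp add: conj_p_def)
  have "\<tau>\<^sub>1 (adj (y o\<^sub>L ?q) o\<^sub>L (y o\<^sub>L ?q)) = \<tau>\<^sub>1 ((p o\<^sub>L ?S o\<^sub>L p o\<^sub>L adj u) o\<^sub>L u)"
    unfolding e by (rule tr1(6)[OF m(3,4)])
  also have "(p o\<^sub>L ?S o\<^sub>L p o\<^sub>L adj u) o\<^sub>L u = p o\<^sub>L ?S o\<^sub>L p"
    by (rule blinfun_eqI) (simp add: unitariesD[OF u])
  also have "\<tau>\<^sub>1 (p o\<^sub>L ?S o\<^sub>L p) = cinner (?S \<Omega>) \<Omega> * \<tau>\<^sub>1 p" by (rule trace_compression[OF m(2)])
  also have "cinner (?S \<Omega>) \<Omega> = cinner ((y o\<^sub>L u) \<Omega>) ((y o\<^sub>L u) \<Omega>)"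
    using cinner_adj'[OF cb(1)[OF yu], of "(y o\<^sub>L u) \<Omega>" \<Omega>] by simp
  also have "\<dots> = complex_of_real ((norm (y \<Omega>))\<^sup>2)"
    unfolding cinner_self by (simp add: norm_mult_unitary_\<Omega>[OF y u])
  finally have "(nrm (y o\<^sub>L ?q))\<^sup>2 = (norm (y \<Omega>))\<^sup>2 * lam"
    unfolding nrm_square[OF m(1)] ip_def by (simp add: lam(2))
  also have "\<dots> = (sqrt lam * norm (y \<Omega>))\<^sup>2" using lam(1) by (simp add: power_mult_distrib)
  finally show ?thesis using nrm_nonneg[OF m(1)] lam(1) by (simp add: power2_eq_iff_nonneg)
qed

text \<open>With z = \<open>adj v o\<^sub>L u\<close>, cyclicity reduces the mixed term to the
  compression of \<open>z o\<^sub>L p o\<^sub>L adj z\<close>, where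
  \<open>trace_compression\<close> applies.\<close>

lemma nrm_conj_p_diff:
  assumes u: "u \<in> unitaries M" and v: "v \<in> unitaries M"
  shows "(nrm (conj_p u - conj_p v))\<^sup>2 = 2 * lam * (1 - (norm (p (adj v (u \<Omega>))))\<^sup>2)"
proof -
  note uM = unitariesD(1)[OF u] and vM = unitariesD(1)[OF v]
  let ?q = "conj_p u" and ?r = "conj_p v"
  define z where "z = adj v o\<^sub>L u"
  have zM: "z \<in> M" unfolding z_def by (intro M_closed uM vM)
  have az: "adj z = adj u o\<^sub>L v" by (simp add: z_def adj_simps(1) cb uM vM adj_cbounded)
  have m: "?q \<in> M\<^sub>1" "?r \<in> M\<^sub>1" "?q - ?r \<in> M\<^sub>1" "?q o\<^sub>L ?r \<in> M\<^sub>1" "?r o\<^sub>L ?q \<in> M\<^sub>1"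
    by (intro M1_closed conj_p_M1 u v)+
  have idem: "conj_p w o\<^sub>L conj_p w = conj_p w" if "w \<in> unitaries M" for w
    by (rule blinfun_eqI) (simp add: conj_p_def unitariesD[OF that] p_apply(1))
  have tq: "\<tau>\<^sub>1 (conj_p w) = \<tau>\<^sub>1 p" if w: "w \<in> unitaries M" for w
  proof -
    have "conj_p w = w o\<^sub>L (p o\<^sub>L adj w)" by (rule blinfun_eqI) (simp add: conj_p_def)
    also have "\<tau>\<^sub>1 \<dots> = \<tau>\<^sub>1 ((p o\<^sub>L adj w) o\<^sub>L w)"
      by (rule tr1(6)) (intro M1_closed in_M1 unitariesD(1)[OF w])+
    also have "(p o\<^sub>L adj w) o\<^sub>L w = p" by (rule blinfun_eqI) (simp add: unitariesD[OF w])
    finally show ?thesis .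
  qed
  have "\<tau>\<^sub>1 (?r o\<^sub>L ?q) = complex_of_real ((norm (p (z \<Omega>)))\<^sup>2) * \<tau>\<^sub>1 p"
  proof -
    let ?X = "z o\<^sub>L p o\<^sub>L adj z"
    have X: "?X \<in> M\<^sub>1" by (intro M1_closed in_M1 zM)
    have "?r o\<^sub>L ?q = (v o\<^sub>L p) o\<^sub>L (z o\<^sub>L p o\<^sub>L adj u)" by (rule blinfun_eqI) (simp add: conj_p_def z_def)
    also have "\<tau>\<^sub>1 \<dots> = \<tau>\<^sub>1 ((z o\<^sub>L p o\<^sub>L adj u) o\<^sub>L (v o\<^sub>L p))"
      by (rule tr1(6)) (intro M1_closed in_M1 uM vM zM)+
    also have "(z o\<^sub>L p o\<^sub>L adj u) o\<^sub>L (v o\<^sub>L p) = (?X o\<^sub>L p) o\<^sub>L p"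
      by (rule blinfun_eqI) (simp add: az p_apply(1))
    also have "\<tau>\<^sub>1 \<dots> = \<tau>\<^sub>1 (p o\<^sub>L (?X o\<^sub>L p))" by (rule tr1(6)) (intro M1_closed in_M1 X)+
    also have "p o\<^sub>L (?X o\<^sub>L p) = p o\<^sub>L ?X o\<^sub>L p" by (rule blinfun_eqI) simp
    also have "\<tau>\<^sub>1 \<dots> = cinner (?X \<Omega>) \<Omega> * \<tau>\<^sub>1 p" by (rule trace_compression[OF X])
    also have "cinner (?X \<Omega>) \<Omega> = cinner (p (adj z \<Omega>)) (p (adj z \<Omega>))"
      using cinner_adj[OF cb(1)[OF zM], of "p (adj z \<Omega>)" \<Omega>] by (simp add: p_apply(1,3))
    also have "\<dots> = complex_of_real ((norm (p (adj z \<Omega>)))\<^sup>2)" by (rule cinner_self)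
    \<comment> \<open>J is isometric, commutes with p and exchanges z with its adjoint at
      \<open>\<Omega>\<close>.\<close>
    also have "norm (p (adj z \<Omega>)) = norm (p (z \<Omega>))"
      unfolding J_\<Omega>[OF zM, symmetric] p_J norm_J ..
    finally show ?thesis .
  qed
  moreover have "\<tau>\<^sub>1 (?q o\<^sub>L ?r) = \<tau>\<^sub>1 (?r o\<^sub>L ?q)" by (rule tr1(6)[OF m(1,2)])
  moreover have "adj (?q - ?r) o\<^sub>L (?q - ?r) = (?q + ?r) - ((?q o\<^sub>L ?r) + (?r o\<^sub>L ?q))"
  proof -
    have "?q (?q x) = ?q x" "?r (?r x) = ?r x" for x
      using arg_cong[OF idem[OF u], of "\<lambda>Z. blinfun_apply Z x"] arg_cong[OF idem[OF v], of "\<lambda>Z. blinfun_apply Z x"] by simp_all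
    then show ?thesis
      by (intro blinfun_eqI) (simp add: adj_simps M1_cb m conj_p_selfadjoint uM vM blinfun.bilinear_simps algebra_simps)
  qed
  ultimately have "ip (?q - ?r) (?q - ?r) = 2 * lam - 2 * ((norm (p (z \<Omega>)))\<^sup>2 * lam)"
    by (simp add: ip_def trace_diff tr1(1) m M1_closed tq u v lam(2))
  then show ?thesis unfolding nrm_square[OF m(3)] by (simp add: z_def algebra_simps)
qed

text \<open>Replacing v by v w with w unitary in N leaves the orbit point unchanged, so w is taken
  close to \<open>adj v o\<^sub>L u\<close>. The slack is inherited from
  \<open>near_unitary\<close>, which compares with a supremum.\<close>

lemma lift_orbit_point:
  assumes u: "u \<in> unitaries M" and v: "v \<in> unitaries M" and \<delta>: "0 < \<delta>"
  obtains v' where "v' \<in> unitaries M" "conj_p v' = conj_p v"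
    "(norm (u \<Omega> - v' \<Omega>))\<^sup>2 \<le> (nrm (conj_p u - conj_p v))\<^sup>2 / lam + \<delta>"
proof -
  let ?z = "adj v o\<^sub>L u"
  have z: "?z \<in> unitaries M" by (intro unitaries_closed[OF vN_M] u v)
  obtain w where w: "w \<in> unitaries N" "(norm (?z \<Omega> - w \<Omega>))\<^sup>2 \<le> 2 * (1 - (norm (p (?z \<Omega>)))\<^sup>2) + \<delta>"
    by (rule near_unitary[OF z \<delta>])
  have vw: "v o\<^sub>L w \<in> unitaries M" by (intro unitaries_closed(3)[OF vN_M] v unitary_N_M w(1))
  have M_cb: "M \<subseteq> cbounded_ops" using cb by blast
  have "norm (?z \<Omega> - w \<Omega>) = norm (v (?z \<Omega> - w \<Omega>))" by (simp add: unitary_norm(1)[OF v M_cb])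
  also have "v (?z \<Omega> - w \<Omega>) = u \<Omega> - (v o\<^sub>L w) \<Omega>" by (simp add: blinfun.diff_right unitariesD[OF v])
  finally have "(norm (u \<Omega> - (v o\<^sub>L w) \<Omega>))\<^sup>2 \<le> (nrm (conj_p u - conj_p v))\<^sup>2 / lam + \<delta>"
    using w(2) lam(1) unfolding nrm_conj_p_diff[OF u v] by simp
  then show thesis using that[OF vw conj_p_mult_N[OF v w(1)]] by blast
qed

end

section \<open>Smooth curves\<close>

lemma has_vector_derivative_quotient:
  "(f has_vector_derivative D) (at x within S) \<longleftrightarrow> ((\<lambda>y. (1 / (y - x)) *\<^sub>R (f y - f x)) \<longlongrightarrow> D) (at x within S)"
proof -
  have e: "norm ((1 / norm (y - x)) *\<^sub>R (f y - (f x + (y - x) *\<^sub>R D))) = norm ((1 / (y - x)) *\<^sub>R (f y - f x) - D)"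
    if "y \<noteq> x" for y
  proof -
    have "(1 / (y - x)) *\<^sub>R (f y - f x) - D = (1 / (y - x)) *\<^sub>R (f y - (f x + (y - x) *\<^sub>R D))"
      using that by (simp add: scaleR_diff_right scaleR_add_right)
    then show ?thesis by simp
  qed
  have "((\<lambda>y. (1 / norm (y - x)) *\<^sub>R (f y - (f x + (y - x) *\<^sub>R D))) \<longlongrightarrow> 0) (at x within S)
      \<longleftrightarrow> ((\<lambda>y. norm ((1 / norm (y - x)) *\<^sub>R (f y - (f x + (y - x) *\<^sub>R D)))) \<longlongrightarrow> 0) (at x within S)"
    by (rule tendsto_norm_zero_iff[symmetric])
  also have "\<dots> \<longleftrightarrow> ((\<lambda>y. norm ((1 / (y - x)) *\<^sub>R (f y - f x) - D)) \<longlongrightarrow> 0) (at x within S)"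
    by (rule filterlim_cong[OF refl refl]) (use e in \<open>auto simp: eventually_at_filter\<close>)
  also have "\<dots> \<longleftrightarrow> ((\<lambda>y. (1 / (y - x)) *\<^sub>R (f y - f x)) \<longlongrightarrow> D) (at x within S)"
    unfolding tendsto_norm_zero_iff by (rule LIM_zero_iff)
  finally show ?thesis
    unfolding has_vector_derivative_def has_derivative_within by (simp add: bounded_linear_scaleR_left)
qed

lemma has_vector_derivative_in_closed_subspace:
  assumes "(f has_vector_derivative D) (at x within S)" "f ` S \<subseteq> V" "x \<in> S" "at x within S \<noteq> bot" "closed V" "subspace V"
  shows "D \<in> V"
proof (rule Lim_in_closed_set[OF \<open>closed V\<close> _ \<open>at x within S \<noteq> bot\<close>])
  show "((\<lambda>y. (1 / (y - x)) *\<^sub>R (f y - f x)) \<longlongrightarrow> D) (at x within S)"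
    using assms(1) by (simp only: has_vector_derivative_quotient)
  have "(1 / (y - x)) *\<^sub>R (f y - f x) \<in> V" if "y \<in> S" for y
    using that assms by (intro subspace_scale subspace_diff) auto
  then show "\<forall>\<^sub>F y in at x within S. (1 / (y - x)) *\<^sub>R (f y - f x) \<in> V" by (simp add: eventually_at_filter)
qed

text \<open>A class of functions closed under differentiation consists of smooth functions: choose a
  derivative inside the class and iterate.\<close>

lemma smooth_arcI:
  assumes f: "f \<in> \<F>"
    and D: "\<And>g. g \<in> \<F> \<Longrightarrow> \<exists>g'\<in>\<F>. \<forall>t\<in>{a..b}. (g has_vector_derivative g' t) (at t within {a..b})"
  shows "smooth_arc f a b"
proof -
  from D obtain d where d: "\<And>g. g \<in> \<F> \<Longrightarrow> d g \<in> \<F>"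
    "\<And>g t. g \<in> \<F> \<Longrightarrow> t \<in> {a..b} \<Longrightarrow> (g has_vector_derivative d g t) (at t within {a..b})" by metis
  have "(d ^^ k) f \<in> \<F>" for k by (induction k) (simp_all add: f d(1))
  then show ?thesis unfolding smooth_arc_def by (intro exI[of _ "\<lambda>k. (d ^^ k) f"]) (simp add: d(2))
qed

lemma smooth_arc_cong: "smooth_arc f a b \<Longrightarrow> (\<And>t. t \<in> {a..b} \<Longrightarrow> g t = f t) \<Longrightarrow> smooth_arc g a b"
  unfolding smooth_arc_def by metis

lemma smooth_arc_affine:
  assumes "smooth_arc \<gamma> c e" and im: "\<And>t. t \<in> {a..b} \<Longrightarrow> m * t + q \<in> {c..e}"
  shows "smooth_arc (\<lambda>t. \<gamma> (m * t + q)) a b"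
proof -
  obtain D where D: "\<And>t. t \<in> {c..e} \<Longrightarrow> D 0 t = \<gamma> t"
    "\<And>k t. t \<in> {c..e} \<Longrightarrow> (D k has_vector_derivative D (Suc k) t) (at t within {c..e})"
    using assms(1) unfolding smooth_arc_def by blast
  have "((\<lambda>t. m ^ k *\<^sub>R D k (m * t + q)) has_vector_derivative m ^ Suc k *\<^sub>R D (Suc k) (m * t + q)) (at t within {a..b})"
    if t: "t \<in> {a..b}" for k t
  proof -
    have 1: "((\<lambda>t. m * t + q) has_vector_derivative m) (at t within {a..b})"
      by (auto intro!: derivative_eq_intros simp: has_real_derivative_iff_has_vector_derivative[symmetric])
    have "(D k has_vector_derivative D (Suc k) (m * t + q)) (at (m * t + q) within (\<lambda>t. m * t + q) ` {a..b})"
      by (rule has_vector_derivative_within_subset[OF D(2)[OF im[OF t]]]) (use im in blast)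
    from vector_diff_chain_within[OF 1 this]
    have "((\<lambda>t. D k (m * t + q)) has_vector_derivative m *\<^sub>R D (Suc k) (m * t + q)) (at t within {a..b})" by (simp add: o_def)
    from bounded_linear.has_vector_derivative[OF bounded_linear_scaleR_right[of "m ^ k"] this]
    show ?thesis by (simp add: mult.commute)
  qed
  then show ?thesis
    unfolding smooth_arc_def using D(1) im by (intro exI[of _ "\<lambda>k t. m ^ k *\<^sub>R D k (m * t + q)"]) simp
qed

lemma smooth_arc_continuous: "smooth_arc \<gamma> a b \<Longrightarrow> continuous_on {a..b} \<gamma>"
proof -
  assume "smooth_arc \<gamma> a b"
  then obtain D where D: "\<forall>t\<in>{a..b}. D 0 t = \<gamma> t"
    "\<forall>k. \<forall>t\<in>{a..b}. (D k has_vector_derivative D (Suc k) t) (at t within {a..b})"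
    unfolding smooth_arc_def by blast
  have "continuous_on {a..b} (D 0)"
    unfolding continuous_on_eq_continuous_within using D(2) has_vector_derivative_continuous by blast
  then show ?thesis using D(1) continuous_on_eq by blast
qed

lemma piecewise_smooth_arc: "smooth_arc \<gamma> 0 1 \<Longrightarrow> piecewise_smooth \<gamma>"
proof -
  assume \<gamma>: "smooth_arc \<gamma> 0 1"
  show "piecewise_smooth \<gamma>"
    unfolding piecewise_smooth_def
  proof (intro conjI exI[of _ "{0, 1}"] ballI impI)
    show "continuous_on {0..1} \<gamma>" by (rule smooth_arc_continuous[OF \<gamma>])
    fix a b :: real assume "a \<in> {0, 1}" "b \<in> {0, 1}" "a < b \<and> {0, 1} \<inter> {a<..<b} = {}"
    then have "(a = 0 \<or> a = 1) \<and> (b = 0 \<or> b = 1) \<and> a < b" by blast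
    then have "a = 0" "b = 1" by linarith+
    then show "smooth_arc \<gamma> a b" using \<gamma> by simp
  next
    show "finite {0, 1 :: real}" "{0, 1 :: real} \<subseteq> {0, 1}" "{0, 1 :: real} \<subseteq> {0..1}" by simp_all
  qed
qed

lemma piecewise_smoothE:
  assumes "piecewise_smooth \<gamma>"
  obtains S where "continuous_on {0..1} \<gamma>" "finite S" "{0, 1} \<subseteq> S" "S \<subseteq> {0..1}"
    "\<And>a b. a \<in> S \<Longrightarrow> b \<in> S \<Longrightarrow> a < b \<Longrightarrow> S \<inter> {a<..<b} = {} \<Longrightarrow> smooth_arc \<gamma> a b"
proof -
  from assms obtain S where c: "continuous_on {0..1} \<gamma>" and S: "finite S" "{0, 1} \<subseteq> S" "S \<subseteq> {0..1}"
    and arc: "\<forall>a\<in>S. \<forall>b\<in>S. a < b \<and> S \<inter> {a<..<b} = {} \<longrightarrow> smooth_arc \<gamma> a b"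
    unfolding piecewise_smooth_def by (elim conjE exE)
  show thesis
    by (rule that[OF c S]) (rule arc[rule_format, OF _ _ conjI])
qed

lemma piecewise_smooth_reverse:
  assumes "piecewise_smooth \<gamma>"
  shows "piecewise_smooth (\<lambda>t. \<gamma> (1 - t))"
proof -
  obtain S where c: "continuous_on {0..1} \<gamma>" and S: "finite S" "{0, 1} \<subseteq> S" "S \<subseteq> {0..1}"
    "\<And>a b. a \<in> S \<Longrightarrow> b \<in> S \<Longrightarrow> a < b \<Longrightarrow> S \<inter> {a<..<b} = {} \<Longrightarrow> smooth_arc \<gamma> a b"
    by (rule piecewise_smoothE[OF assms]) blast
  let ?T = "(\<lambda>s. 1 - s) ` S"
  have mem: "s \<in> ?T \<longleftrightarrow> 1 - s \<in> S" for s by (auto intro: image_eqI[of _ _ "1 - s"])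
  have "smooth_arc (\<lambda>t. \<gamma> (1 - t)) a b" if ab: "a \<in> ?T" "b \<in> ?T" "a < b" "?T \<inter> {a<..<b} = {}" for a b
  proof -
    have "S \<inter> {1 - b<..<1 - a} = {}"
    proof (rule ccontr)
      assume "S \<inter> {1 - b<..<1 - a} \<noteq> {}"
      then obtain s where "s \<in> S" "1 - b < s" "s < 1 - a" by auto
      then have "1 - s \<in> ?T \<inter> {a<..<b}" by auto
      then show False using ab(4) by blast
    qed
    then have "smooth_arc \<gamma> (1 - b) (1 - a)" using ab(1-3) S(4)[of "1 - b" "1 - a"] unfolding mem by simp
    then have "smooth_arc (\<lambda>t. \<gamma> (- 1 * t + 1)) a b" by (rule smooth_arc_affine) auto
    then show ?thesis by simp
  qed
  moreover have "continuous_on {0..1} (\<lambda>t. \<gamma> (1 - t))"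
    by (rule continuous_on_compose2[OF c]) (auto intro!: continuous_intros)
  ultimately show ?thesis
    unfolding piecewise_smooth_def using S(1-3) by (intro conjI exI[of _ ?T]) (auto simp: mem)
qed

lemma piecewise_smooth_join:
  assumes "piecewise_smooth \<gamma>\<^sub>1" "piecewise_smooth \<gamma>\<^sub>2" and j: "\<gamma>\<^sub>1 1 = \<gamma>\<^sub>2 0"
  shows "piecewise_smooth (\<gamma>\<^sub>1 +++ \<gamma>\<^sub>2)"
proof -
  obtain S where c: "continuous_on {0..1} \<gamma>\<^sub>1" and S: "finite S" "{0, 1} \<subseteq> S" "S \<subseteq> {0..1}"
    "\<And>a b. a \<in> S \<Longrightarrow> b \<in> S \<Longrightarrow> a < b \<Longrightarrow> S \<inter> {a<..<b} = {} \<Longrightarrow> smooth_arc \<gamma>\<^sub>1 a b"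
    by (rule piecewise_smoothE[OF assms(1)]) blast
  obtain R where c': "continuous_on {0..1} \<gamma>\<^sub>2" and R: "finite R" "{0, 1} \<subseteq> R" "R \<subseteq> {0..1}"
    "\<And>a b. a \<in> R \<Longrightarrow> b \<in> R \<Longrightarrow> a < b \<Longrightarrow> R \<inter> {a<..<b} = {} \<Longrightarrow> smooth_arc \<gamma>\<^sub>2 a b"
    by (rule piecewise_smoothE[OF assms(2)]) blast
  define T where "T = (\<lambda>s. s / 2) ` S \<union> (\<lambda>s. (s + 1) / 2) ` R"
  have h: "1 / 2 \<in> T" using S(2) by (auto simp: T_def)
  have m1: "t \<in> T \<longleftrightarrow> 2 * t \<in> S" if "t \<le> 1 / 2" for t
  proof
    assume "t \<in> T"
    then consider s where "s \<in> S" "t = s / 2" | s where "s \<in> R" "t = (s + 1) / 2" by (auto simp: T_def)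
    then show "2 * t \<in> S"
    proof cases
      case 1
      then have "2 * t = s" by simp
      then show ?thesis using 1(1) by simp
    next
      case 2
      then have "s = 0" using that R(3) by force
      then have "2 * t = 1" using 2 by simp
      then show ?thesis using S(2) by simp
    qed
  next
    assume "2 * t \<in> S"
    then show "t \<in> T" unfolding T_def by (intro UnI1 image_eqI[of _ _ "2 * t"]) simp_all
  qed
  have m2: "t \<in> T \<longleftrightarrow> 2 * t - 1 \<in> R" if "1 / 2 \<le> t" for t
  proof
    assume "t \<in> T"
    then consider s where "s \<in> S" "t = s / 2" | s where "s \<in> R" "t = (s + 1) / 2" by (auto simp: T_def)
    then show "2 * t - 1 \<in> R"
    proof cases
      case 1
      then have "s = 1" using that S(3) by force
      then have "2 * t - 1 = 0" using 1 by simp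
      then show ?thesis using R(2) by simp
    next
      case 2
      then have "2 * t - 1 = s" by simp
      then show ?thesis using 2(1) by simp
    qed
  next
    assume "2 * t - 1 \<in> R"
    then show "t \<in> T" unfolding T_def by (intro UnI2 image_eqI[of _ _ "2 * t - 1"]) simp_all
  qed
  have "smooth_arc (\<gamma>\<^sub>1 +++ \<gamma>\<^sub>2) a b" if ab: "a \<in> T" "b \<in> T" "a < b" "T \<inter> {a<..<b} = {}" for a b
  proof -
    \<comment> \<open>The junction is itself a break point, so an interval free of break points lies
      in one half.\<close>
    have "\<not> (a < 1 / 2 \<and> 1 / 2 < b)" using ab(4) h by (metis IntI empty_iff greaterThanLessThan_iff)
    then consider "b \<le> 1 / 2" | "1 / 2 \<le> a" by linarith
    then show ?thesis
    proof cases
      case 1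
      have "S \<inter> {2 * a<..<2 * b} = {}"
      proof (rule ccontr)
        assume "S \<inter> {2 * a<..<2 * b} \<noteq> {}"
        then obtain s where s: "s \<in> S" "2 * a < s" "s < 2 * b" by auto
        then have "s / 2 \<in> T \<inter> {a<..<b}" using 1 m1[of "s / 2"] by simp
        then show False using ab(4) by blast
      qed
      then have "smooth_arc \<gamma>\<^sub>1 (2 * a) (2 * b)" using S(4)[of "2 * a" "2 * b"] ab m1[of a] m1[of b] 1 by simp
      then have "smooth_arc (\<lambda>t. \<gamma>\<^sub>1 (2 * t + 0)) a b" by (rule smooth_arc_affine) auto
      then show ?thesis by (rule smooth_arc_cong) (use 1 in \<open>simp add: joinpaths_def\<close>)
    next
      case 2
      have "R \<inter> {2 * a - 1<..<2 * b - 1} = {}"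
      proof (rule ccontr)
        assume "R \<inter> {2 * a - 1<..<2 * b - 1} \<noteq> {}"
        then obtain s where s: "s \<in> R" "2 * a - 1 < s" "s < 2 * b - 1" by auto
        then have "(s + 1) / 2 \<in> T \<inter> {a<..<b}" using 2 m2[of "(s + 1) / 2"] by (simp add: field_simps)
        then show False using ab(4) by blast
      qed
      then have "smooth_arc \<gamma>\<^sub>2 (2 * a - 1) (2 * b - 1)" using R(4)[of "2 * a - 1" "2 * b - 1"] ab m2[of a] m2[of b] 2 by simp
      then have "smooth_arc (\<lambda>t. \<gamma>\<^sub>2 (2 * t + (- 1))) a b" by (rule smooth_arc_affine) auto
      then show ?thesis
      proof (rule smooth_arc_cong)
        fix t assume t: "t \<in> {a..b}"
        show "(\<gamma>\<^sub>1 +++ \<gamma>\<^sub>2) t = \<gamma>\<^sub>2 (2 * t + (- 1))"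
        proof (cases "t = 1 / 2")
          case True
          show ?thesis unfolding True using j by (simp add: joinpaths_def)
        qed (use t 2 in \<open>simp add: joinpaths_def\<close>)
      qed
    qed
  qed
  moreover have "continuous_on {0..1} (\<gamma>\<^sub>1 +++ \<gamma>\<^sub>2)"
    using path_join_imp[of \<gamma>\<^sub>1 \<gamma>\<^sub>2] c c' j by (simp add: path_def pathfinish_def pathstart_def)
  moreover have "finite T" "T \<subseteq> {0..1}" using S(1,3) R(1,3) by (auto simp: T_def)
  moreover have "{0, 1} \<subseteq> T" using S(2) R(2) m1[of 0] m2[of 1] by simp
  ultimately show ?thesis unfolding piecewise_smooth_def by blast
qed

text \<open>On each arc the derivative is continuous and, as a limit of difference quotients, stays
  in the closed subspace V; the arcs are joined by induction on the number of break points below x.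
  V will be M_1, outside which the 2-norm is not controlled.\<close>

lemma piecewise_smooth_derivative_integrable:
  fixes \<gamma> :: "real \<Rightarrow> 'a::real_normed_vector" and \<nu> :: "'a \<Rightarrow> real"
  assumes ps: "piecewise_smooth \<gamma>" and V: "\<gamma> ` {0..1} \<subseteq> V" "closed V" "subspace V" and \<nu>: "continuous_on V \<nu>"
  obtains S where "finite S" "\<And>t. t \<in> {0<..<1} - S \<Longrightarrow> vector_derivative \<gamma> (at t) \<in> V"
    "\<And>t. t \<in> {0<..<1} - S \<Longrightarrow> (\<gamma> has_vector_derivative vector_derivative \<gamma> (at t)) (at t)"
    "(\<lambda>t. \<nu> (vector_derivative \<gamma> (at t))) integrable_on {0..1}"
proof -
  obtain S where S: "finite S" "{0, 1} \<subseteq> S" "S \<subseteq> {0..1}"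
    "\<And>a b. a \<in> S \<Longrightarrow> b \<in> S \<Longrightarrow> a < b \<Longrightarrow> S \<inter> {a<..<b} = {} \<Longrightarrow> smooth_arc \<gamma> a b"
    by (rule piecewise_smoothE[OF ps]) blast
  have arc: "\<exists>D. continuous_on {a..b} D \<and> D ` {a..b} \<subseteq> V \<and> (\<forall>t\<in>{a<..<b}. (\<gamma> has_vector_derivative D t) (at t))"
    if ab: "a \<in> S" "b \<in> S" "a < b" "S \<inter> {a<..<b} = {}" for a b
  proof -
    have sub: "{a..b} \<subseteq> {0..1}" using ab(1,2) S(3) by auto
    obtain D where D: "\<And>t. t \<in> {a..b} \<Longrightarrow> D 0 t = \<gamma> t"
      "\<And>k t. t \<in> {a..b} \<Longrightarrow> (D k has_vector_derivative D (Suc k) t) (at t within {a..b})"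
      using S(4)[OF ab] unfolding smooth_arc_def by blast
    have "continuous_on {a..b} (D (Suc 0))"
      unfolding continuous_on_eq_continuous_within using D(2) has_vector_derivative_continuous by blast
    moreover have der: "(\<gamma> has_vector_derivative D (Suc 0) t) (at t within {a..b})" if t: "t \<in> {a..b}" for t
      by (rule has_vector_derivative_transform[OF t _ D(2)[OF t]]) (simp add: D(1))
    have "D (Suc 0) t \<in> V" if t: "t \<in> {a..b}" for t
    proof (rule has_vector_derivative_in_closed_subspace[OF der[OF t] _ t _ V(2,3)])
      show "\<gamma> ` {a..b} \<subseteq> V" using V(1) sub by blast
      show "at t within {a..b} \<noteq> bot" using t ab(3) islimpt_Icc trivial_limit_within by blast
    qed
    then have "D (Suc 0) ` {a..b} \<subseteq> V" by blast
    moreover have "(\<gamma> has_vector_derivative D (Suc 0) t) (at t)" if t: "t \<in> {a<..<b}" for t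
    proof -
      have "t \<in> {a..b}" "at t within {a..b} = at t" using t by (auto intro!: at_within_Icc_at)
      then show ?thesis using der[of t] by simp
    qed
    ultimately show ?thesis by blast
  qed
  have pred: "\<exists>a\<in>S. a < x \<and> S \<inter> {a<..<x} = {}" if "0 < x" for x
  proof -
    have f: "finite {s \<in> S. s < x}" "{s \<in> S. s < x} \<noteq> {}" using S(1,2) that by auto
    have "Max {s \<in> S. s < x} \<in> {s \<in> S. s < x}" by (rule Max_in[OF f])
    moreover have "S \<inter> {Max {s \<in> S. s < x}<..<x} = {}"
    proof (rule ccontr)
      assume "S \<inter> {Max {s \<in> S. s < x}<..<x} \<noteq> {}"
      then obtain s where "s \<in> S" "Max {s \<in> S. s < x} < s" "s < x" by auto
      then show False using Max_ge[OF f(1), of s] by simp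
    qed
    ultimately show ?thesis by blast
  qed
  have "(\<lambda>t. \<nu> (vector_derivative \<gamma> (at t))) integrable_on {0..x}
      \<and> (\<forall>t\<in>{0<..<x} - S. vector_derivative \<gamma> (at t) \<in> V \<and> (\<gamma> has_vector_derivative vector_derivative \<gamma> (at t)) (at t))"
    if "x \<in> S" for x
    using that
  proof (induction "card {s \<in> S. s < x}" arbitrary: x rule: less_induct)
    case less
    show ?case
    proof (cases "0 < x")
      case True
      then obtain a where a: "a \<in> S" "a < x" "S \<inter> {a<..<x} = {}" using pred by blast
      have a0: "0 \<le> a" using a(1) S(3) by auto
      have "card {s \<in> S. s < a} < card {s \<in> S. s < x}"
        using S(1) a by (intro psubset_card_mono) auto
      from less(1)[OF this a(1)]
      have IH: "(\<lambda>t. \<nu> (vector_derivative \<gamma> (at t))) integrable_on {0..a}"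
        "\<forall>t\<in>{0<..<a} - S. vector_derivative \<gamma> (at t) \<in> V \<and> (\<gamma> has_vector_derivative vector_derivative \<gamma> (at t)) (at t)" by blast+
      obtain D where D: "continuous_on {a..x} D" "D ` {a..x} \<subseteq> V" "\<And>t. t \<in> {a<..<x} \<Longrightarrow> (\<gamma> has_vector_derivative D t) (at t)"
        using arc[OF a(1) less(2) a(2,3)] by blast
      have vd: "vector_derivative \<gamma> (at t) = D t" if "t \<in> {a<..<x}" for t
        by (rule vector_derivative_at[OF D(3)[OF that]])
      have "continuous_on {a..x} (\<lambda>t. \<nu> (D t))" by (rule continuous_on_compose2[OF \<nu> D(1,2)])
      then have "(\<lambda>t. \<nu> (D t)) integrable_on {a..x}" by (rule integrable_continuous_interval)
      then have "(\<lambda>t. \<nu> (vector_derivative \<gamma> (at t))) integrable_on {a..x}"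
        by (rule integrable_spike_finite[of "{a, x}", rotated 2]) (auto simp: vd)
      with IH(1) have "(\<lambda>t. \<nu> (vector_derivative \<gamma> (at t))) integrable_on {0..x}"
        using a0 a(2) by (intro Henstock_Kurzweil_Integration.integrable_combine[of 0 a x]) simp_all
      moreover have "vector_derivative \<gamma> (at t) \<in> V \<and> (\<gamma> has_vector_derivative vector_derivative \<gamma> (at t)) (at t)"
        if t: "t \<in> {0<..<x} - S" for t
      proof -
        have "t \<noteq> a" using t a(1) by auto
        then consider "t \<in> {0<..<a} - S" | "t \<in> {a<..<x}" using t by fastforce
        then show ?thesis
        proof cases
          case 2
          then have "D t \<in> V" using D(2) by auto
          then show ?thesis using vd[OF 2] D(3)[OF 2] by simp
        qed (use IH(2) in blast)
      qed
      ultimately show ?thesis by blast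
    next
      case False
      then have "x = 0" using less(2) S(3) by force
      then show ?thesis using integrable_on_refl[of _ 0] by simp
    qed
  qed
  from this[of 1] S(1,2) show thesis by (intro that[of S]) auto
qed

context finite_inclusion
begin

lemma closed_M1: "closed M\<^sub>1" and subspace_M1: "subspace M\<^sub>1"
proof -
  show "closed M\<^sub>1" unfolding M1_eq by (rule closed_commutant)
  have "0 \<in> M\<^sub>1" using M1_closed(8)[OF M1_closed(2), of 0] by simp
  then show "subspace M\<^sub>1" by (intro subspaceI M1_closed)
qed

text \<open>Length as a relation with an exceptional finite set: derivatives at break points are
  left open and the others are two-sided, which makes reversal and joining direct. The witness D
  records that velocities lie in M_1.\<close>

definition has_len :: "(real \<Rightarrow> 'h \<Rightarrow>\<^sub>L 'h) \<Rightarrow> real \<Rightarrow> bool" where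
  "has_len \<gamma> L \<longleftrightarrow> (\<exists>S g. finite S \<and> (g has_integral L) {0..1} \<and>
     (\<forall>t\<in>{0<..<1} - S. \<exists>D\<in>M\<^sub>1. (\<gamma> has_vector_derivative D) (at t) \<and> g t = nrm D))"

lemma has_lenE:
  assumes "has_len \<gamma> L"
  obtains S g where "finite S" "(g has_integral L) {0..1}"
    "\<And>t. t \<in> {0<..<1} - S \<Longrightarrow> \<exists>D\<in>M\<^sub>1. (\<gamma> has_vector_derivative D) (at t) \<and> g t = nrm D"
proof -
  from assms obtain S g where S: "finite S" "(g has_integral L) {0..1}"
    and D: "\<forall>t\<in>{0<..<1} - S. \<exists>D\<in>M\<^sub>1. (\<gamma> has_vector_derivative D) (at t) \<and> g t = nrm D"
    unfolding has_len_def by (elim conjE exE)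
  show thesis by (rule that[OF S D[rule_format]])
qed

lemma has_len_exists:
  assumes "piecewise_smooth \<gamma>" "\<gamma> ` {0..1} \<subseteq> M\<^sub>1"
  obtains L where "has_len \<gamma> L"
proof -
  have "continuous_on M\<^sub>1 nrm" using continuous_on_nrm[of M\<^sub>1 "\<lambda>x. x"] by simp
  then obtain S where S: "finite S" "\<And>t. t \<in> {0<..<1} - S \<Longrightarrow> vector_derivative \<gamma> (at t) \<in> M\<^sub>1"
    "\<And>t. t \<in> {0<..<1} - S \<Longrightarrow> (\<gamma> has_vector_derivative vector_derivative \<gamma> (at t)) (at t)"
    "(\<lambda>t. nrm (vector_derivative \<gamma> (at t))) integrable_on {0..1}"
    by (rule piecewise_smooth_derivative_integrable[OF assms closed_M1 subspace_M1]) blast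
  then obtain L where L: "((\<lambda>t. nrm (vector_derivative \<gamma> (at t))) has_integral L) {0..1}" by (auto simp: integrable_on_def)
  have "has_len \<gamma> L"
    unfolding has_len_def
    by (rule exI[of _ S], rule exI[of _ "\<lambda>t. nrm (vector_derivative \<gamma> (at t))"]) (use S(1-3) L in blast)
  then show thesis by (rule that)
qed

lemma has_len_length2:
  assumes "has_len \<gamma> L"
  shows "length2 M\<^sub>1 \<gamma> = L"
proof -
  obtain S g where S: "finite S" "(g has_integral L) {0..1}"
    "\<And>t. t \<in> {0<..<1} - S \<Longrightarrow> \<exists>D\<in>M\<^sub>1. (\<gamma> has_vector_derivative D) (at t) \<and> g t = nrm D"
    by (rule has_lenE[OF assms]) blast
  have "((\<lambda>t. nrm (vector_derivative \<gamma> (at t within {0..1}))) has_integral L) {0..1}"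
  proof (rule has_integral_spike_finite[OF _ _ S(2)])
    show "finite (S \<union> {0, 1})" using S(1) by simp
    fix t assume "t \<in> {0..1} - (S \<union> {0, 1})"
    then have t: "t \<in> {0<..<1} - S" by auto
    then obtain D where D: "(\<gamma> has_vector_derivative D) (at t)" "g t = nrm D" using S(3) by blast
    have "at t within {0..1} = at t" using t by (intro at_within_Icc_at) auto
    then show "nrm (vector_derivative \<gamma> (at t within {0..1})) = g t" using vector_derivative_at[OF D(1)] D(2) by simp
  qed
  then show ?thesis unfolding length2_def by (rule integral_unique)
qed

lemma has_len_reverse:
  assumes "has_len \<gamma> L"
  shows "has_len (\<lambda>t. \<gamma> (1 - t)) L"
proof -
  obtain S g where S: "finite S" "(g has_integral L) {0..1}"
    "\<And>t. t \<in> {0<..<1} - S \<Longrightarrow> \<exists>D\<in>M\<^sub>1. (\<gamma> has_vector_derivative D) (at t) \<and> g t = nrm D"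
    by (rule has_lenE[OF assms]) blast
  have im: "(\<lambda>x::real. 1 - x) ` {0..1} = {0..1}" by (auto intro: image_eqI[of _ _ "1 - x" for x])
  have "((\<lambda>t. g (1 - t)) has_integral L) {0..1}"
    using has_integral_affinity[of g L 0 1 "- 1" 1] S(2) im by (simp add: add.commute)
  moreover have "\<exists>D\<in>M\<^sub>1. ((\<lambda>t. \<gamma> (1 - t)) has_vector_derivative D) (at t) \<and> g (1 - t) = nrm D"
    if t: "t \<in> {0<..<1} - (\<lambda>s. 1 - s) ` S" for t
  proof -
    have "1 - t \<in> {0<..<1} - S" using t by (auto intro: image_eqI[of _ _ "1 - t"])
    then obtain D where D: "D \<in> M\<^sub>1" "(\<gamma> has_vector_derivative D) (at (1 - t))" "g (1 - t) = nrm D" using S(3) by blast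
    have "((\<lambda>t. 1 - t) has_vector_derivative (- 1)) (at t)"
      by (auto intro!: derivative_eq_intros simp: has_real_derivative_iff_has_vector_derivative[symmetric])
    from vector_diff_chain_at[OF this D(2)] have "((\<lambda>t. \<gamma> (1 - t)) has_vector_derivative (- 1) *\<^sub>R D) (at t)"
      by (simp add: o_def)
    moreover have "(- 1) *\<^sub>R D \<in> M\<^sub>1" by (rule M1_closed(8)[OF D(1)])
    moreover have "nrm ((- 1) *\<^sub>R D) = nrm D" using nrm_scaleR[OF D(1), of "- 1"] by simp
    ultimately show ?thesis using D(3) by (intro bexI[of _ "(- 1) *\<^sub>R D"]) simp_all
  qed
  ultimately show ?thesis
    unfolding has_len_def using S(1) by (intro exI[of _ "(\<lambda>s. 1 - s) ` S"] exI[of _ "\<lambda>t. g (1 - t)"]) blast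
qed

lemma has_len_join:
  assumes "has_len \<gamma>\<^sub>1 L\<^sub>1" "has_len \<gamma>\<^sub>2 L\<^sub>2"
  shows "has_len (\<gamma>\<^sub>1 +++ \<gamma>\<^sub>2) (L\<^sub>1 + L\<^sub>2)"
proof -
  obtain S f where S: "finite S" "(f has_integral L\<^sub>1) {0..1}"
    "\<And>t. t \<in> {0<..<1} - S \<Longrightarrow> \<exists>D\<in>M\<^sub>1. (\<gamma>\<^sub>1 has_vector_derivative D) (at t) \<and> f t = nrm D"
    by (rule has_lenE[OF assms(1)]) blast
  obtain R g where R: "finite R" "(g has_integral L\<^sub>2) {0..1}"
    "\<And>t. t \<in> {0<..<1} - R \<Longrightarrow> \<exists>D\<in>M\<^sub>1. (\<gamma>\<^sub>2 has_vector_derivative D) (at t) \<and> g t = nrm D"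
    by (rule has_lenE[OF assms(2)]) blast
  define T where "T = (\<lambda>s. s / 2) ` S \<union> (\<lambda>s. (s + 1) / 2) ` R \<union> {1 / 2}"
  define h where "h = (\<lambda>t. if t \<le> 1 / 2 then 2 * f (2 * t) else 2 * g (2 * t - 1))"
  have "((\<lambda>t. f (2 * t)) has_integral L\<^sub>1 / 2) {0..1 / 2}"
  proof -
    have im: "(\<lambda>x::real. (1 / 2) *\<^sub>R x + - ((1 / 2) *\<^sub>R 0)) ` cbox 0 1 = {0..1 / 2}"
      by (auto intro: image_eqI[of _ _ "2 * x" for x])
    have "(f has_integral L\<^sub>1) (cbox 0 1)" using S(2) by simp
    from has_integral_affinity[OF this, of 2 0, unfolded im] show ?thesis by simp
  qed
  from has_integral_mult_right[OF this, of 2] have "((\<lambda>t. 2 * f (2 * t)) has_integral L\<^sub>1) {0..1 / 2}" by simp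
  then have 1: "(h has_integral L\<^sub>1) {0..1 / 2}"
    by (rule has_integral_spike_finite[of "{}", rotated 2]) (simp_all add: h_def)
  have "((\<lambda>t. g (2 * t - 1)) has_integral L\<^sub>2 / 2) {1 / 2..1}"
  proof -
    have im: "(\<lambda>x::real. (1 / 2) *\<^sub>R x + - ((1 / 2) *\<^sub>R (- 1))) ` cbox 0 1 = {1 / 2..1}"
    proof (intro equalityI subsetI)
      fix x :: real assume "x \<in> {1 / 2..1}"
      then show "x \<in> (\<lambda>x. (1 / 2) *\<^sub>R x + - ((1 / 2) *\<^sub>R (- 1))) ` cbox 0 1"
        by (intro image_eqI[of _ _ "2 * x - 1"]) (simp_all add: field_simps)
    qed auto
    have "(g has_integral L\<^sub>2) (cbox 0 1)" using R(2) by simp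
    from has_integral_affinity[OF this, of 2 "- 1", unfolded im] show ?thesis by simp
  qed
  from has_integral_mult_right[OF this, of 2] have "((\<lambda>t. 2 * g (2 * t - 1)) has_integral L\<^sub>2) {1 / 2..1}" by simp
  then have 2: "(h has_integral L\<^sub>2) {1 / 2..1}"
    by (rule has_integral_spike_finite[of "{1 / 2}", rotated 2]) (auto simp: h_def)
  have "(h has_integral (L\<^sub>1 + L\<^sub>2)) {0..1}" by (rule has_integral_combine[OF _ _ 1 2]) simp_all
  moreover have "\<exists>D\<in>M\<^sub>1. ((\<gamma>\<^sub>1 +++ \<gamma>\<^sub>2) has_vector_derivative D) (at t) \<and> h t = nrm D" if t: "t \<in> {0<..<1} - T" for t
  proof -
    have aff: "((\<lambda>t. 2 * t + c) has_vector_derivative 2) (at t)" for c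
      by (auto intro!: derivative_eq_intros simp: has_real_derivative_iff_has_vector_derivative[symmetric])
    consider "t < 1 / 2" | "1 / 2 < t" using t by (fastforce simp: T_def)
    then show ?thesis
    proof cases
      case 1
      have "2 * t \<notin> S"
      proof
        assume "2 * t \<in> S"
        then have "t \<in> T" unfolding T_def by (intro UnI1 image_eqI[of _ _ "2 * t"]) simp_all
        then show False using t by simp
      qed
      then obtain D where D: "D \<in> M\<^sub>1" "(\<gamma>\<^sub>1 has_vector_derivative D) (at (2 * t))" "f (2 * t) = nrm D"
        using S(3)[of "2 * t"] 1 t by auto
      have "((\<gamma>\<^sub>1 \<circ> (\<lambda>t. 2 * t + 0)) has_vector_derivative 2 *\<^sub>R D) (at t)"
        by (rule vector_diff_chain_at[OF aff]) (simp add: D(2))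
      then have "((\<gamma>\<^sub>1 +++ \<gamma>\<^sub>2) has_vector_derivative 2 *\<^sub>R D) (at t)"
        by (rule has_vector_derivative_transform_within_open[of _ _ _ "{..<1 / 2}"]) (use 1 in \<open>simp_all add: joinpaths_def\<close>)
      moreover have "2 *\<^sub>R D \<in> M\<^sub>1" by (rule M1_closed(8)[OF D(1)])
      ultimately show ?thesis using 1 D(3) nrm_scaleR[OF D(1), of 2] by (intro bexI[of _ "2 *\<^sub>R D"]) (simp_all add: h_def)
    next
      case 2
      have "2 * t - 1 \<notin> R"
      proof
        assume "2 * t - 1 \<in> R"
        then have "t \<in> T" unfolding T_def by (intro UnI1[OF UnI2] image_eqI[of _ _ "2 * t - 1"]) simp_all
        then show False using t by simp
      qed
      then obtain D where D: "D \<in> M\<^sub>1" "(\<gamma>\<^sub>2 has_vector_derivative D) (at (2 * t - 1))" "g (2 * t - 1) = nrm D"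
        using R(3)[of "2 * t - 1"] 2 t by auto
      have "((\<gamma>\<^sub>2 \<circ> (\<lambda>t. 2 * t + (- 1))) has_vector_derivative 2 *\<^sub>R D) (at t)"
        by (rule vector_diff_chain_at[OF aff]) (simp add: D(2))
      then have "((\<gamma>\<^sub>1 +++ \<gamma>\<^sub>2) has_vector_derivative 2 *\<^sub>R D) (at t)"
        by (rule has_vector_derivative_transform_within_open[of _ _ _ "{1 / 2<..}"]) (use 2 in \<open>simp_all add: joinpaths_def\<close>)
      moreover have "2 *\<^sub>R D \<in> M\<^sub>1" by (rule M1_closed(8)[OF D(1)])
      ultimately show ?thesis using 2 D(3) nrm_scaleR[OF D(1), of 2] by (intro bexI[of _ "2 *\<^sub>R D"]) (simp_all add: h_def)
    qed
  qed
  moreover have "finite T" using S(1) R(1) by (simp add: T_def)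
  ultimately show ?thesis unfolding has_len_def by blast
qed

text \<open>Differentiate \<open>t \<mapsto> \<langle>\<delta>, \<gamma> t\<rangle>\<close> for \<open>\<delta> = \<gamma> 1 - \<gamma> 0\<close>. The trace has arbitrary values outside the algebra,
  hence the extension F.\<close>

lemma has_len_lower_bound:
  assumes c: "continuous_on {0..1} \<gamma>" and im: "\<gamma> ` {0..1} \<subseteq> M\<^sub>1" and len: "has_len \<gamma> L"
  shows "nrm (\<gamma> 1 - \<gamma> 0) \<le> L"
proof -
  obtain S g where S: "finite S" "(g has_integral L) {0..1}"
    "\<And>t. t \<in> {0<..<1} - S \<Longrightarrow> \<exists>D\<in>M\<^sub>1. (\<gamma> has_vector_derivative D) (at t) \<and> g t = nrm D"
    by (rule has_lenE[OF len]) blast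
  define \<delta> where "\<delta> = \<gamma> 1 - \<gamma> 0"
  have \<gamma>M: "\<gamma> 0 \<in> M\<^sub>1" "\<gamma> 1 \<in> M\<^sub>1" using im by auto
  then have \<delta>: "\<delta> \<in> M\<^sub>1" unfolding \<delta>_def by (intro M1_closed)
  obtain F where F: "bounded_linear F" "\<And>x. x \<in> M\<^sub>1 \<Longrightarrow> F x = \<tau>\<^sub>1 x" by (rule ultraweakly_continuous_extends[OF tr1(7)]) blast
  define l where "l = (\<lambda>x. Re (F (adj \<delta> o\<^sub>L x)))"
  have l: "l x = ip \<delta> x" if "x \<in> M\<^sub>1" for x
    unfolding l_def ip_def by (subst F(2)) (intro M1_closed \<delta> that refl)+
  have bl: "bounded_linear l"
    unfolding l_def
    by (intro bounded_linear_compose[OF bounded_linear_Re] bounded_linear_compose[OF F(1)]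
        bounded_bilinear.bounded_linear_right[OF bounded_bilinear_blinfun_compose])
  define D where "D = (\<lambda>t. vector_derivative \<gamma> (at t))"
  have D: "D t \<in> M\<^sub>1" "(\<gamma> has_vector_derivative D t) (at t)" "g t = nrm (D t)" if "t \<in> {0<..<1} - S" for t
    using S(3)[OF that] vector_derivative_at[of \<gamma> _ t] by (auto simp: D_def)
  have "((\<lambda>t. l (D t)) has_integral (l (\<gamma> 1) - l (\<gamma> 0))) {0..1}"
  proof (rule fundamental_theorem_of_calculus_interior_strong[OF S(1)])
    show "((\<lambda>t. l (\<gamma> t)) has_vector_derivative l (D t)) (at t)" if "t \<in> {0<..<1} - S" for t
      by (rule bounded_linear.has_vector_derivative[OF bl D(2)[OF that]])
    show "continuous_on {0..1} (\<lambda>t. l (\<gamma> t))" by (rule bounded_linear.continuous_on[OF bl c])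
  qed simp
  moreover have "l (\<gamma> 1) - l (\<gamma> 0) = (nrm \<delta>)\<^sup>2"
    using \<gamma>M \<delta> ip_simps(4)[OF \<gamma>M(2,1) \<delta>] by (simp add: l nrm_square \<delta>_def)
  ultimately have i1: "((\<lambda>t. l (D t)) has_integral (nrm \<delta>)\<^sup>2) {0..1}" by simp
  let ?E = "S \<union> {0, 1}"
  have E: "finite ?E" "\<And>t. t \<in> {0..1} - ?E \<Longrightarrow> t \<in> {0<..<1} - S" using S(1) by auto
  \<comment> \<open>The comparison of integrals is pointwise on the whole interval, while g and the
    derivative are controlled off E only; hence both integrands are set to 0 on E.\<close>
  have j1: "((\<lambda>t. if t \<in> ?E then 0 else l (D t)) has_integral (nrm \<delta>)\<^sup>2) {0..1}"
    by (rule has_integral_spike_finite[OF E(1) _ i1]) simp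
  have j2: "((\<lambda>t. if t \<in> ?E then 0 else g t) has_integral L) {0..1}"
    by (rule has_integral_spike_finite[OF E(1) _ S(2)]) simp
  have "0 \<le> L"
    by (rule has_integral_nonneg[OF j2]) (use E(2) D(1,3) nrm_nonneg in auto)
  have "(nrm \<delta>)\<^sup>2 \<le> nrm \<delta> * L"
  proof (rule has_integral_le[OF j1 has_integral_mult_right[OF j2]])
    fix t :: real assume t: "t \<in> {0..1}"
    show "(if t \<in> ?E then 0 else l (D t)) \<le> nrm \<delta> * (if t \<in> ?E then 0 else g t)"
    proof (cases "t \<in> ?E")
      case False
      then have "t \<in> {0<..<1} - S" using E(2) t by blast
      from D(1,3)[OF this] False show ?thesis using ip_le[OF \<delta>] by (simp add: l)
    qed simp
  qed
  then have "nrm \<delta> \<le> L"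
    using \<open>0 \<le> L\<close> nrm_nonneg[OF \<delta>] by (cases "nrm \<delta> = 0") (simp_all add: power2_eq_square)
  then show ?thesis by (simp only: \<delta>_def)
qed

end

section \<open>Curves of unitaries\<close>

text \<open>Noncommutative polynomials in the generators. By the Leibniz rule they are closed under
  differentiation once derivatives of generators are again such polynomials, as for resolvents; this
  gives all orders of smoothness at once.\<close>

inductive_set function_algebra ::
  "(real \<Rightarrow> 'h::complex_hilbert \<Rightarrow>\<^sub>L 'h) set \<Rightarrow> (real \<Rightarrow> 'h \<Rightarrow>\<^sub>L 'h) set" for G where
  base: "g \<in> G \<Longrightarrow> g \<in> function_algebra G"
| const: "(\<lambda>_. c) \<in> function_algebra G"
| add: "f \<in> function_algebra G \<Longrightarrow> g \<in> function_algebra G \<Longrightarrow> (\<lambda>t. f t + g t) \<in> function_algebra G"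
| comp: "f \<in> function_algebra G \<Longrightarrow> g \<in> function_algebra G \<Longrightarrow> (\<lambda>t. f t o\<^sub>L g t) \<in> function_algebra G"

lemma function_algebra_smooth:
  assumes f: "f \<in> function_algebra G"
    and G: "\<And>g. g \<in> G \<Longrightarrow> \<exists>g'\<in>function_algebra G. \<forall>t\<in>{a..b}. (g has_vector_derivative g' t) (at t within {a..b})"
  shows "smooth_arc f a b"
proof (rule smooth_arcI[OF f])
  fix g assume "g \<in> function_algebra G"
  then show "\<exists>g'\<in>function_algebra G. \<forall>t\<in>{a..b}. (g has_vector_derivative g' t) (at t within {a..b})"
  proof induction
    case (base g)
    then show ?case by (rule G)
  next
    case (const c)
    show ?case by (intro bexI[of _ "\<lambda>_. 0"] ballI function_algebra.const has_vector_derivative_const)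
  next
    case (add f g)
    then obtain f' g' where fg: "f' \<in> function_algebra G" "g' \<in> function_algebra G"
      "\<forall>t\<in>{a..b}. (f has_vector_derivative f' t) (at t within {a..b})"
      "\<forall>t\<in>{a..b}. (g has_vector_derivative g' t) (at t within {a..b})" by blast
    show ?case
      by (intro bexI[of _ "\<lambda>t. f' t + g' t"] ballI function_algebra.add fg(1,2) has_vector_derivative_add)
        (simp_all add: fg(3,4))
  next
    case (comp f g)
    then obtain f' g' where fg: "f' \<in> function_algebra G" "g' \<in> function_algebra G"
      "\<forall>t\<in>{a..b}. (f has_vector_derivative f' t) (at t within {a..b})"
      "\<forall>t\<in>{a..b}. (g has_vector_derivative g' t) (at t within {a..b})" by blast
    show ?case
      by (intro bexI[of _ "\<lambda>t. (f t o\<^sub>L g' t) + (f' t o\<^sub>L g t)"] ballI function_algebra.add function_algebra.comp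
          comp.hyps fg(1,2) bounded_bilinear.has_vector_derivative[OF bounded_bilinear_blinfun_compose])
        (simp_all add: fg(3,4))
  qed
qed

text \<open>The resolvent identity \<open>d\<close> exhibits the difference quotient as
  \<open>R s o\<^sub>L k o\<^sub>L R t\<close>; the uniform norm bound makes R Lipschitz, so s may
  tend to t.\<close>

lemma resolvent_has_vector_derivative:
  fixes k :: "'a::real_normed_vector \<Rightarrow>\<^sub>L 'a"
  assumes R1: "\<And>t. R t o\<^sub>L (id_blinfun - t *\<^sub>R k) = id_blinfun"
    and R2: "\<And>t. (id_blinfun - t *\<^sub>R k) o\<^sub>L R t = id_blinfun" and b: "\<And>t. norm (R t) \<le> 1"
  shows "(R has_vector_derivative (R t o\<^sub>L k o\<^sub>L R t)) (at t within S)"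
proof -
  have d: "R s - R t = (s - t) *\<^sub>R (R s o\<^sub>L k o\<^sub>L R t)" for s t
  proof (rule blinfun_eqI)
    fix x
    define y where "y = R t x"
    have 1: "y - t *\<^sub>R k y = x"
      using arg_cong[OF R2[of t], of "\<lambda>Z. blinfun_apply Z x"] by (simp add: y_def blinfun.diff_left blinfun.scaleR_left)
    have 2: "R s y - s *\<^sub>R R s (k y) = y"
      using arg_cong[OF R1[of s], of "\<lambda>Z. blinfun_apply Z y"]
      by (simp add: blinfun.diff_left blinfun.diff_right blinfun.scaleR_left blinfun.scaleR_right)
    have 3: "R s x = R s y - t *\<^sub>R R s (k y)"
      unfolding 1[symmetric] by (simp add: blinfun.diff_right blinfun.scaleR_right)
    have "R s x - y = (R s y - t *\<^sub>R R s (k y)) - (R s y - s *\<^sub>R R s (k y))" by (simp only: 2 3)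
    then show "(R s - R t) x = ((s - t) *\<^sub>R (R s o\<^sub>L k o\<^sub>L R t)) x"
      by (simp add: y_def blinfun.diff_left blinfun.scaleR_left scaleR_left_diff_distrib)
  qed
  have "norm (R s - R t) \<le> norm k * \<bar>s - t\<bar>" for s t
  proof -
    have "norm (R s o\<^sub>L k o\<^sub>L R t) \<le> norm (R s) * norm k * norm (R t)"
      by (rule order_trans[OF norm_blinfun_compose]) (simp add: mult_right_mono norm_blinfun_compose)
    also have "\<dots> \<le> 1 * norm k * 1" by (intro mult_mono b) simp_all
    finally have "norm (R s o\<^sub>L k o\<^sub>L R t) \<le> norm k" by simp
    from mult_left_mono[OF this, of "\<bar>s - t\<bar>"] show ?thesis unfolding d[of s t] by (simp add: mult.commute)
  qed
  then have "(norm k)-lipschitz_on UNIV R" by (intro lipschitz_onI) (simp_all add: dist_norm)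
  then have "continuous_on UNIV R" by (rule lipschitz_on_continuous_on)
  then have "isCont R t" by (simp add: continuous_on_eq_continuous_at)
  then have "(R \<longlongrightarrow> R t) (at t within S)" unfolding isCont_def by (rule tendsto_within_subset) simp
  then have "((\<lambda>s. R s o\<^sub>L k o\<^sub>L R t) \<longlongrightarrow> (R t o\<^sub>L k o\<^sub>L R t)) (at t within S)"
    by (intro bounded_bilinear.tendsto[OF bounded_bilinear_blinfun_compose] tendsto_const)
  moreover have "\<forall>\<^sub>F s in at t within S. (R s o\<^sub>L k o\<^sub>L R t) = (1 / (s - t)) *\<^sub>R (R s - R t)"
    unfolding eventually_at_filter d by simp
  ultimately have "((\<lambda>s. (1 / (s - t)) *\<^sub>R (R s - R t)) \<longlongrightarrow> (R t o\<^sub>L k o\<^sub>L R t)) (at t within S)"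
    by (rule Lim_transform_eventually)
  then show ?thesis by (simp only: has_vector_derivative_quotient)
qed

context finite_inclusion
begin

lemma M_cb: "M \<subseteq> cbounded_ops"
  using cb(1) by blast

definition admissible :: "('h \<Rightarrow>\<^sub>L 'h) \<Rightarrow> ('h \<Rightarrow>\<^sub>L 'h) \<Rightarrow> (real \<Rightarrow> 'h \<Rightarrow>\<^sub>L 'h) set" where
  "admissible q\<^sub>1 q\<^sub>2 = {\<gamma>. piecewise_smooth \<gamma> \<and> \<gamma> ` {0..1} \<subseteq> Op \<and> \<gamma> 0 = q\<^sub>1 \<and> \<gamma> 1 = q\<^sub>2}"

text \<open>Real bounds on actual curves, which compose under joining; the extended-real infimum is
  reached through them.\<close>

definition reach :: "('h \<Rightarrow>\<^sub>L 'h) \<Rightarrow> ('h \<Rightarrow>\<^sub>L 'h) \<Rightarrow> real \<Rightarrow> bool" where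
  "reach q\<^sub>1 q\<^sub>2 B \<longleftrightarrow> (\<exists>\<gamma>\<in>admissible q\<^sub>1 q\<^sub>2. length2 M\<^sub>1 \<gamma> \<le> B)"

lemma admissibleD:
  assumes "\<gamma> \<in> admissible q\<^sub>1 q\<^sub>2"
  shows "piecewise_smooth \<gamma>" "\<gamma> ` {0..1} \<subseteq> Op" "\<gamma> 0 = q\<^sub>1" "\<gamma> 1 = q\<^sub>2" "has_len \<gamma> (length2 M\<^sub>1 \<gamma>)"
proof -
  show *: "piecewise_smooth \<gamma>" "\<gamma> ` {0..1} \<subseteq> Op" "\<gamma> 0 = q\<^sub>1" "\<gamma> 1 = q\<^sub>2" using assms by (auto simp: admissible_def)
  from *(2) Op_M1 have "\<gamma> ` {0..1} \<subseteq> M\<^sub>1" by (rule subset_trans)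
  then obtain L where "has_len \<gamma> L" by (rule has_len_exists[OF *(1)])
  then show "has_len \<gamma> (length2 M\<^sub>1 \<gamma>)" using has_len_length2 by simp
qed

lemma admissible_reverse:
  assumes "\<gamma> \<in> admissible q\<^sub>1 q\<^sub>2"
  shows "(\<lambda>t. \<gamma> (1 - t)) \<in> admissible q\<^sub>2 q\<^sub>1" "length2 M\<^sub>1 (\<lambda>t. \<gamma> (1 - t)) = length2 M\<^sub>1 \<gamma>"
proof -
  note a = admissibleD[OF assms]
  have "\<gamma> (1 - t) \<in> Op" if "t \<in> {0..1}" for t using a(2) that by (auto simp: image_subset_iff)
  then show "(\<lambda>t. \<gamma> (1 - t)) \<in> admissible q\<^sub>2 q\<^sub>1"
    using piecewise_smooth_reverse[OF a(1)] a(3,4) by (simp add: admissible_def image_subset_iff)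
  show "length2 M\<^sub>1 (\<lambda>t. \<gamma> (1 - t)) = length2 M\<^sub>1 \<gamma>" by (rule has_len_length2[OF has_len_reverse[OF a(5)]])
qed

lemma reach_trans:
  assumes "reach q\<^sub>1 q\<^sub>2 A" "reach q\<^sub>2 q\<^sub>3 B"
  shows "reach q\<^sub>1 q\<^sub>3 (A + B)"
proof -
  obtain \<gamma> \<gamma>' where \<gamma>: "\<gamma> \<in> admissible q\<^sub>1 q\<^sub>2" "length2 M\<^sub>1 \<gamma> \<le> A" and \<gamma>': "\<gamma>' \<in> admissible q\<^sub>2 q\<^sub>3" "length2 M\<^sub>1 \<gamma>' \<le> B"
    using assms unfolding reach_def by blast
  note a = admissibleD[OF \<gamma>(1)] and a' = admissibleD[OF \<gamma>'(1)]
  have "piecewise_smooth (\<gamma> +++ \<gamma>')" by (rule piecewise_smooth_join[OF a(1) a'(1)]) (simp only: a(4) a'(3))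
  moreover have "(\<gamma> +++ \<gamma>') t \<in> Op" if "t \<in> {0..1}" for t
    using that a(2) a'(2) by (auto simp: joinpaths_def image_subset_iff)
  moreover have "(\<gamma> +++ \<gamma>') 0 = q\<^sub>1" "(\<gamma> +++ \<gamma>') 1 = q\<^sub>3" using a(3) a'(4) by (simp_all add: joinpaths_def)
  ultimately have "\<gamma> +++ \<gamma>' \<in> admissible q\<^sub>1 q\<^sub>3" by (simp add: admissible_def image_subset_iff)
  moreover have "length2 M\<^sub>1 (\<gamma> +++ \<gamma>') \<le> A + B"
    unfolding has_len_length2[OF has_len_join[OF a(5) a'(5)]] using \<gamma>(2) \<gamma>'(2) by simp
  ultimately show ?thesis unfolding reach_def by blast
qed

lemma reach_mono: "reach q\<^sub>1 q\<^sub>2 A \<Longrightarrow> A \<le> B \<Longrightarrow> reach q\<^sub>1 q\<^sub>2 B"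
  unfolding reach_def by (meson order_trans)

lemma reach_lower_bound: "reach q\<^sub>1 q\<^sub>2 B \<Longrightarrow> nrm (q\<^sub>1 - q\<^sub>2) \<le> B"
proof -
  assume "reach q\<^sub>1 q\<^sub>2 B"
  then obtain \<gamma> where \<gamma>: "\<gamma> \<in> admissible q\<^sub>1 q\<^sub>2" "length2 M\<^sub>1 \<gamma> \<le> B" unfolding reach_def by blast
  note a = admissibleD[OF \<gamma>(1)]
  have im: "\<gamma> ` {0..1} \<subseteq> M\<^sub>1" using a(2) Op_M1 by (rule subset_trans)
  have c: "continuous_on {0..1} \<gamma>" using a(1) by (simp add: piecewise_smooth_def)
  have m: "q\<^sub>2 - q\<^sub>1 \<in> M\<^sub>1" using im a(3,4) by (intro M1_closed) (auto simp: image_subset_iff)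
  have "nrm ((- 1) *\<^sub>R (q\<^sub>2 - q\<^sub>1)) = nrm (q\<^sub>2 - q\<^sub>1)" using nrm_scaleR[OF m, of "- 1"] by simp
  then have "nrm (q\<^sub>1 - q\<^sub>2) = nrm (\<gamma> 1 - \<gamma> 0)" by (simp add: a(3,4))
  also have "\<dots> \<le> B" using has_len_lower_bound[OF c im a(5)] \<gamma>(2) by simp
  finally show ?thesis .
qed

lemma has_len_upper_bound:
  assumes len: "has_len \<gamma> L" and "0 \<le> B"
    and D: "\<And>t. t \<in> {0..1} \<Longrightarrow> (\<gamma> has_vector_derivative D t) (at t within {0..1})" "\<And>t. t \<in> {0..1} \<Longrightarrow> nrm (D t) \<le> B"
  shows "L \<le> B"
proof -
  obtain S g where S: "finite S" "(g has_integral L) {0..1}"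
    "\<And>t. t \<in> {0<..<1} - S \<Longrightarrow> \<exists>D\<in>M\<^sub>1. (\<gamma> has_vector_derivative D) (at t) \<and> g t = nrm D"
    by (rule has_lenE[OF len]) blast
  let ?E = "S \<union> {0, 1}"
  have fin: "finite ?E" using S(1) by simp
  have j: "((\<lambda>t. if t \<in> ?E then 0 else g t) has_integral L) {0..1}"
    by (rule has_integral_spike_finite[OF fin _ S(2)]) simp
  have c: "((\<lambda>t::real. B) has_integral B) {0..1}" using has_integral_const_real[of B 0 1] by simp
  show ?thesis
  proof (rule has_integral_le[OF j c])
    fix t :: real assume t: "t \<in> {0..1}"
    show "(if t \<in> ?E then 0 else g t) \<le> B"
    proof (cases "t \<in> ?E")
      case False
      then have t': "t \<in> {0<..<1} - S" using t by auto
      then obtain D' where D': "(\<gamma> has_vector_derivative D') (at t)" "g t = nrm D'" using S(3) by blast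
      have "at t within {0..1} = at t" using t' by (intro at_within_Icc_at) auto
      then have "D' = D t" using vector_derivative_at[OF D'(1)] vector_derivative_at[of \<gamma> "D t" t] D(1)[OF t] by simp
      then show ?thesis using D(2)[OF t] D'(2) False by simp
    qed (use \<open>0 \<le> B\<close> in simp)
  qed
qed

text \<open>The curve is the conjugation by the Cayley transforms \<open>(1 + t k) (1 - t k)\<^sup>-\<^sup>1 = 2 R t - 1\<close>, where r is the Cayley transform
  of the bounded skew operator k; the latter exists because \<open>1 + r\<close> is invertible.\<close>

lemma reach_accretive:
  assumes r: "r \<in> unitaries M" and pos: "\<And>x. 0 \<le> inner (blinfun_apply r x) x" and u: "u \<in> unitaries M"
  shows "reach (conj_p u) (conj_p (r o\<^sub>L u)) (4 * sqrt lam * norm (r \<Omega> - \<Omega>))"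
proof -
  have rM: "r \<in> M" and uM: "u \<in> M" using unitariesD(1)[OF r] unitariesD(1)[OF u] .
  note rc = cb(1)[OF rM]
  define T where "T = id_blinfun + r"
  have Tc: "T \<in> cbounded_ops" using rc by (simp add: T_def)
  have aT: "adj T = id_blinfun + adj r" by (simp add: T_def adj_simps rc)
  \<comment> \<open>Nonnegative real part makes 1 + r, and likewise its adjoint, bounded below by 1.
    The inverse S is then a contraction, which keeps the constants free of operator norms of
    k.\<close>
  have acc: "1 * norm x \<le> norm (x + w)" if "0 \<le> inner w x" for x w :: 'h
  proof -
    have "(norm x)\<^sup>2 \<le> (norm (x + w))\<^sup>2"
      using that unfolding power2_norm_eq_inner by (simp add: inner_simps inner_commute[of x w])
    then show ?thesis unfolding mult_1 by (rule power2_le_imp_le) simp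
  qed
  have posa: "0 \<le> inner (adj r x) x" for x
    using pos[of x] unfolding inner_adj[OF rc, of x x] by (subst inner_commute)
  have lT: "1 * norm x \<le> norm (T x)" for x using acc[OF pos[of x]] by (simp add: T_def blinfun.add_left)
  have lT': "1 * norm x \<le> norm (adj T x)" for x unfolding aT using acc[OF posa[of x]] by (simp add: blinfun.add_left)
  obtain S where S: "S \<in> cbounded_ops" "S o\<^sub>L T = id_blinfun" "T o\<^sub>L S = id_blinfun" "norm S \<le> 1 / 1"
    by (rule bounded_below_invertible[OF Tc zero_less_one lT lT']) blast
  have SM: "S \<in> M"
  proof (rule von_neumann_algebraI[OF vN_M])
    fix y assume y: "y \<in> commutant M"
    show "y o\<^sub>L S = S o\<^sub>L y"
      by (rule inverse_commutes[OF S(2,3)], rule commutesI)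
        (simp add: T_def blinfun.add_left blinfun.add_right commutant_apply[OF y rM])
  qed
  have ST: "S x + S (r x) = x" and TS: "S x + r (S x) = x" for x
    using arg_cong[OF S(2), of "\<lambda>Z. blinfun_apply Z x"] arg_cong[OF S(3), of "\<lambda>Z. blinfun_apply Z x"]
    by (simp_all add: T_def blinfun.add_left blinfun.add_right)
  define k where "k = (r - id_blinfun) o\<^sub>L S"
  have kM: "k \<in> M" unfolding k_def by (intro M_closed rM SM)
  note kc = cb(1)[OF kM]
  have kx: "k x = r (S x) - S x" for x by (simp add: k_def blinfun.diff_left)
  have ak: "adj k = - k"
  proof (rule adj_equality)
    fix a b
    define x y where "x = S a" and "y = S b"
    have iso: "cinner (r x) (r y) = cinner x y" by (simp add: cinner_adj[OF rc] unitariesD[OF r])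
    have "cinner (r x - x) (y + r y) = - cinner (x + r x) (r y - y)"
      by (simp add: cinner.add_left cinner.add_right cinner.diff_left cinner.diff_right iso)
    then show "cinner (k a) b = cinner a ((- k) b)"
      by (simp add: x_def y_def TS kx blinfun.minus_left cinner.minus_right cinner.diff_right)
  qed
  have tkM: "t *\<^sub>R k \<in> M" and atk: "adj (t *\<^sub>R k) = - (t *\<^sub>R k)" for t
    by (intro M_closed kM) (simp add: adj_unary kc ak)
  have ex: "\<exists>R. R \<in> M \<and> R o\<^sub>L (id_blinfun - t *\<^sub>R k) = id_blinfun \<and> (id_blinfun - t *\<^sub>R k) o\<^sub>L R = id_blinfun \<and> norm R \<le> 1" for t
    by (rule skew_resolvent[OF vN_M tkM atk]) (intro exI conjI)
  define R where "R = (\<lambda>t. SOME R. R \<in> M \<and> R o\<^sub>L (id_blinfun - t *\<^sub>R k) = id_blinfun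
      \<and> (id_blinfun - t *\<^sub>R k) o\<^sub>L R = id_blinfun \<and> norm R \<le> 1)"
  have Rt: "R t \<in> M \<and> R t o\<^sub>L (id_blinfun - t *\<^sub>R k) = id_blinfun
      \<and> (id_blinfun - t *\<^sub>R k) o\<^sub>L R t = id_blinfun \<and> norm (R t) \<le> 1" for t
    unfolding R_def by (rule someI_ex[OF ex])
  have RM: "R t \<in> M" and R1: "R t o\<^sub>L (id_blinfun - t *\<^sub>R k) = id_blinfun"
    and R2: "(id_blinfun - t *\<^sub>R k) o\<^sub>L R t = id_blinfun" and nR: "norm (R t) \<le> 1" for t
    using Rt[of t] by simp_all
  define Q where "Q = (\<lambda>t. adj (R t))"
  have QM: "Q t \<in> M" for t unfolding Q_def by (intro M_closed RM)
  have nQ: "norm (Q t) \<le> 1" for t using norm_adj_le[OF cb(1)[OF RM[of t]]] nR[of t] by (simp add: Q_def)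
  have Q1: "Q t o\<^sub>L (id_blinfun - t *\<^sub>R (- k)) = id_blinfun" and Q2: "(id_blinfun - t *\<^sub>R (- k)) o\<^sub>L Q t = id_blinfun" for t
    using cayley_unitary(2,3)[OF vN_M tkM atk RM R1 R2, of t] by (simp_all add: Q_def)
  \<comment> \<open>Written with sums and a constant so that the curve is visibly a polynomial in R
    and Q; A t is the Cayley transform of t k and C t its adjoint.\<close>
  define A where "A = (\<lambda>t. R t + R t + (- id_blinfun))"
  define C where "C = (\<lambda>t. Q t + Q t + (- id_blinfun))"
  define q where "q = conj_p u"
  define \<gamma> where "\<gamma> = (\<lambda>t. (A t o\<^sub>L q) o\<^sub>L C t)"
  have A2: "A t = 2 *\<^sub>R R t - id_blinfun" for t by (simp add: A_def scaleR_2)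
  have AU: "A t \<in> unitaries M" for t unfolding A2 by (rule cayley_unitary(1)[OF vN_M tkM atk RM R1 R2])
  note AM = unitariesD(1)[OF AU]
  have aA: "adj (A t) = C t" for t unfolding A2 by (simp add: adj_simps adj_unary cb(1)[OF RM] C_def Q_def scaleR_2)
  have CU: "C t \<in> unitaries M" for t unfolding aA[symmetric] by (rule unitaries_closed(2)[OF vN_M AU])
  have \<gamma>_eq: "\<gamma> t = conj_p (A t o\<^sub>L u)" for t unfolding conj_p_mult[OF AM uM] \<gamma>_def q_def aA ..
  have \<gamma>Op: "\<gamma> t \<in> Op" for t unfolding Op_eq \<gamma>_eq by (intro imageI unitaries_closed(3)[OF vN_M] AU u)
  have dR: "(R has_vector_derivative (R t o\<^sub>L k o\<^sub>L R t)) (at t within X)" for t X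
    by (rule resolvent_has_vector_derivative[OF R1 R2 nR])
  have dQ: "(Q has_vector_derivative (Q t o\<^sub>L (- k) o\<^sub>L Q t)) (at t within X)" for t X
    by (rule resolvent_has_vector_derivative[OF Q1 Q2 nQ])
  let ?F = "function_algebra {R, Q}"
  have RF: "R \<in> ?F" "Q \<in> ?F" by (rule function_algebra.base, simp)+
  have "\<gamma> \<in> ?F" unfolding \<gamma>_def A_def C_def by (intro function_algebra.comp function_algebra.add function_algebra.const RF)
  then have "smooth_arc \<gamma> 0 1"
  proof (rule function_algebra_smooth)
    fix g assume "g \<in> {R, Q}"
    then consider "g = R" | "g = Q" by blast
    then show "\<exists>g'\<in>?F. \<forall>t\<in>{0..1}. (g has_vector_derivative g' t) (at t within {0..1})"
    proof cases
      case 1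
      show ?thesis unfolding 1
        by (rule bexI[of _ "\<lambda>t. R t o\<^sub>L k o\<^sub>L R t"], rule ballI, rule dR)
          (intro function_algebra.comp function_algebra.const RF)
    next
      case 2
      show ?thesis unfolding 2
        by (rule bexI[of _ "\<lambda>t. Q t o\<^sub>L (- k) o\<^sub>L Q t"], rule ballI, rule dQ)
          (intro function_algebra.comp function_algebra.const RF)
    qed
  qed
  then have ps: "piecewise_smooth \<gamma>" by (rule piecewise_smooth_arc)
  have "\<gamma> 0 = conj_p u"
  proof -
    have "R 0 = id_blinfun" using R1[of 0] by simp
    then have "A 0 o\<^sub>L u = u" by (simp add: A_def)
    then show ?thesis by (simp only: \<gamma>_eq)
  qed
  moreover have "\<gamma> 1 = conj_p (r o\<^sub>L u)"
  proof -
    \<comment> \<open>On vectors (1 + r) x one has k (1 + r) x = (r - 1) x, so 1 - k sends them to 2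
      x, and R 1 inverts this.\<close>
    have "A 1 = r"
    proof (rule blinfun_eqI)
      fix x
      have "S (x + r x) = x" by (simp only: blinfun.add_right ST)
      then have "k (x + r x) = r x - x" by (simp only: kx)
      moreover have "R 1 ((x + r x) - k (x + r x)) = x + r x"
        using arg_cong[OF R1[of 1], of "\<lambda>Z. blinfun_apply Z (x + r x)"] by (simp add: blinfun.diff_left)
      ultimately have "R 1 (x + x) = x + r x" by simp
      then show "A 1 x = r x" by (simp add: A_def blinfun.bilinear_simps)
    qed
    then show ?thesis by (simp only: \<gamma>_eq)
  qed
  moreover have "\<gamma> ` {0..1} \<subseteq> Op" using \<gamma>Op by blast
  ultimately have adm: "\<gamma> \<in> admissible (conj_p u) (conj_p (r o\<^sub>L u))" using ps by (simp add: admissible_def)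
  define A' where "A' = (\<lambda>t. (R t o\<^sub>L k o\<^sub>L R t) + (R t o\<^sub>L k o\<^sub>L R t))"
  define C' where "C' = (\<lambda>t. (Q t o\<^sub>L (- k) o\<^sub>L Q t) + (Q t o\<^sub>L (- k) o\<^sub>L Q t))"
  have A'M: "A' t \<in> M" for t unfolding A'_def by (intro M_closed RM kM)
  have aA': "adj (A' t) = C' t" for t
    by (rule blinfun_eqI) (simp add: A'_def C'_def adj_simps cb(1)[OF RM] kc ak Q_def blinfun.add_left)
  have dA: "(A has_vector_derivative A' t) (at t within X)" for t X
    using has_vector_derivative_add[OF has_vector_derivative_add[OF dR dR] has_vector_derivative_const[of "- id_blinfun"], of t X]
    by (simp add: A_def A'_def)
  have dC: "(C has_vector_derivative C' t) (at t within X)" for t X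
    using has_vector_derivative_add[OF has_vector_derivative_add[OF dQ dQ] has_vector_derivative_const[of "- id_blinfun"], of t X]
    by (simp add: C_def C'_def)
  note comp_deriv = bounded_bilinear.has_vector_derivative[OF bounded_bilinear_blinfun_compose]
  define Z where "Z = (\<lambda>t. (A' t o\<^sub>L q) o\<^sub>L C t)"
  have d\<gamma>: "(\<gamma> has_vector_derivative adj (Z t) + Z t) (at t within {0..1})" for t
  proof -
    have "((\<lambda>t. A t o\<^sub>L q) has_vector_derivative (A' t o\<^sub>L q)) (at t within {0..1})"
      using comp_deriv[OF dA has_vector_derivative_const[of q], of t "{0..1}"]
        bounded_bilinear.zero_right[OF bounded_bilinear_blinfun_compose] by simp
    from comp_deriv[OF this dC]
    have "(\<gamma> has_vector_derivative ((A t o\<^sub>L q) o\<^sub>L C' t) + Z t) (at t within {0..1})" by (simp add: \<gamma>_def Z_def)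
    moreover have "(A t o\<^sub>L q) o\<^sub>L C' t = adj (Z t)"
    proof -
      have qc: "q \<in> cbounded_ops" unfolding q_def by (rule M1_cb[OF conj_p_M1[OF u]])
      have "adj (Z t) = adj (C t) o\<^sub>L (adj q o\<^sub>L adj (A' t))"
        unfolding Z_def by (simp add: adj_simps(1) cb(1)[OF A'M] qc cb(1)[OF unitariesD(1)[OF CU]])
      also have "adj (C t) = A t" unfolding aA[symmetric] by (rule adj_adj[OF cb(1)[OF AM]])
      also have "adj q = q" unfolding q_def by (rule conj_p_selfadjoint[OF uM])
      finally show ?thesis unfolding aA' by (intro blinfun_eqI) simp
    qed
    ultimately show ?thesis by simp
  qed
  \<comment> \<open>The constant 4: the derivative of A is 2 R k R, of norm at most twice that of k
    at \<open>\<Omega>\<close>, and the velocity is Z plus its adjoint, of equal 2-norm. Rewriting Z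
    as an element of M times the moving projection makes \<open>nrm_mult_conj_p\<close>
    applicable.\<close>
  have nD: "nrm (adj (Z t) + Z t) \<le> 4 * sqrt lam * norm (r \<Omega> - \<Omega>)" for t
  proof -
    have Ztil: "Z t = (A' t o\<^sub>L C t) o\<^sub>L conj_p (A t o\<^sub>L u)"
      unfolding Z_def conj_p_mult[OF AM uM] aA q_def
      using unitariesD(2)[OF AU[of t]] unfolding aA by (intro blinfun_eqI) simp
    have ACM: "A' t o\<^sub>L C t \<in> M" by (intro M_closed A'M unitariesD(1)[OF CU])
    have AuU: "A t o\<^sub>L u \<in> unitaries M" by (intro unitaries_closed(3)[OF vN_M] AU u)
    have ZM: "Z t \<in> M\<^sub>1" unfolding Ztil by (intro M1_closed in_M1 ACM conj_p_M1 AuU)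
    have kR: "k o\<^sub>L R t = R t o\<^sub>L k"
      by (rule inverse_commutes[OF R1 R2], rule commutesI) (simp add: blinfun.bilinear_simps)
    have Sr: "r o\<^sub>L S = S o\<^sub>L r"
      by (rule inverse_commutes[OF S(2,3)], rule commutesI) (simp add: T_def blinfun.bilinear_simps)
    have c1: "norm (F x) \<le> norm x" if "norm F \<le> 1" for F :: "'h \<Rightarrow>\<^sub>L 'h" and x
      using order_trans[OF norm_blinfun[of F x] mult_right_mono[OF that norm_ge_zero]] by simp
    have "k \<Omega> = S (r \<Omega> - \<Omega>)" unfolding kx commutes_apply[OF Sr] by (simp add: blinfun.diff_right)
    then have nk: "norm (k \<Omega>) \<le> norm (r \<Omega> - \<Omega>)" using c1[of S "r \<Omega> - \<Omega>"] S(4) by simp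
    have "A' t \<Omega> = 2 *\<^sub>R R t (R t (k \<Omega>))"
      by (simp add: A'_def blinfun.add_left scaleR_2 commutes_apply[OF kR])
    moreover have "norm (R t (R t (k \<Omega>))) \<le> norm (k \<Omega>)" by (rule order_trans[OF c1[OF nR] c1[OF nR]])
    ultimately have nA: "norm (A' t \<Omega>) \<le> 2 * norm (r \<Omega> - \<Omega>)" using nk by simp
    have "nrm (Z t) = sqrt lam * norm ((A' t o\<^sub>L C t) \<Omega>)" unfolding Ztil by (rule nrm_mult_conj_p[OF ACM AuU])
    also have "norm ((A' t o\<^sub>L C t) \<Omega>) = norm (A' t \<Omega>)" using norm_mult_unitary_\<Omega>[OF A'M CU] by simp
    finally have "nrm (Z t) \<le> sqrt lam * (2 * norm (r \<Omega> - \<Omega>))" using nA lam(1) by (simp add: mult_left_mono)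
    moreover have "nrm (adj (Z t) + Z t) \<le> nrm (adj (Z t)) + nrm (Z t)" by (rule nrm_triangle[OF M1_closed(1)[OF ZM] ZM])
    ultimately show ?thesis unfolding nrm_adj[OF ZM] by simp
  qed
  have "length2 M\<^sub>1 \<gamma> \<le> 4 * sqrt lam * norm (r \<Omega> - \<Omega>)"
    by (rule has_len_upper_bound[OF admissibleD(5)[OF adm] _ d\<gamma> nD]) (use lam(1) in simp)
  with adm show ?thesis unfolding reach_def by blast
qed

text \<open>A unitary v need not have a bounded Cayley preimage. With e the spectral projection of v for the half plane of
  negative real part, \<open>v (1 - 2 e)\<close> and the square root \<open>1 + (i - 1) e\<close> of \<open>1 - 2 e\<close> do.\<close>

lemma reach_unitary:
  assumes v: "v \<in> unitaries M" and u: "u \<in> unitaries M"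
  shows "reach (conj_p u) (conj_p (v o\<^sub>L u)) (28 * sqrt lam * norm (v \<Omega> - \<Omega>))"
proof -
  note vM = unitariesD(1)[OF v]
  note vc = cb(1)[OF vM]
  have avc: "adj v \<in> cbounded_ops" using vc by blast
  define a where "a = (1 / 2) *\<^sub>R (v + adj v)"
  have aM: "a \<in> M" unfolding a_def by (intro M_closed vM)
  note ac = cb(1)[OF aM]
  have "adj a = a" unfolding a_def by (simp add: adj_unary adj_simps vc avc add.commute)
  then have sa: "selfadjoint a" using selfadjoint_iff_adj[OF ac] by blast
  have na: "norm a \<le> 1"
    using norm_triangle_ineq[of v "adj v"] unitary_norm(2)[OF v M_cb] unitary_norm(2)[OF unitaries_closed(2)[OF vN_M v] M_cb]
    by (simp add: a_def)
  obtain e where e: "e \<in> cbounded_ops" "e o\<^sub>L e = e" "adj e = e" "positive_op (a - 2 *\<^sub>R (a o\<^sub>L e))"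
    "\<And>B. B \<in> cbounded_ops \<Longrightarrow> B o\<^sub>L a = a o\<^sub>L B \<Longrightarrow> B o\<^sub>L e = e o\<^sub>L B"
    by (rule sign_projection[OF ac sa na]) blast
  have eM: "e \<in> M"
    by (rule von_neumann_algebraI[OF vN_M], rule e(5)[OF commutant_cbounded commutant_self_commute[OF aM]])
  have ee: "e (e x) = e x" for x using arg_cong[OF e(2), of "\<lambda>Z. blinfun_apply Z x"] by simp
  have eC: "e (c *\<^sub>C x) = c *\<^sub>C e x" for c x by (rule cboundedD[OF e(1)])
  have ie: "inner (e x) y = inner x (e y)" for x y using inner_adj[OF e(1), of x y] e(3) by simp
  have ve: "v (e x) = e (v x)" for x
    by (rule commutes_apply[OF e(5)[OF vc]], rule commutesI)
      (simp add: a_def blinfun.bilinear_simps unitariesD[OF v])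
  have ce: "0 \<le> inner (a x - 2 *\<^sub>R a (e x)) x" for x
    using e(4) unfolding positive_op_def by (simp add: blinfun.bilinear_simps)
  have va: "inner (v x) x = inner (a x) x" for x
    using inner_adj[OF vc, of x x] by (simp add: a_def blinfun.bilinear_simps inner_simps inner_commute[of x])
  \<comment> \<open>On the range of e the real part of v is at most 0, so v moves
    \<open>e \<Omega>\<close> by at least its norm; since e commutes with v, that displacement is e
    applied to \<open>v \<Omega> - \<Omega>\<close>.\<close>
  have ne: "norm (e \<Omega>) \<le> norm (v \<Omega> - \<Omega>)"
  proof -
    have "inner (v (e \<Omega>)) (e \<Omega>) \<le> 0"
      using ce[of "e \<Omega>"] unfolding va by (simp add: ee inner_diff_left)
    moreover have "norm (v (e \<Omega>)) = norm (e \<Omega>)" by (rule unitary_norm(1)[OF v M_cb])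
    then have "inner (v (e \<Omega>)) (v (e \<Omega>)) = inner (e \<Omega>) (e \<Omega>)" by (simp add: norm_eq)
    moreover have "inner (v (e \<Omega>) - e \<Omega>) (v (e \<Omega>) - e \<Omega>)
        = inner (v (e \<Omega>)) (v (e \<Omega>)) - 2 * inner (v (e \<Omega>)) (e \<Omega>) + inner (e \<Omega>) (e \<Omega>)"
      by (simp add: inner_diff_left inner_diff_right inner_commute[of "e \<Omega>" "v (e \<Omega>)"])
    ultimately have "(norm (e \<Omega>))\<^sup>2 \<le> (norm (v (e \<Omega>) - e \<Omega>))\<^sup>2"
      unfolding power2_norm_eq_inner using inner_ge_zero[of "e \<Omega>"] by linarith
    then have "norm (e \<Omega>) \<le> norm (v (e \<Omega>) - e \<Omega>)" by (rule power2_le_imp_le) simp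
    also have "v (e \<Omega>) - e \<Omega> = e (v \<Omega> - \<Omega>)" by (simp add: ve blinfun.diff_right)
    also have "norm (e y) \<le> norm y" for y
    proof -
      have "norm (e y) * norm (e y) = inner y (e y)" using ie[of y "e y"] by (simp add: ee dot_square_norm power2_eq_square)
      also have "\<dots> \<le> norm y * norm (e y)" by (rule norm_cauchy_schwarz)
      finally show ?thesis by (cases "norm (e y) = 0") simp_all
    qed
    finally show ?thesis .
  qed
  define r where "r = id_blinfun + (scalar_op (\<i> - 1) o\<^sub>L e)"
  have rM: "r \<in> M" unfolding r_def by (intro M_closed eM)
  have rx: "r x = x + (\<i> - 1) *\<^sub>C e x" for x by (simp add: r_def blinfun.add_left)
  have arx: "adj r x = x + (- \<i> - 1) *\<^sub>C e x" for x
    by (simp add: r_def adj_simps adj_scalar_op e(1,3) blinfun.add_left eC)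
  have rU: "r \<in> unitaries M"
  proof (rule unitariesI[OF rM])
    fix x
    have z: "(\<i> - 1) *\<^sub>C e x + ((- \<i> - 1) *\<^sub>C e x + ((- \<i> - 1) * (\<i> - 1)) *\<^sub>C e x) = 0"
      unfolding scaleC_add_left[symmetric] by (simp add: algebra_simps scaleC.zero_left)
    then have z': "(- \<i> - 1) *\<^sub>C e x + ((\<i> - 1) *\<^sub>C e x + ((\<i> - 1) * (- \<i> - 1)) *\<^sub>C e x) = 0"
      unfolding scaleC_add_left[symmetric] by (simp add: algebra_simps scaleC.zero_left)
    show "adj r (r x) = x"
      using z unfolding arx rx by (simp only: blinfun.add_right eC ee scaleC_add_right scaleC_scaleC add.assoc add_0_right)
    show "r (adj r x) = x"
      using z' unfolding arx rx by (simp only: blinfun.add_right eC ee scaleC_add_right scaleC_scaleC add.assoc add_0_right)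
  qed
  have rr: "r (r x) = x - 2 *\<^sub>R e x" for x
  proof -
    have "(\<i> - 1) *\<^sub>C e x + ((\<i> - 1) *\<^sub>C e x + ((\<i> - 1) * (\<i> - 1)) *\<^sub>C e x) = (- complex_of_real 2) *\<^sub>C e x"
      unfolding scaleC_add_left[symmetric] by (simp add: algebra_simps)
    also have "\<dots> = - (2 *\<^sub>R e x)" by (simp only: scaleC.minus_left scaleC_of_real)
    finally show ?thesis
      unfolding rx by (simp only: blinfun.add_right eC ee scaleC_add_right scaleC_scaleC add.assoc diff_conv_add_uminus)
  qed
  have rpos: "0 \<le> inner (r x) x" for x
  proof -
    have "inner ((\<i> - 1) *\<^sub>C e x) x = Re ((\<i> - 1) * cinner (e x) x)" by (simp only: inner_eq_Re_cinner cinner_scaleC_left)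
    also have "cinner (e x) x = complex_of_real ((norm (e x))\<^sup>2)"
      using cinner_adj[OF e(1), of "e x" x] unfolding e(3) ee by (simp only: cinner_self[symmetric])
    finally have "inner (r x) x = inner x x - inner (e x) (e x)"
      unfolding rx by (simp add: inner_add_left power2_norm_eq_inner)
    also have "inner (e x) (e x) = inner (e x) x" using ie[of "e x" x] by (simp add: ee)
    also have "inner x x - inner (e x) x = inner (x - e x) (x - e x)"
      using ie[of x x] ie[of "e x" x] by (simp add: inner_diff_left inner_diff_right ee inner_commute)
    finally show ?thesis by simp
  qed
  \<comment> \<open>The real part of w is the absolute value of a, hence nonnegative. As r has order
    dividing four, w r r gives back v.\<close>
  define w where "w = v o\<^sub>L (r o\<^sub>L r)"
  have wU: "w \<in> unitaries M" unfolding w_def by (intro unitaries_closed(3)[OF vN_M] v rU)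
  have wx: "w x = v x - 2 *\<^sub>R v (e x)" for x by (simp add: w_def rr blinfun.diff_right blinfun.scaleR_right)
  have wpos: "0 \<le> inner (w x) x" for x
  proof -
    have "inner (v (e x)) x = inner (a (e x)) x"
    proof -
      have 1: "inner (v (e x)) x = inner (v (e x)) (e x)" using ie[of "v x" x] ie[of "v (e x)" x] by (simp add: ve ee flip: ie)
      have ae: "a (e x) = e (a x)" by (rule commutes_apply[OF e(5)[OF ac]]) simp
      have 2: "inner (a (e x)) x = inner (a (e x)) (e x)" unfolding ae using ie[of "e (a x)" x] by (simp add: ee)
      show ?thesis unfolding 1 2 by (rule va)
    qed
    then have "inner (w x) x = inner (a x - 2 *\<^sub>R a (e x)) x" by (simp add: wx inner_diff_left va)
    then show ?thesis using ce[of x] by simp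
  qed
  have wrr: "w o\<^sub>L (r o\<^sub>L (r o\<^sub>L u)) = v o\<^sub>L u"
  proof (rule blinfun_eqI)
    fix x
    have "r (r (r (r y))) = y" for y by (simp add: rr blinfun.diff_right blinfun.add_right blinfun.scaleR_right ee scaleR_2)
    then show "(w o\<^sub>L (r o\<^sub>L (r o\<^sub>L u))) x = (v o\<^sub>L u) x" by (simp add: w_def)
  qed
  have ru: "r o\<^sub>L u \<in> unitaries M" and rru: "r o\<^sub>L (r o\<^sub>L u) \<in> unitaries M"
    by (intro unitaries_closed(3)[OF vN_M] rU u)+
  let ?n = "norm (v \<Omega> - \<Omega>)"
  have nr: "norm (r \<Omega> - \<Omega>) \<le> 2 * ?n"
  proof -
    have "norm (r \<Omega> - \<Omega>) = cmod (\<i> - 1) * norm (e \<Omega>)" by (simp add: rx norm_scaleC)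
    also have "\<dots> \<le> 2 * norm (e \<Omega>)" using norm_triangle_ineq4[of \<i> 1] by (intro mult_right_mono) simp_all
    finally show ?thesis using ne by simp
  qed
  have nw: "norm (w \<Omega> - \<Omega>) \<le> 3 * ?n"
  proof -
    have "w \<Omega> - \<Omega> = (v \<Omega> - \<Omega>) - 2 *\<^sub>R v (e \<Omega>)" by (simp add: wx)
    then have "norm (w \<Omega> - \<Omega>) \<le> ?n + norm (2 *\<^sub>R v (e \<Omega>))" by (simp only: norm_triangle_ineq4)
    then show ?thesis using ne by (simp add: unitary_norm(1)[OF v M_cb])
  qed
  \<comment> \<open>Two moves by r, each displacing \<open>\<Omega>\<close> by at most 2 n, and one
    by w, by at most 3 n: the constant 28 is 4 (2 + 2 + 3).\<close>
  have "reach (conj_p u) (conj_p (w o\<^sub>L (r o\<^sub>L (r o\<^sub>L u))))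
      (4 * sqrt lam * norm (r \<Omega> - \<Omega>) + 4 * sqrt lam * norm (r \<Omega> - \<Omega>) + 4 * sqrt lam * norm (w \<Omega> - \<Omega>))"
    by (rule reach_trans[OF reach_trans[OF reach_accretive[OF rU rpos u] reach_accretive[OF rU rpos ru]] reach_accretive[OF wU wpos rru]])
  moreover have "4 * sqrt lam * norm (r \<Omega> - \<Omega>) \<le> 4 * sqrt lam * (2 * ?n)" "4 * sqrt lam * norm (w \<Omega> - \<Omega>) \<le> 4 * sqrt lam * (3 * ?n)"
    using nr nw lam(1) by (intro mult_left_mono; simp)+
  ultimately show ?thesis unfolding wrr by (elim reach_mono) linarith
qed

section \<open>The geodesic distance\<close>

abbreviation od where "od \<equiv> orbit_dist M N \<Omega>"
abbreviation gd where "gd \<equiv> (\<lambda>q\<^sub>1 q\<^sub>2. enn2real (od q\<^sub>1 q\<^sub>2))"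

lemma od_eq: "od q\<^sub>1 q\<^sub>2 = (INF \<gamma>\<in>admissible q\<^sub>1 q\<^sub>2. ennreal (length2 M\<^sub>1 \<gamma>))"
  by (simp only: orbit_dist_def geodesic_dist_def admissible_def)

lemma od_sym: "od q\<^sub>1 q\<^sub>2 = od q\<^sub>2 q\<^sub>1"
proof -
  have "od a b \<le> od b a" for a b
    unfolding od_eq[of b a]
  proof (rule INF_greatest)
    fix \<gamma> assume "\<gamma> \<in> admissible b a"
    note r = admissible_reverse[OF this]
    have "od a b \<le> ennreal (length2 M\<^sub>1 (\<lambda>t. \<gamma> (1 - t)))" unfolding od_eq by (rule INF_lower[OF r(1)])
    then show "od a b \<le> ennreal (length2 M\<^sub>1 \<gamma>)" unfolding r(2) .
  qed
  then show ?thesis by (simp add: order.antisym)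
qed

lemma od_le_reach: "reach q\<^sub>1 q\<^sub>2 B \<Longrightarrow> od q\<^sub>1 q\<^sub>2 \<le> ennreal B"
proof -
  assume "reach q\<^sub>1 q\<^sub>2 B"
  then obtain \<gamma> where \<gamma>: "\<gamma> \<in> admissible q\<^sub>1 q\<^sub>2" "length2 M\<^sub>1 \<gamma> \<le> B" unfolding reach_def by blast
  have "od q\<^sub>1 q\<^sub>2 \<le> ennreal (length2 M\<^sub>1 \<gamma>)" unfolding od_eq by (rule INF_lower[OF \<gamma>(1)])
  also have "\<dots> \<le> ennreal B" by (rule ennreal_leI[OF \<gamma>(2)])
  finally show ?thesis .
qed

text \<open>Apply \<open>reach_unitary\<close> to v times the adjoint of u; right invariance of the
  2-norm identifies its displacement of \<open>\<Omega>\<close> with the distance of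
  \<open>u \<Omega>\<close> and \<open>v \<Omega>\<close>.\<close>

lemma reach_conj_p:
  assumes u: "u \<in> unitaries M" and v: "v \<in> unitaries M"
  shows "reach (conj_p u) (conj_p v) (28 * sqrt lam * norm (u \<Omega> - v \<Omega>))"
proof -
  note uM = unitariesD(1)[OF u] and vM = unitariesD(1)[OF v]
  let ?z = "v o\<^sub>L adj u"
  have z: "?z \<in> unitaries M" by (intro unitaries_closed[OF vN_M] u v)
  have zu: "?z o\<^sub>L u = v" by (rule blinfun_eqI) (simp add: unitariesD[OF u])
  have "?z \<Omega> - \<Omega> = (v - u) (adj u \<Omega>)" by (simp add: blinfun.diff_left unitariesD[OF u])
  also have "norm \<dots> = norm ((v - u) \<Omega>)"
    by (rule norm_mult_unitary_\<Omega>) (intro M_closed vM uM, intro unitaries_closed(2)[OF vN_M] u)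
  finally have n: "norm (?z \<Omega> - \<Omega>) = norm (u \<Omega> - v \<Omega>)" by (simp add: blinfun.diff_left norm_minus_commute)
  from reach_unitary[OF z u] show ?thesis unfolding zu n .
qed

lemma od_finite: "q\<^sub>1 \<in> Op \<Longrightarrow> q\<^sub>2 \<in> Op \<Longrightarrow> od q\<^sub>1 q\<^sub>2 < \<infinity>"
proof -
  assume "q\<^sub>1 \<in> Op" "q\<^sub>2 \<in> Op"
  then obtain u v where uv: "u \<in> unitaries M" "q\<^sub>1 = conj_p u" "v \<in> unitaries M" "q\<^sub>2 = conj_p v" unfolding Op_eq by blast
  from od_le_reach[OF reach_conj_p[OF uv(1,3)]] show ?thesis unfolding uv(2,4) by (rule le_less_trans) simp
qed

lemma gd_le_reach: "reach q\<^sub>1 q\<^sub>2 B \<Longrightarrow> 0 \<le> B \<Longrightarrow> gd q\<^sub>1 q\<^sub>2 \<le> B"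
  using od_le_reach enn2real_leI by blast

text \<open>An infimum need not be attained, hence the slack. Finiteness of the distance makes
  \<open>enn2real\<close> faithful here.\<close>

lemma reach_gd:
  assumes q: "q\<^sub>1 \<in> Op" "q\<^sub>2 \<in> Op" and "0 < \<epsilon>"
  shows "reach q\<^sub>1 q\<^sub>2 (gd q\<^sub>1 q\<^sub>2 + \<epsilon>)"
proof -
  have "od q\<^sub>1 q\<^sub>2 = ennreal (gd q\<^sub>1 q\<^sub>2)" using od_finite[OF q] by simp
  also have "\<dots> < ennreal (gd q\<^sub>1 q\<^sub>2 + \<epsilon>)" using \<open>0 < \<epsilon>\<close> by (intro ennreal_lessI) (simp_all add: add_nonneg_pos)
  finally obtain \<gamma> where \<gamma>: "\<gamma> \<in> admissible q\<^sub>1 q\<^sub>2" "ennreal (length2 M\<^sub>1 \<gamma>) < ennreal (gd q\<^sub>1 q\<^sub>2 + \<epsilon>)"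
    unfolding od_eq[of q\<^sub>1 q\<^sub>2] INF_less_iff by blast
  have "length2 M\<^sub>1 \<gamma> \<le> gd q\<^sub>1 q\<^sub>2 + \<epsilon>"
  proof (rule ccontr)
    assume "\<not> length2 M\<^sub>1 \<gamma> \<le> gd q\<^sub>1 q\<^sub>2 + \<epsilon>"
    then have "ennreal (gd q\<^sub>1 q\<^sub>2 + \<epsilon>) \<le> ennreal (length2 M\<^sub>1 \<gamma>)" by (intro ennreal_leI) simp
    with \<gamma>(2) show False by simp
  qed
  with \<gamma>(1) show ?thesis unfolding reach_def by blast
qed

lemma nrm_le_gd: "q\<^sub>1 \<in> Op \<Longrightarrow> q\<^sub>2 \<in> Op \<Longrightarrow> nrm (q\<^sub>1 - q\<^sub>2) \<le> gd q\<^sub>1 q\<^sub>2"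
  by (rule field_le_epsilon) (rule reach_lower_bound[OF reach_gd])

lemma gd_triangle:
  assumes "q\<^sub>1 \<in> Op" "q\<^sub>2 \<in> Op" "q\<^sub>3 \<in> Op"
  shows "gd q\<^sub>1 q\<^sub>3 \<le> gd q\<^sub>1 q\<^sub>2 + gd q\<^sub>2 q\<^sub>3"
proof (rule field_le_epsilon)
  fix \<epsilon> :: real assume "0 < \<epsilon>"
  then have h: "0 < \<epsilon> / 2" by simp
  have "gd q\<^sub>1 q\<^sub>3 \<le> (gd q\<^sub>1 q\<^sub>2 + \<epsilon> / 2) + (gd q\<^sub>2 q\<^sub>3 + \<epsilon> / 2)"
    using h by (intro gd_le_reach reach_trans[OF reach_gd[OF assms(1,2) h] reach_gd[OF assms(2,3) h]]) (simp add: add_nonneg_nonneg)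
  then show "gd q\<^sub>1 q\<^sub>3 \<le> gd q\<^sub>1 q\<^sub>2 + gd q\<^sub>2 q\<^sub>3 + \<epsilon>" by simp
qed

lemma gd_conj_p_le: "u \<in> unitaries M \<Longrightarrow> v \<in> unitaries M \<Longrightarrow> gd (conj_p u) (conj_p v) \<le> 28 * sqrt lam * norm (u \<Omega> - v \<Omega>)"
  using lam(1) by (intro gd_le_reach reach_conj_p) simp_all

lemma metric_space_Op: "Metric_space Op gd"
proof
  show "0 \<le> gd x y" for x y by simp
  show "gd x y = gd y x" for x y by (simp add: od_sym)
  show "gd x z \<le> gd x y + gd y z" if "x \<in> Op" "y \<in> Op" "z \<in> Op" for x y z by (rule gd_triangle[OF that])
  fix x y assume xy: "x \<in> Op" "y \<in> Op"
  show "gd x y = 0 \<longleftrightarrow> x = y"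
  proof
    assume "gd x y = 0"
    have m: "x - y \<in> M\<^sub>1" using xy Op_M1 by (intro M1_closed) blast+
    have "nrm (x - y) = 0" using nrm_le_gd[OF xy] nrm_nonneg[OF m] \<open>gd x y = 0\<close> by simp
    then have "x - y = 0" by (rule nrm_eq_0[OF m])
    then show "x = y" by simp
  next
    assume "x = y"
    obtain u where u: "u \<in> unitaries M" "x = conj_p u" using xy(1) unfolding Op_eq by blast
    have "gd x y \<le> 0" using gd_conj_p_le[OF u(1) u(1)] unfolding \<open>x = y\<close>[symmetric] u(2) by simp
    then show "gd x y = 0" by (simp add: order.antisym)
  qed
qed

text \<open>The limit is an isometry in any algebra; surjectivity comes from the trace, which gives
  \<open>adj U \<Omega>\<close> the same norm as \<open>U \<Omega>\<close>, namely 1.\<close>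

lemma unitary_strong_limit:
  assumes u: "\<And>n. u n \<in> unitaries M" and "U \<in> M" and lim: "\<And>x. (\<lambda>n. blinfun_apply (u n) x) \<longlonglongrightarrow> blinfun_apply U x"
  shows "U \<in> unitaries M"
proof -
  have iso: "inner (U x) (U y) = inner x y" for x y
  proof (rule LIMSEQ_unique)
    show "(\<lambda>n. inner (u n x) (u n y)) \<longlonglongrightarrow> inner (U x) (U y)" by (intro tendsto_inner lim)
    have "inner (u n x) (u n y) = inner x y" for n
      using inner_adj[OF cb(1)[OF unitariesD(1)[OF u]], of n x "u n y"] by (simp add: unitariesD[OF u])
    then show "(\<lambda>n. inner (u n x) (u n y)) \<longlonglongrightarrow> inner x y" by simp
  qed
  note Uc = cb(1)[OF \<open>U \<in> M\<close>]
  have UU: "adj U (U x) = x" for x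
  proof (rule inner_eqI)
    fix y
    show "inner y (adj U (U x)) = inner y x" using inner_adj[OF Uc, of y "U x"] iso[of y x] by simp
  qed
  have n1: "norm (U \<Omega>) = 1" using iso[of \<Omega> \<Omega>] norm_\<Omega> by (simp add: norm_eq_sqrt_inner)
  have "norm (adj U \<Omega>) = 1" using norm_adj_\<Omega>[OF \<open>U \<in> M\<close>] n1 by simp
  then have i1: "inner (adj U \<Omega>) (adj U \<Omega>) = 1" by (simp add: norm_eq_1)
  have i2: "inner \<Omega> \<Omega> = 1" using norm_\<Omega> by (simp add: norm_eq_1)
  have i3: "inner (U (adj U \<Omega>)) \<Omega> = 1" using inner_adj[OF Uc, of "adj U \<Omega>" \<Omega>] i1 by simp
  \<comment> \<open>Equality in Cauchy-Schwarz: \<open>U (adj U \<Omega>)\<close> and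
    \<open>\<Omega>\<close> are unit vectors with inner product 1. As \<open>\<Omega>\<close>
    separates M, U times its adjoint is 1.\<close>
  have "inner (U (adj U \<Omega>) - \<Omega>) (U (adj U \<Omega>) - \<Omega>) = 0"
    using i3 i2 iso[of "adj U \<Omega>" "adj U \<Omega>"] i1 inner_commute[of \<Omega> "U (adj U \<Omega>)"] by (simp add: inner_diff_left inner_diff_right)
  then have "(U o\<^sub>L adj U) \<Omega> = id_blinfun \<Omega>" by simp
  moreover have "U o\<^sub>L adj U \<in> M" "id_blinfun \<in> M" by (intro M_closed \<open>U \<in> M\<close>)+
  ultimately have "U o\<^sub>L adj U = id_blinfun" by (intro separating)
  from arg_cong[OF this, of "\<lambda>Z. blinfun_apply Z x" for x] have "U (adj U x) = x" for x by simp
  with UU \<open>U \<in> M\<close> show ?thesis by (intro unitariesI)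
qed

lemma lift_step:
  assumes u: "u \<in> unitaries M" and q: "q \<in> Op" and "0 < \<epsilon>" and close: "gd (conj_p u) q < sqrt lam * \<epsilon>"
  obtains v where "v \<in> unitaries M" "conj_p v = q" "norm (u \<Omega> - v \<Omega>) \<le> 2 * \<epsilon>"
proof -
  obtain w where w: "w \<in> unitaries M" "q = conj_p w" using q unfolding Op_eq by blast
  have cu: "conj_p u \<in> Op" using u unfolding Op_eq by blast
  \<comment> \<open>The slack for the lift is chosen equal to the bound on the main term, so the
    squared distance is at most twice the square of \<open>\<epsilon>\<close>.\<close>
  have "0 < \<epsilon>\<^sup>2" using \<open>0 < \<epsilon>\<close> by simp
  from lift_orbit_point[OF u w(1) this] obtain v where v: "v \<in> unitaries M" "conj_p v = conj_p w"
    "(norm (u \<Omega> - v \<Omega>))\<^sup>2 \<le> (nrm (conj_p u - conj_p w))\<^sup>2 / lam + \<epsilon>\<^sup>2" .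
  have m: "conj_p u - conj_p w \<in> M\<^sub>1" by (intro M1_closed conj_p_M1 u w)
  have "nrm (conj_p u - conj_p w) \<le> sqrt lam * \<epsilon>" using nrm_le_gd[OF cu q] close w(2) by simp
  then have "(nrm (conj_p u - conj_p w))\<^sup>2 \<le> (sqrt lam * \<epsilon>)\<^sup>2" by (intro power_mono nrm_nonneg[OF m])
  then have "(nrm (conj_p u - conj_p w))\<^sup>2 / lam \<le> \<epsilon>\<^sup>2"
    using lam(1) by (simp add: power_mult_distrib pos_divide_le_eq mult.commute)
  with v(3) have "(norm (u \<Omega> - v \<Omega>))\<^sup>2 \<le> \<epsilon>\<^sup>2 + \<epsilon>\<^sup>2" by linarith
  also have "\<dots> \<le> (2 * \<epsilon>)\<^sup>2" by (simp add: power_mult_distrib)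
  finally have "norm (u \<Omega> - v \<Omega>) \<le> 2 * \<epsilon>" by (rule power2_le_imp_le) (use \<open>0 < \<epsilon>\<close> in simp)
  then show thesis using that v(1,2) w(2) by simp
qed

lemma mcomplete_Op: "Metric_space.mcomplete Op gd"
proof -
  interpret O: Metric_space Op gd by (rule metric_space_Op)
  show ?thesis
    unfolding O.mcomplete_def
  proof (intro allI impI)
    fix \<sigma> assume \<sigma>: "O.MCauchy \<sigma>"
    have \<sigma>Op: "\<sigma> n \<in> Op" for n using \<sigma> unfolding O.MCauchy_def by blast
    have pos: "0 < sqrt lam * (1 / 2) ^ n" for n :: nat using lam(1) by simp
    have "\<exists>K. \<forall>n n'. K \<le> n \<longrightarrow> K \<le> n' \<longrightarrow> gd (\<sigma> n) (\<sigma> n') < \<epsilon>" if "0 < \<epsilon>" for \<epsilon>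
      using \<sigma> that unfolding O.MCauchy_def by blast
    then have "\<forall>m::nat. \<exists>K. \<forall>n n'. K \<le> n \<longrightarrow> K \<le> n' \<longrightarrow> gd (\<sigma> n) (\<sigma> n') < sqrt lam * (1 / 2) ^ m" using pos by blast
    from choice[OF this] obtain K where K: "\<forall>m n n'. K m \<le> n \<longrightarrow> K m \<le> n' \<longrightarrow> gd (\<sigma> n) (\<sigma> n') < sqrt lam * (1 / 2) ^ m" ..
    \<comment> \<open>A strictly increasing subsequence beyond the thresholds K m. The factor
      \<open>sqrt lam\<close> in those thresholds is the one absorbed by \<open>lift_step\<close>,
      so successive lifts differ by at most 2 (1/2)^m at \<open>\<Omega>\<close>.\<close>
    define r where "r = rec_nat (K 0) (\<lambda>m s. max (Suc s) (K (Suc m)))"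
    have rS: "r (Suc m) = max (Suc (r m)) (K (Suc m))" and r0: "r 0 = K 0" for m by (simp_all add: r_def)
    have sm: "strict_mono r" unfolding strict_mono_Suc_iff rS by (simp add: less_max_iff_disj)
    have Kr: "K m \<le> r m" for m by (cases m) (simp_all add: rS r0)
    have step: "gd (\<sigma> (r m)) (\<sigma> (r (Suc m))) < sqrt lam * (1 / 2) ^ m" for m
    proof -
      have "r m \<le> r (Suc m)" by (simp add: rS)
      then have "K m \<le> r (Suc m)" using Kr[of m] by simp
      with K Kr[of m] show ?thesis by blast
    qed
    let ?P = "\<lambda>n u. u \<in> unitaries M \<and> conj_p u = \<sigma> (r n)"
    let ?Q = "\<lambda>n u v. norm (blinfun_apply u \<Omega> - blinfun_apply v \<Omega>) \<le> 2 * (1 / 2) ^ n"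
    have P0: "\<exists>u. ?P 0 u"
    proof -
      obtain u where "u \<in> unitaries M" "\<sigma> (r 0) = conj_p u" using \<sigma>Op[of "r 0"] unfolding Op_eq by blast
      then show ?thesis by (intro exI[of _ u]) simp
    qed
    \<comment> \<open>Each lift is chosen relative to the preceding one: arbitrary lifts of a Cauchy
      sequence may differ by unitaries of N and need not converge.\<close>
    have PS: "\<exists>v. ?P (Suc n) v \<and> ?Q n u v" if u: "?P n u" for u n
    proof -
      have uM: "u \<in> unitaries M" and c: "gd (conj_p u) (\<sigma> (r (Suc n))) < sqrt lam * (1 / 2) ^ n" using u step[of n] by simp_all
      have h: "0 < (1 / 2 :: real) ^ n" by simp
      obtain v where "v \<in> unitaries M" "conj_p v = \<sigma> (r (Suc n))" "norm (u \<Omega> - v \<Omega>) \<le> 2 * (1 / 2) ^ n"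
        by (rule lift_step[OF uM \<sigma>Op h c])
      then show ?thesis by (intro exI[of _ v]) simp
    qed
    from dependent_nat_choice[of ?P ?Q, OF P0 PS]
    obtain u where u: "\<forall>n. ?P n (u n) \<and> ?Q n (u n) (u (Suc n))" ..
    have uU: "u n \<in> unitaries M" and cu: "conj_p (u n) = \<sigma> (r n)"
      and close: "norm (u n \<Omega> - u (Suc n) \<Omega>) \<le> 2 * (1 / 2) ^ n" for n using u by simp_all
    have "summable (\<lambda>n. norm (u (Suc n) \<Omega> - u n \<Omega>))"
    proof (rule summable_comparison_test')
      show "summable (\<lambda>n. 2 * (1 / 2 :: real) ^ n)" by (intro summable_mult summable_geometric) simp
      show "norm (norm (u (Suc n) \<Omega> - u n \<Omega>)) \<le> 2 * (1 / 2) ^ n" for n using close[of n] by (simp add: norm_minus_commute)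
    qed
    then have "summable (\<lambda>n. u (Suc n) \<Omega> - u n \<Omega>)" by (rule summable_norm_cancel)
    then have "convergent (\<lambda>n. \<Sum>k<n. u (Suc k) \<Omega> - u k \<Omega>)" by (simp only: summable_iff_convergent)
    then have "convergent (\<lambda>n. u n \<Omega> - u 0 \<Omega>)" by (simp only: sum_lessThan_telescope[of "\<lambda>n. u n \<Omega>"])
    then have "convergent (\<lambda>n. u n \<Omega>)" by (simp add: convergent_diff_const_right_iff)
    then obtain \<xi> where \<xi>: "(\<lambda>n. u n \<Omega>) \<longlonglongrightarrow> \<xi>" by (auto simp: convergent_def)
    note bM = von_neumann_algebraD(3)[OF vN_M]
    have ub: "u n \<in> commutant (commutant M)" "norm (u n) \<le> 1" for n
      using unitariesD(1)[OF uU] unitary_norm(2)[OF uU M_cb] bM by simp_all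
    obtain U where U': "U \<in> commutant (commutant M)" and U: "U \<Omega> = \<xi>" "norm U \<le> 1" "\<And>x. (\<lambda>n. u n x) \<longlonglongrightarrow> U x"
      by (rule bounded_orbit_limit[OF M_cb commutant_cyclic(1) ub \<xi>]) blast
    have "U \<in> M" using U' bM by simp
    then have UU: "U \<in> unitaries M" by (rule unitary_strong_limit[OF uU _ U(3)])
    have UOp: "conj_p U \<in> Op" using UU unfolding Op_eq by blast
    have "limitin O.mtopology (\<sigma> \<circ> r) (conj_p U) sequentially"
      unfolding O.limit_metric_sequentially
    proof (intro conjI allI impI UOp)
      fix \<epsilon> :: real assume \<epsilon>: "0 < \<epsilon>"
      have "(\<lambda>n. 28 * sqrt lam * norm (u n \<Omega> - U \<Omega>)) \<longlonglongrightarrow> 28 * sqrt lam * norm (U \<Omega> - U \<Omega>)"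
        by (intro tendsto_intros U(3))
      then have "(\<lambda>n. 28 * sqrt lam * norm (u n \<Omega> - U \<Omega>)) \<longlonglongrightarrow> 0" by simp
      from order_tendstoD(2)[OF this \<epsilon>] obtain k where k: "\<And>n. n \<ge> k \<Longrightarrow> 28 * sqrt lam * norm (u n \<Omega> - U \<Omega>) < \<epsilon>"
        unfolding eventually_sequentially by blast
      have "(\<sigma> \<circ> r) n \<in> Op \<and> gd ((\<sigma> \<circ> r) n) (conj_p U) < \<epsilon>" if "n \<ge> k" for n
        using gd_conj_p_le[OF uU UU, of n] k[OF that] \<sigma>Op[of "r n"] by (simp add: cu)
      then show "\<exists>k. \<forall>n\<ge>k. (\<sigma> \<circ> r) n \<in> Op \<and> gd ((\<sigma> \<circ> r) n) (conj_p U) < \<epsilon>" by blast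
    qed
    from O.MCauchy_convergent_subsequence[OF \<sigma> sm this]
    show "\<exists>x. limitin O.mtopology \<sigma> x sequentially" by blast
  qed
qed

end

theorem theorem3p5:
  fixes N M :: "('h::complex_hilbert \<Rightarrow>\<^sub>L 'h) set" and \<Omega> :: 'h
  assumes "II1_factor N" and "II1_factor M" and "N \<subseteq> M"
    and "acts_on_L2 M \<Omega>"
    and "jones_index M N < \<infinity>"
  defines "Op \<equiv> unitary_orbit M (jones_projection N \<Omega>)"
    and "d \<equiv> (\<lambda>q1 q2. enn2real (orbit_dist M N \<Omega> q1 q2))"
  shows "(\<forall>q1\<in>Op. \<forall>q2\<in>Op. orbit_dist M N \<Omega> q1 q2 < \<infinity>)
    \<and> Metric_space Op d \<and> Metric_space.mcomplete Op d"
proof -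
  \<comment> \<open>Otherwise the index is infinite by the default branch of
    \<open>vN_dim\<close>.\<close>
  have "II1_factor (commutant N)"
  proof (rule ccontr)
    assume "\<not> II1_factor (commutant N)"
    then have "jones_index M N = \<infinity>" by (simp add: jones_index_def vN_dim_def)
    then show False using assms(5) by simp
  qed
  then interpret finite_inclusion N M \<Omega>
    using assms(1-4) by unfold_locales
  show ?thesis
    unfolding Op_def d_def using od_finite metric_space_Op mcomplete_Op by blast
qed

end
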